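(* For each $k\in\{66,44,42,36,28,12\}\cup\{9,27,5,25,7,11,13,17,19\}$, the K3 surface $X_k$ listed in the context is birationally equivalent to a quotient of the Fermat surface $\mathcal{F}_m: x_0^m+x_1^m+x_2^m+x_3^m=0\subset\mathbb{P}^3$ by a finite group of automorphisms of $\mathcal{F}_m$, where $m=k$ if $k\in\{66,44,42,36,28,12\}$ and $m=2k$ if $k\in\{9,27,5,25,7,11,13,17,19\}$.
   Context: $X_k$ denotes the K3 surface which is the smooth minimal projective model of the following affine surface. $k=66$: $y^2=x^3-t(t^{11}+1)$; $k=44$: $y^2=x^3+x+t^{11}$; $k=42$: $y^2=x^3-t^5(t^7+1)$; $k=36$: $y^2=x^3-t^5(t^6+1)$; $k=28$: $y^2=x^3+x+t^7$; $k=12$: $y^2=x^3+t^5(t^2+1)$; $k=19$: $y^2=x^3+t^7x-t$; $k=17$: $y^2=x^3+t^7x-t^2$; $k=13$: $y^2=x^3+t^5x-t$; $k=11$: $y^2=x^3+t^5x-t^2$; $k=7$: $y^2=x^3+t^3x-t^8$; $k=5$: $y^2=x^3+t^3x-t^7$; $k=27$: $y^2=x^3-t(t^9+1)$; $k=9$: $y^2=x^3-t^5(t^3+1)$; $k=25$: $y^2=u^5+uv^5-1$. *)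

theory Defs
  imports
    "HOL-Analysis.Analysis"
    "HOL-Algebra.Bij"
    "HOL-Library.Function_Algebras"
begin

section \<open>Spaces with functions\<close>

text \<open>
  Complex varieties are treated as topological spaces equipped with a sheaf of complex-valued
  functions. \<open>regular X U f\<close> says that \<open>f\<close> is a section over \<open>U\<close>. It is only meaningful for
  open \<open>U\<close> and only depends on the values of \<open>f\<close> on \<open>U\<close>.
\<close>

record 'a fun_space =
  space_top :: "'a topology"
  regular :: "'a set \<Rightarrow> ('a \<Rightarrow> complex) \<Rightarrow> bool"

abbreviation points :: "'a fun_space \<Rightarrow> 'a set" where
  "points X \<equiv> topspace (space_top X)"

definition morphism :: "'a fun_space \<Rightarrow> 'b fun_space \<Rightarrow> ('a \<Rightarrow> 'b) \<Rightarrow> bool" where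
  "morphism X Y \<phi> \<longleftrightarrow>
     continuous_map (space_top X) (space_top Y) \<phi> \<and>
     (\<forall>V h. openin (space_top Y) V \<and> regular Y V h \<longrightarrow>
        regular X {p \<in> points X. \<phi> p \<in> V} (h \<circ> \<phi>))"

definition isomorphism :: "'a fun_space \<Rightarrow> 'b fun_space \<Rightarrow> ('a \<Rightarrow> 'b) \<Rightarrow> bool" where
  "isomorphism X Y \<phi> \<longleftrightarrow>
     morphism X Y \<phi> \<and>
     (\<exists>\<psi>. morphism Y X \<psi> \<and> (\<forall>p \<in> points X. \<psi> (\<phi> p) = p) \<and> (\<forall>q \<in> points Y. \<phi> (\<psi> q) = q))"

definition open_subspace :: "'a fun_space \<Rightarrow> 'a set \<Rightarrow> 'a fun_space" where
  "open_subspace X U = \<lparr>space_top = subtopology (space_top X) U, regular = regular X\<rparr>"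

definition dense_open :: "'a fun_space \<Rightarrow> 'a set \<Rightarrow> bool" where
  "dense_open X U \<longleftrightarrow> openin (space_top X) U \<and> space_top X closure_of U = points X"

definition birational :: "'a fun_space \<Rightarrow> 'b fun_space \<Rightarrow> bool" where
  "birational X Y \<longleftrightarrow>
     (\<exists>U V \<phi>. dense_open X U \<and> dense_open Y V \<and>
        isomorphism (open_subspace X U) (open_subspace Y V) \<phi>)"

definition birational_morphism :: "'a fun_space \<Rightarrow> 'b fun_space \<Rightarrow> ('a \<Rightarrow> 'b) \<Rightarrow> bool" where
  "birational_morphism X Y \<phi> \<longleftrightarrow>
     morphism X Y \<phi> \<and>
     (\<exists>U V. dense_open X U \<and> dense_open Y V \<and>
        isomorphism (open_subspace X U) (open_subspace Y V) \<phi>)"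


section \<open>Automorphism groups and quotients\<close>

definition aut_group :: "'a fun_space \<Rightarrow> ('a \<Rightarrow> 'a) monoid" where
  "aut_group X = (BijGroup (points X))\<lparr>carrier := {g \<in> Bij (points X). isomorphism X X g}\<rparr>"

definition orbit_of :: "('a \<Rightarrow> 'a) set \<Rightarrow> 'a \<Rightarrow> 'a set" where
  "orbit_of G p = (\<lambda>g. g p) ` G"

definition image_topology :: "'a topology \<Rightarrow> ('a \<Rightarrow> 'b) \<Rightarrow> 'b topology" where
  "image_topology T q =
     topology (\<lambda>V. V \<subseteq> q ` topspace T \<and> openin T {p \<in> topspace T. q p \<in> V})"

lemma openin_image_topology:
  "openin (image_topology T q) V \<longleftrightarrow>
     V \<subseteq> q ` topspace T \<and> openin T {p \<in> topspace T. q p \<in> V}"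
proof -
  let ?P = "\<lambda>V. V \<subseteq> q ` topspace T \<and> openin T {p \<in> topspace T. q p \<in> V}"
  have "istopology ?P"
    unfolding istopology_def
  proof (rule conjI)
    show "\<forall>V W. ?P V \<longrightarrow> ?P W \<longrightarrow> ?P (V \<inter> W)"
    proof (intro allI impI)
      fix V W assume V: "?P V" and W: "?P W"
      have "{p \<in> topspace T. q p \<in> V \<inter> W} =
          {p \<in> topspace T. q p \<in> V} \<inter> {p \<in> topspace T. q p \<in> W}" by blast
      with V W show "?P (V \<inter> W)" by (auto intro: openin_Int)
    qed
    show "\<forall>K. (\<forall>V\<in>K. ?P V) \<longrightarrow> ?P (\<Union>K)"
    proof (intro allI impI)
      fix K assume K: "\<forall>V\<in>K. ?P V"
      have "{p \<in> topspace T. q p \<in> \<Union>K} = (\<Union>V\<in>K. {p \<in> topspace T. q p \<in> V})" by blast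
      moreover have "openin T (\<Union>V\<in>K. {p \<in> topspace T. q p \<in> V})"
        using K by blast
      ultimately show "?P (\<Union>K)" using K by auto
    qed
  qed
  then show ?thesis by (simp add: image_topology_def)
qed

text \<open>
  The quotient by a finite group: the orbit set with the quotient topology, the sections over \<open>V\<close>
  being the invariant sections over the preimage of \<open>V\<close>.
\<close>

definition quotient_space :: "'a fun_space \<Rightarrow> ('a \<Rightarrow> 'a) set \<Rightarrow> 'a set fun_space" where
  "quotient_space X G =
     \<lparr>space_top = image_topology (space_top X) (orbit_of G),
      regular = (\<lambda>V h. regular X {p \<in> points X. orbit_of G p \<in> V} (h \<circ> orbit_of G))\<rparr>"


section \<open>Polynomial functions\<close>

text \<open>
  Polynomials in the variables with indices \<open>0, \<dots>, n - 1\<close>, identified with the functions they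
  define, which loses nothing over an infinite field.
\<close>

definition poly_fun :: "nat \<Rightarrow> ((nat \<Rightarrow> complex) \<Rightarrow> complex) \<Rightarrow> bool" where
  "poly_fun n f \<longleftrightarrow>
     (\<exists>A c. finite A \<and> f = (\<lambda>x. \<Sum>\<alpha>\<in>A. c \<alpha> * (\<Prod>i<n. x i ^ (\<alpha> i :: nat))))"

definition hom_poly_fun :: "nat \<Rightarrow> nat \<Rightarrow> ((nat \<Rightarrow> complex) \<Rightarrow> complex) \<Rightarrow> bool" where
  "hom_poly_fun n d f \<longleftrightarrow>
     (\<exists>A c. finite A \<and> (\<forall>\<alpha>\<in>A. (\<Sum>i<n. \<alpha> i) = d) \<and>
        f = (\<lambda>x. \<Sum>\<alpha>\<in>A. c \<alpha> * (\<Prod>i<n. x i ^ (\<alpha> i :: nat))))"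


section \<open>Affine and projective varieties\<close>

definition aff_space :: "nat \<Rightarrow> (nat \<Rightarrow> complex) set" where
  "aff_space n = {a. \<forall>i\<ge>n. a i = 0}"

text \<open>The complements of hypersurfaces form a basis of the Zariski topology.\<close>

definition zariski_aff :: "nat \<Rightarrow> (nat \<Rightarrow> complex) topology" where
  "zariski_aff n = topology_generated_by {{a \<in> aff_space n. f a \<noteq> 0} | f. poly_fun n f}"

definition aff_fun_space :: "nat \<Rightarrow> (nat \<Rightarrow> complex) set \<Rightarrow> (nat \<Rightarrow> complex) fun_space" where
  "aff_fun_space n X =
     \<lparr>space_top = subtopology (zariski_aff n) X,
      regular = (\<lambda>U r. \<forall>p\<in>U. \<exists>W g h.
        openin (subtopology (zariski_aff n) X) W \<and> p \<in> W \<and> W \<subseteq> U \<and>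
        poly_fun n g \<and> poly_fun n h \<and>
        (\<forall>a\<in>W. h a \<noteq> 0 \<and> r a = g a / h a))\<rparr>"

text \<open>
  A point of projective \<open>n\<close>-space is the set of all its homogeneous coordinate vectors.
\<close>

type_synonym proj_point = "(nat \<Rightarrow> complex) set"

definition proj_space :: "nat \<Rightarrow> proj_point set" where
  "proj_space n = {{(\<lambda>i. c * a i) | c. c \<noteq> 0} | a. a \<in> aff_space (Suc n) \<and> a \<noteq> (\<lambda>i. 0)}"

definition zariski_proj :: "nat \<Rightarrow> proj_point topology" where
  "zariski_proj n =
     topology_generated_by
       {{p \<in> proj_space n. \<forall>a\<in>p. f a \<noteq> 0} | f d. hom_poly_fun (Suc n) d f}"

definition proj_fun_space :: "nat \<Rightarrow> proj_point set \<Rightarrow> proj_point fun_space" where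
  "proj_fun_space n X =
     \<lparr>space_top = subtopology (zariski_proj n) X,
      regular = (\<lambda>U r. \<forall>p\<in>U. \<exists>W g h d.
        openin (subtopology (zariski_proj n) X) W \<and> p \<in> W \<and> W \<subseteq> U \<and>
        hom_poly_fun (Suc n) d g \<and> hom_poly_fun (Suc n) d h \<and>
        (\<forall>q\<in>W. \<forall>a\<in>q. h a \<noteq> 0 \<and> r q = g a / h a))\<rparr>"

definition irreducible_top :: "'a topology \<Rightarrow> bool" where
  "irreducible_top T \<longleftrightarrow>
     topspace T \<noteq> {} \<and>
     (\<forall>A B. closedin T A \<and> closedin T B \<and> A \<union> B = topspace T \<longrightarrow>
        A = topspace T \<or> B = topspace T)"

definition irreducible_chain :: "'a topology \<Rightarrow> nat \<Rightarrow> (nat \<Rightarrow> 'a set) \<Rightarrow> bool" where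
  "irreducible_chain T r Z \<longleftrightarrow>
     (\<forall>i\<le>r. closedin T (Z i) \<and> irreducible_top (subtopology T (Z i))) \<and>
     (\<forall>i<r. Z i \<subset> Z (Suc i))"

definition has_krull_dim :: "'a topology \<Rightarrow> nat \<Rightarrow> bool" where
  "has_krull_dim T r \<longleftrightarrow>
     (\<exists>Z. irreducible_chain T r Z) \<and> \<not> (\<exists>Z. irreducible_chain T (Suc r) Z)"

definition proj_variety :: "nat \<Rightarrow> proj_point set \<Rightarrow> bool" where
  "proj_variety n X \<longleftrightarrow>
     closedin (zariski_proj n) X \<and> irreducible_top (subtopology (zariski_proj n) X)"

definition hom_ideal :: "nat \<Rightarrow> proj_point set \<Rightarrow> ((nat \<Rightarrow> complex) \<Rightarrow> complex) set" where
  "hom_ideal n X = {f. (\<exists>d. hom_poly_fun (Suc n) d f) \<and> (\<forall>p\<in>X. \<forall>a\<in>p. f a = 0)}"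

definition gradient :: "((nat \<Rightarrow> complex) \<Rightarrow> complex) \<Rightarrow> (nat \<Rightarrow> complex) \<Rightarrow> nat \<Rightarrow> complex" where
  "gradient f a = (\<lambda>i. deriv (\<lambda>z. f (a(i := z))) (a i))"

text \<open>
  Jacobian criterion: an \<open>r\<close>-dimensional variety in projective \<open>n\<close>-space is smooth if the Jacobian
  matrix of its homogeneous ideal has rank \<open>n - r\<close> at every point.
\<close>

definition smooth_proj_variety :: "nat \<Rightarrow> nat \<Rightarrow> proj_point set \<Rightarrow> bool" where
  "smooth_proj_variety r n X \<longleftrightarrow>
     proj_variety n X \<and> has_krull_dim (subtopology (zariski_proj n) X) r \<and>
     (\<forall>p\<in>X. \<forall>a\<in>p.
        vector_space.dim (\<lambda>(c::complex) v i. c * v i) ((\<lambda>f. gradient f a) ` hom_ideal n X) + r = n)"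

abbreviation smooth_proj_surface :: "nat \<Rightarrow> proj_point set \<Rightarrow> bool" where
  "smooth_proj_surface \<equiv> smooth_proj_variety 2"

text \<open>
  A smooth projective surface is minimal if every birational morphism from it to a smooth
  projective surface is an isomorphism.
\<close>

definition minimal_surface :: "nat \<Rightarrow> proj_point set \<Rightarrow> bool" where
  "minimal_surface n X \<longleftrightarrow>
     smooth_proj_surface n X \<and>
     (\<forall>l Y \<phi>. smooth_proj_surface l Y \<and>
        birational_morphism (proj_fun_space n X) (proj_fun_space l Y) \<phi> \<longrightarrow>
        isomorphism (proj_fun_space n X) (proj_fun_space l Y) \<phi>)"

definition smooth_minimal_proj_model ::
    "nat \<Rightarrow> proj_point set \<Rightarrow> 'a fun_space \<Rightarrow> bool" where
  "smooth_minimal_proj_model n X S \<longleftrightarrow>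
     minimal_surface n X \<and> birational (proj_fun_space n X) S"


section \<open>The surfaces\<close>

definition fermat_surface :: "nat \<Rightarrow> proj_point fun_space" where
  "fermat_surface m =
     proj_fun_space 3 {p \<in> proj_space 3. \<forall>a\<in>p. a 0 ^ m + a 1 ^ m + a 2 ^ m + a 3 ^ m = 0}"

text \<open>For \<open>k = 25\<close> the arguments \<open>x\<close> and \<open>t\<close> play the roles of \<open>u\<close> and \<open>v\<close> in
  \<open>y\<^sup>2 = u\<^sup>5 + u v\<^sup>5 - 1\<close>.\<close>

definition k3_rhs :: "nat \<Rightarrow> complex \<Rightarrow> complex \<Rightarrow> complex" where
  "k3_rhs k x t =
    (if k = 66 then x ^ 3 - t * (t ^ 11 + 1)
     else if k = 44 then x ^ 3 + x + t ^ 11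
     else if k = 42 then x ^ 3 - t ^ 5 * (t ^ 7 + 1)
     else if k = 36 then x ^ 3 - t ^ 5 * (t ^ 6 + 1)
     else if k = 28 then x ^ 3 + x + t ^ 7
     else if k = 12 then x ^ 3 + t ^ 5 * (t ^ 2 + 1)
     else if k = 19 then x ^ 3 + t ^ 7 * x - t
     else if k = 17 then x ^ 3 + t ^ 7 * x - t ^ 2
     else if k = 13 then x ^ 3 + t ^ 5 * x - t
     else if k = 11 then x ^ 3 + t ^ 5 * x - t ^ 2
     else if k = 7 then x ^ 3 + t ^ 3 * x - t ^ 8
     else if k = 5 then x ^ 3 + t ^ 3 * x - t ^ 7
     else if k = 27 then x ^ 3 - t * (t ^ 9 + 1)
     else if k = 9 then x ^ 3 - t ^ 5 * (t ^ 3 + 1)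
     else if k = 25 then x ^ 5 + x * t ^ 5 - 1
     else undefined)"

text \<open>The coordinates \<open>(x, y, t)\<close> of affine 3-space have indices 0, 1, 2.\<close>

definition k3_affine :: "nat \<Rightarrow> (nat \<Rightarrow> complex) fun_space" where
  "k3_affine k = aff_fun_space 3 {a \<in> aff_space 3. a 1 ^ 2 = k3_rhs k (a 0) (a 2)}"

end

theory Submission
  imports Defs
begin

text \<open>
  Each equation \<open>y\<^sup>2 = s\<^sub>1 x^p\<^sub>1 t^q\<^sub>1 + s\<^sub>2 x^p\<^sub>2 t^q\<^sub>2 + s\<^sub>3 x^p\<^sub>3 t^q\<^sub>3\<close> with signs \<open>s\<^sub>i\<close> has exactly
  four monomials: it defines a Delsarte surface. Divided by \<open>y\<^sup>2\<close>, it says that \<open>1\<close> plus three Laurent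
  monomials in \<open>(x, y, t)\<close>, with signs, vanishes; the exponents of these monomials are the rows of a
  \<open>3 \<times> 3\<close> integer matrix \<open>B\<close>. In the coordinates \<open>z\<^sub>i = a\<^sub>i\<^sub>+\<^sub>1 / a\<^sub>0\<close> the Fermat surface is
  \<open>1 + z\<^sub>0^m + z\<^sub>1^m + z\<^sub>2^m = 0\<close>. So a point of the Fermat surface gives a point of the Delsarte surface
  as soon as \<open>(x, y, t)\<close> solves "\<open>i\<close>-th signed Laurent monomial \<open>= z\<^sub>i^m\<close>". Up to constants \<open>c\<close>, the
  solution is a triple of Laurent monomials in \<open>z\<close> with exponent matrix \<open>A = m B\<inverse>\<close>, and the
  arithmetic content of the theorem is that \<open>A\<close> is an integer matrix in all fifteen cases.

  Call the locus where all coordinates are nonzero the torus part. Between the torus parts the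
  monomial map is surjective because \<open>B\<close> inverts it after taking logarithms, and its fibres are the
  orbits of a group of diagonal matrices whose entries are \<open>m\<close>-th roots of unity
  (\<open>cover_surjective\<close>, \<open>cover_fibres\<close>). These matrices act on the Fermat surface and form a finite
  subgroup \<open>G\<close> of its automorphism group (\<open>subgroup_deck_group\<close>).

  A bijection from an orbit space need not be an isomorphism. Here it is one because open sets and
  invariant regular functions descend (\<open>invariant_fraction_descends\<close>): a polynomial in \<open>z\<close> is the sum
  of its components for the characters of \<open>G\<close>; averaging over \<open>G\<close> computes a component; and by
  orthogonality of characters a component is one fixed monomial times a Laurent polynomial in the
  three invariant monomials \<open>x, y, t\<close>. If an invariant function is a fraction of two polynomials, it is
  also the fraction of their components for one character, so the fixed monomial cancels.

  Both torus parts are dense: near any point the coordinates that vanish can be made nonzero, and the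
  equation can be repaired by changing one further coordinate slightly. Hence the affine surface is
  birational to the quotient of the Fermat surface (\<open>birational_fermat_quotient\<close>). A smooth minimal
  projective model is birational to the affine surface, and birationality is transitive
  (\<open>birational_trans\<close>).
\<close>

section \<open>Birational equivalence and quotients\<close>

text \<open>
  Between open subspaces, everything can be said with open subsets of the ambient spaces. This
  removes subtopologies from all later arguments.
\<close>

lemma morphism_open_subspace_iff:
  assumes U: "openin (space_top X) U" and V: "openin (space_top Y) V"
  shows "morphism (open_subspace X U) (open_subspace Y V) \<phi> \<longleftrightarrow>
    \<phi> ` U \<subseteq> V \<and>
    (\<forall>W. openin (space_top Y) W \<and> W \<subseteq> V \<longrightarrow> openin (space_top X) {p \<in> U. \<phi> p \<in> W}) \<and>
    (\<forall>W h. openin (space_top Y) W \<and> W \<subseteq> V \<and> regular Y W h \<longrightarrow>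
       regular X {p \<in> U. \<phi> p \<in> W} (h \<circ> \<phi>))"
proof -
  have [simp]: "topspace (space_top X) \<inter> U = U" "topspace (space_top Y) \<inter> V = V"
    using openin_subset[OF U] openin_subset[OF V] by auto
  show ?thesis
    unfolding morphism_def open_subspace_def continuous_map_def
    by (simp add: openin_open_subtopology[OF U] openin_open_subtopology[OF V] image_subset_iff_funcset)
qed

lemma points_open_subspace:
  assumes "openin (space_top X) U"
  shows "points (open_subspace X U) = U"
  using openin_subset[OF assms] by (auto simp: open_subspace_def)

lemma isomorphism_sym:
  assumes "isomorphism X Y \<phi>"
  shows "\<exists>\<psi>. isomorphism Y X \<psi>"
  using assms unfolding isomorphism_def by blast

lemma birational_sym: "birational X Y \<Longrightarrow> birational Y X"
  unfolding birational_def by (meson isomorphism_sym)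

lemma morphism_compose:
  assumes f: "morphism X Y f" and g: "morphism Y Z g"
  shows "morphism X Z (g \<circ> f)"
proof -
  have "{p \<in> points X. f p \<in> {q \<in> points Y. g q \<in> W}} = {p \<in> points X. (g \<circ> f) p \<in> W}" for W
    using f by (auto simp: morphism_def continuous_map_def)
  moreover have "continuous_map (space_top X) (space_top Z) (g \<circ> f)"
    using f g by (auto simp: morphism_def intro: continuous_map_compose)
  moreover have "regular X {p \<in> points X. f p \<in> {q \<in> points Y. g q \<in> W}} (h \<circ> (g \<circ> f))"
    if "openin (space_top Z) W" "regular Z W h" for W h
  proof -
    have "openin (space_top Y) {q \<in> points Y. g q \<in> W}" "regular Y {q \<in> points Y. g q \<in> W} (h \<circ> g)"
      using g that by (auto simp: morphism_def continuous_map_def)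
    then show ?thesis
      using f unfolding morphism_def comp_assoc[symmetric] by blast
  qed
  ultimately show ?thesis
    unfolding morphism_def by simp
qed

lemma isomorphism_compose:
  assumes "isomorphism X Y f" and "isomorphism Y Z g"
  shows "isomorphism X Z (g \<circ> f)"
proof -
  obtain f' where f': "morphism Y X f'" "\<forall>p\<in>points X. f' (f p) = p" "\<forall>q\<in>points Y. f (f' q) = q"
    using assms(1) unfolding isomorphism_def by blast
  obtain g' where g': "morphism Z Y g'" "\<forall>p\<in>points Y. g' (g p) = p" "\<forall>q\<in>points Z. g (g' q) = q"
    using assms(2) unfolding isomorphism_def by blast
  have fg: "morphism X Y f" "morphism Y Z g"
    using assms unfolding isomorphism_def by blast+
  have "f p \<in> points Y" if "p \<in> points X" for p
    using fg(1) that by (auto simp: morphism_def continuous_map_def)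
  moreover have "g' q \<in> points Y" if "q \<in> points Z" for q
    using g'(1) that by (auto simp: morphism_def continuous_map_def)
  ultimately have "\<forall>p\<in>points X. (f' \<circ> g') ((g \<circ> f) p) = p"
      "\<forall>q\<in>points Z. (g \<circ> f) ((f' \<circ> g') q) = q"
    using f'(2,3) g'(2,3) by simp_all
  then show ?thesis
    unfolding isomorphism_def
    using morphism_compose[OF fg] morphism_compose[OF g'(1) f'(1)] by blast
qed

lemma dense_open_iff:
  "dense_open X U \<longleftrightarrow> openin (space_top X) U \<and>
     (\<forall>N. openin (space_top X) N \<and> N \<noteq> {} \<longrightarrow> U \<inter> N \<noteq> {})"
  unfolding dense_open_def by (simp add: dense_intersects_open)

text \<open>
  Composing birational equivalences requires shrinking the target of an isomorphism to a smaller dense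
  open set. Its preimage is still dense, because every nonempty open subset of the source is carried
  to an open set, which the smaller set meets.
\<close>

lemma isomorphism_restrict:
  assumes iso: "isomorphism (open_subspace X U) (open_subspace Y V) \<phi>"
    and U: "dense_open X U" and V: "openin (space_top Y) V"
    and W: "dense_open Y W" "W \<subseteq> V"
  shows "\<exists>U'. dense_open X U' \<and> isomorphism (open_subspace X U') (open_subspace Y W) \<phi>"
proof -
  have Uo: "openin (space_top X) U" and Wo: "openin (space_top Y) W"
    using U W by (auto simp: dense_open_def)
  note iffs = morphism_open_subspace_iff[OF Uo V] morphism_open_subspace_iff[OF V Uo]
  obtain \<psi> where m: "morphism (open_subspace X U) (open_subspace Y V) \<phi>"
    and n: "morphism (open_subspace Y V) (open_subspace X U) \<psi>"
    and inv: "\<forall>p\<in>U. \<psi> (\<phi> p) = p" "\<forall>q\<in>V. \<phi> (\<psi> q) = q"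
    using iso unfolding isomorphism_def points_open_subspace[OF Uo] points_open_subspace[OF V]
    by blast
  define U' where "U' = {p \<in> U. \<phi> p \<in> W}"
  have U'o: "openin (space_top X) U'"
    using m Wo W(2) unfolding iffs U'_def by blast
  have W_eq: "W = {q \<in> V. \<psi> q \<in> U'}"
    using n inv W(2) unfolding iffs U'_def by (auto simp: image_subset_iff)
  have "dense_open X U'"
    unfolding dense_open_iff
  proof (intro conjI U'o allI impI; elim conjE)
    fix N assume N: "openin (space_top X) N" "N \<noteq> {}"
    then have "openin (space_top X) (U \<inter> N)" "U \<inter> N \<noteq> {}"
      using U by (auto simp: dense_open_iff)
    then have o: "openin (space_top Y) {q \<in> V. \<psi> q \<in> U \<inter> N}"
      using n unfolding iffs by blast
    obtain p where "p \<in> U \<inter> N"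
      using \<open>U \<inter> N \<noteq> {}\<close> by blast
    then have "\<phi> p \<in> {q \<in> V. \<psi> q \<in> U \<inter> N}"
      using m inv unfolding iffs by (auto simp: image_subset_iff)
    then obtain q where "q \<in> W" "q \<in> V" "\<psi> q \<in> U \<inter> N"
      using o W(1) unfolding dense_open_iff by blast
    then show "U' \<inter> N \<noteq> {}"
      using W_eq by blast
  qed
  moreover have "morphism (open_subspace X U') (open_subspace Y W) \<phi>"
  proof -
    have "{p \<in> U'. \<phi> p \<in> N} = {p \<in> U. \<phi> p \<in> N}" if "N \<subseteq> W" for N
      using that by (auto simp: U'_def)
    with m W(2) show ?thesis
      unfolding iffs morphism_open_subspace_iff[OF U'o Wo]
      by (auto simp: U'_def dest: subset_trans)
  qed
  moreover have "morphism (open_subspace Y W) (open_subspace X U') \<psi>"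
  proof -
    have "{q \<in> W. \<psi> q \<in> N} = {q \<in> V. \<psi> q \<in> N}" if "N \<subseteq> U'" for N
      using that W_eq by blast
    moreover have "U' \<subseteq> U" "\<psi> ` W \<subseteq> U'"
      using W_eq by (auto simp: U'_def)
    ultimately show ?thesis
      using n unfolding iffs morphism_open_subspace_iff[OF Wo U'o]
      by (auto dest: subset_trans)
  qed
  moreover have "\<forall>p\<in>U'. \<psi> (\<phi> p) = p" "\<forall>q\<in>W. \<phi> (\<psi> q) = q"
    using inv W(2) by (auto simp: U'_def)
  ultimately have "isomorphism (open_subspace X U') (open_subspace Y W) \<phi>"
    unfolding isomorphism_def points_open_subspace[OF U'o] points_open_subspace[OF Wo]
    by blast
  with \<open>dense_open X U'\<close> show ?thesis
    by blast
qed

lemma dense_open_Int: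
  assumes "dense_open X U" and "dense_open X V"
  shows "dense_open X (U \<inter> V)"
  unfolding dense_open_iff
proof (intro conjI allI impI; (elim conjE)?)
  show "openin (space_top X) (U \<inter> V)"
    using assms by (auto simp: dense_open_iff)
  fix N assume "openin (space_top X) N" "N \<noteq> {}"
  with assms(2) have "openin (space_top X) (V \<inter> N)" "V \<inter> N \<noteq> {}"
    by (auto simp: dense_open_iff)
  with assms(1) have "U \<inter> (V \<inter> N) \<noteq> {}"
    by (auto simp: dense_open_iff)
  then show "U \<inter> V \<inter> N \<noteq> {}"
    by (simp add: Int_assoc)
qed

lemma birational_trans:
  assumes "birational X Y" and "birational Y Z"
  shows "birational X Z"
proof -
  obtain U V \<phi> where 1: "dense_open X U" "dense_open Y V"
      "isomorphism (open_subspace X U) (open_subspace Y V) \<phi>"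
    using assms(1) unfolding birational_def by blast
  obtain V' W \<psi> where 2: "dense_open Z W" "dense_open Y V'"
      "isomorphism (open_subspace Z W) (open_subspace Y V') \<psi>"
    using birational_sym[OF assms(2)] unfolding birational_def by blast
  have d: "dense_open Y (V \<inter> V')"
    using 1 2 by (simp add: dense_open_Int)
  obtain U' where U': "dense_open X U'"
      "isomorphism (open_subspace X U') (open_subspace Y (V \<inter> V')) \<phi>"
    using isomorphism_restrict[OF 1(3) 1(1) _ d] 1(2) by (auto simp: dense_open_def)
  obtain W' where W': "dense_open Z W'"
      "isomorphism (open_subspace Z W') (open_subspace Y (V \<inter> V')) \<psi>"
    using isomorphism_restrict[OF 2(3) 2(1) _ d] 2(2) by (auto simp: dense_open_def)
  obtain \<psi>' where "isomorphism (open_subspace Y (V \<inter> V')) (open_subspace Z W') \<psi>'"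
    using isomorphism_sym[OF W'(2)] by blast
  then show ?thesis
    using isomorphism_compose[OF U'(2)] U'(1) W'(1) unfolding birational_def by blast
qed

text \<open>
  The criterion by which a quotient is recognised: on a dense open set that is a union of orbits, a
  surjection separates exactly the orbits, and both open sets and regular functions on the target are
  detected by pulling them back. The induced bijection then identifies the target with the orbit
  space. The last assumption, that regularity over \<open>U\<close> depends only on the values on \<open>U\<close>, enters because
  the maps between target and orbit space are inverse to each other only over the dense open sets.
\<close>

lemma birational_quotient:
  fixes F :: "'a fun_space" and S :: "'b fun_space" and \<Phi> :: "'a \<Rightarrow> 'b"
  assumes T: "dense_open F T" and T': "dense_open S T'"
    and refl: "\<And>p. p \<in> points F \<Longrightarrow> p \<in> orbit_of G p"
    and inv: "\<And>p. p \<in> T \<Longrightarrow> orbit_of G p \<subseteq> T"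
    and surj: "\<Phi> ` T = T'"
    and fib: "\<And>p q. p \<in> T \<Longrightarrow> q \<in> T \<Longrightarrow> \<Phi> p = \<Phi> q \<longleftrightarrow> orbit_of G p = orbit_of G q"
    and op: "\<And>V. V \<subseteq> T' \<Longrightarrow> openin (space_top S) V \<longleftrightarrow> openin (space_top F) {p \<in> T. \<Phi> p \<in> V}"
    and reg: "\<And>V h. V \<subseteq> T' \<Longrightarrow> openin (space_top S) V \<Longrightarrow>
       regular S V h \<longleftrightarrow> regular F {p \<in> T. \<Phi> p \<in> V} (h \<circ> \<Phi>)"
    and congF: "\<And>U f g. (\<And>p. p \<in> U \<Longrightarrow> f p = g p) \<Longrightarrow> regular F U f \<Longrightarrow> regular F U g"
  shows "birational S (quotient_space F G)"
proof -
  define Q where "Q = quotient_space F G"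
  define \<pi> where "\<pi> = orbit_of G"
  have To: "openin (space_top F) T" and T'o: "openin (space_top S) T'"
    using T T' by (auto simp: dense_open_def)
  have TF: "T \<subseteq> points F"
    using openin_subset[OF To] .
  have sat: "{p \<in> points F. \<pi> p \<in> V} = {p \<in> T. \<pi> p \<in> V}" if "V \<subseteq> \<pi> ` T" for V
  proof -
    have "p \<in> T" if "p \<in> points F" "\<pi> p = \<pi> q" "q \<in> T" for p q
      using refl[OF that(1)] inv[OF that(3)] that(2) by (auto simp: \<pi>_def)
    with that TF show ?thesis by blast
  qed
  have Qo: "openin (space_top Q) V \<longleftrightarrow> openin (space_top F) {p \<in> T. \<pi> p \<in> V}"
    if "V \<subseteq> \<pi> ` T" for V
    using that sat[OF that] TF
    by (auto simp: Q_def quotient_space_def openin_image_topology simp flip: \<pi>_def)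
  have Qr: "regular Q V h \<longleftrightarrow> regular F {p \<in> T. \<pi> p \<in> V} (h \<circ> \<pi>)" if "V \<subseteq> \<pi> ` T" for V h
    using sat[OF that] by (simp add: Q_def quotient_space_def flip: \<pi>_def)
  have Vo: "openin (space_top Q) (\<pi> ` T)"
  proof -
    have "{p \<in> T. \<pi> p \<in> \<pi> ` T} = T" by blast
    then show ?thesis using To by (simp add: Qo)
  qed
  have "dense_open Q (\<pi> ` T)"
    unfolding dense_open_iff
  proof (intro conjI Vo allI impI; elim conjE)
    fix N assume "openin (space_top Q) N" "N \<noteq> {}"
    then have "N \<subseteq> \<pi> ` points F" "openin (space_top F) {p \<in> points F. \<pi> p \<in> N}"
      by (auto simp: Q_def quotient_space_def openin_image_topology simp flip: \<pi>_def)
    with \<open>N \<noteq> {}\<close> have "T \<inter> {p \<in> points F. \<pi> p \<in> N} \<noteq> {}"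
      using T unfolding dense_open_iff by blast
    then show "\<pi> ` T \<inter> N \<noteq> {}" by blast
  qed
  define \<sigma> where "\<sigma> s = (SOME p. p \<in> T \<and> \<Phi> p = s)" for s
  have \<sigma>: "\<sigma> s \<in> T" "\<Phi> (\<sigma> s) = s" if "s \<in> T'" for s
    using someI_ex[of "\<lambda>p. p \<in> T \<and> \<Phi> p = s"] that surj unfolding \<sigma>_def by blast+
  define \<tau> where "\<tau> O' = \<Phi> (SOME p. p \<in> T \<and> \<pi> p = O')" for O'
  have \<tau>: "\<tau> (\<pi> p) = \<Phi> p" if "p \<in> T" for p
    using someI[of "\<lambda>q. q \<in> T \<and> \<pi> q = \<pi> p" p] that fib unfolding \<tau>_def \<pi>_def by blast
  have \<pi>\<sigma>: "\<pi> (\<sigma> (\<Phi> p)) = \<pi> p" if "p \<in> T" for p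
    using \<sigma>[of "\<Phi> p"] that surj fib unfolding \<pi>_def by blast
  have \<Phi>: "\<Phi> p \<in> T'" if "p \<in> T" for p
    using that surj by blast
  have "morphism (open_subspace S T') (open_subspace Q (\<pi> ` T)) (\<pi> \<circ> \<sigma>)"
    unfolding morphism_open_subspace_iff[OF T'o Vo]
  proof (intro conjI allI impI; (elim conjE)?)
    show "(\<pi> \<circ> \<sigma>) ` T' \<subseteq> \<pi> ` T"
      using \<sigma> by auto
    fix W assume W: "openin (space_top Q) W" "W \<subseteq> \<pi> ` T"
    have eq: "{p \<in> T. \<Phi> p \<in> {s \<in> T'. (\<pi> \<circ> \<sigma>) s \<in> W}} = {p \<in> T. \<pi> p \<in> W}"
      using \<pi>\<sigma> \<Phi> by auto
    show o: "openin (space_top S) {s \<in> T'. (\<pi> \<circ> \<sigma>) s \<in> W}"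
    proof (subst op)
      show "openin (space_top F) {p \<in> T. \<Phi> p \<in> {s \<in> T'. (\<pi> \<circ> \<sigma>) s \<in> W}}"
        unfolding eq using W by (simp add: Qo)
    qed blast
    fix h assume "regular Q W h"
    then have r: "regular F {p \<in> T. \<pi> p \<in> W} (h \<circ> \<pi>)"
      using W by (simp add: Qr)
    show "regular S {s \<in> T'. (\<pi> \<circ> \<sigma>) s \<in> W} (h \<circ> (\<pi> \<circ> \<sigma>))"
    proof (subst reg)
      show "regular F {p \<in> T. \<Phi> p \<in> {s \<in> T'. (\<pi> \<circ> \<sigma>) s \<in> W}} (h \<circ> (\<pi> \<circ> \<sigma>) \<circ> \<Phi>)"
        unfolding eq by (rule congF[OF _ r]) (use \<pi>\<sigma> in auto)
    qed (use o in auto)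
  qed
  moreover have "morphism (open_subspace Q (\<pi> ` T)) (open_subspace S T') \<tau>"
    unfolding morphism_open_subspace_iff[OF Vo T'o]
  proof (intro conjI allI impI; (elim conjE)?)
    show "\<tau> ` \<pi> ` T \<subseteq> T'"
      using \<tau> \<Phi> by auto
    fix W assume W: "openin (space_top S) W" "W \<subseteq> T'"
    have eq: "{p \<in> T. \<pi> p \<in> {O' \<in> \<pi> ` T. \<tau> O' \<in> W}} = {p \<in> T. \<Phi> p \<in> W}"
      using \<tau> by auto
    have sub: "{O' \<in> \<pi> ` T. \<tau> O' \<in> W} \<subseteq> \<pi> ` T" by blast
    show "openin (space_top Q) {O' \<in> \<pi> ` T. \<tau> O' \<in> W}"
      using W by (simp only: Qo[OF sub] eq op)
    fix h assume "regular S W h"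
    then have r: "regular F {p \<in> T. \<Phi> p \<in> W} (h \<circ> \<Phi>)"
      using W by (simp add: reg)
    show "regular Q {O' \<in> \<pi> ` T. \<tau> O' \<in> W} (h \<circ> \<tau>)"
      unfolding Qr[OF sub] eq by (rule congF[OF _ r]) (use \<tau> in auto)
  qed
  moreover have "\<forall>s\<in>T'. \<tau> ((\<pi> \<circ> \<sigma>) s) = s" "\<forall>O'\<in>\<pi> ` T. (\<pi> \<circ> \<sigma>) (\<tau> O') = O'"
    using \<tau> \<sigma> \<pi>\<sigma> by auto
  ultimately have "isomorphism (open_subspace S T') (open_subspace Q (\<pi> ` T)) (\<pi> \<circ> \<sigma>)"
    unfolding isomorphism_def points_open_subspace[OF Vo] points_open_subspace[OF T'o] by blast
  with T' \<open>dense_open Q (\<pi> ` T)\<close> show ?thesis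
    unfolding birational_def Q_def by blast
qed

section \<open>Polynomial functions\<close>

text \<open>
  The index set of a polynomial is a set of exponents, so sums and products of polynomials produce
  repeated exponents. Grouping the terms by exponent allows arbitrary index sets.
\<close>

lemma poly_fun_sum_monomials:
  assumes "finite J"
  shows "poly_fun n (\<lambda>x. \<Sum>j\<in>J. c j * (\<Prod>i<n. x i ^ e j i))"
proof -
  have "(\<Sum>j\<in>J. c j * (\<Prod>i<n. x i ^ e j i)) =
      (\<Sum>\<alpha>\<in>e ` J. (\<Sum>j | j \<in> J \<and> e j = \<alpha>. c j) * (\<Prod>i<n. x i ^ \<alpha> i))" for x :: "nat \<Rightarrow> complex"
    by (subst sum.image_gen[OF assms, of _ e]) (auto simp: sum_distrib_right intro!: sum.cong)
  then show ?thesis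
    unfolding poly_fun_def
    by (intro exI[of _ "e ` J"] exI[of _ "\<lambda>\<alpha>. \<Sum>j | j \<in> J \<and> e j = \<alpha>. c j"]) (use assms in auto)
qed

lemma hom_poly_fun_sum_monomials:
  assumes "finite J" and "\<And>j. j \<in> J \<Longrightarrow> (\<Sum>i<n. e j i) = d"
  shows "hom_poly_fun n d (\<lambda>x. \<Sum>j\<in>J. c j * (\<Prod>i<n. x i ^ e j i))"
proof -
  have "(\<Sum>j\<in>J. c j * (\<Prod>i<n. x i ^ e j i)) =
      (\<Sum>\<alpha>\<in>e ` J. (\<Sum>j | j \<in> J \<and> e j = \<alpha>. c j) * (\<Prod>i<n. x i ^ \<alpha> i))" for x :: "nat \<Rightarrow> complex"
    by (subst sum.image_gen[OF assms(1), of _ e]) (auto simp: sum_distrib_right intro!: sum.cong)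
  then show ?thesis
    unfolding hom_poly_fun_def
    by (intro exI[of _ "e ` J"] exI[of _ "\<lambda>\<alpha>. \<Sum>j | j \<in> J \<and> e j = \<alpha>. c j"]) (use assms in auto)
qed

lemma prod_lessThan_single:
  assumes "j < (n::nat)"
  shows "(\<Prod>i<n. x i ^ (if i = j then k else 0)) = (x j ^ k :: 'a :: comm_monoid_mult)"
proof -
  have "(\<Prod>i<n. x i ^ (if i = j then k else 0)) = (\<Prod>i<n. if i = j then x i ^ k else 1)"
    by (rule prod.cong) auto
  with assms show ?thesis by simp
qed

lemma poly_fun_const: "poly_fun n (\<lambda>x. a)"
  using poly_fun_sum_monomials[of "{()}" n "\<lambda>_. a" "\<lambda>_ _. 0"] by simp

lemma poly_fun_coord: "j < n \<Longrightarrow> poly_fun n (\<lambda>x. x j)"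
  using poly_fun_sum_monomials[of "{()}" n "\<lambda>_. 1" "\<lambda>_ i. if i = j then 1 else 0"]
  by (simp add: prod_lessThan_single)

lemma poly_fun_add:
  assumes "poly_fun n f" and "poly_fun n g"
  shows "poly_fun n (\<lambda>x. f x + g x)"
proof -
  obtain A c where A: "finite A" "f = (\<lambda>x. \<Sum>\<alpha>\<in>A. c \<alpha> * (\<Prod>i<n. x i ^ \<alpha> i))"
    using assms(1) unfolding poly_fun_def by blast
  obtain B d where B: "finite B" "g = (\<lambda>x. \<Sum>\<alpha>\<in>B. d \<alpha> * (\<Prod>i<n. x i ^ \<alpha> i))"
    using assms(2) unfolding poly_fun_def by blast
  have "poly_fun n (\<lambda>x. \<Sum>j\<in>A <+> B. case_sum c d j * (\<Prod>i<n. x i ^ case_sum id id j i))"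
    using A B by (intro poly_fun_sum_monomials) auto
  then show ?thesis
    using A B by (simp add: sum.Plus)
qed

lemma hom_poly_fun_add:
  assumes "hom_poly_fun n k f" and "hom_poly_fun n k g"
  shows "hom_poly_fun n k (\<lambda>x. f x + g x)"
proof -
  obtain A c where A: "finite A" "\<forall>\<alpha>\<in>A. (\<Sum>i<n. \<alpha> i) = k"
      "f = (\<lambda>x. \<Sum>\<alpha>\<in>A. c \<alpha> * (\<Prod>i<n. x i ^ \<alpha> i))"
    using assms(1) unfolding hom_poly_fun_def by blast
  obtain B d where B: "finite B" "\<forall>\<alpha>\<in>B. (\<Sum>i<n. \<alpha> i) = k"
      "g = (\<lambda>x. \<Sum>\<alpha>\<in>B. d \<alpha> * (\<Prod>i<n. x i ^ \<alpha> i))"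
    using assms(2) unfolding hom_poly_fun_def by blast
  have "hom_poly_fun n k (\<lambda>x. \<Sum>j\<in>A <+> B. case_sum c d j * (\<Prod>i<n. x i ^ case_sum id id j i))"
    using A B by (intro hom_poly_fun_sum_monomials) auto
  then show ?thesis
    using A B by (simp add: sum.Plus)
qed

lemma sum_monomials_mult:
  fixes x :: "nat \<Rightarrow> complex"
  shows "(\<Sum>\<alpha>\<in>A. c \<alpha> * (\<Prod>i<n. x i ^ \<alpha> i)) * (\<Sum>\<beta>\<in>B. d \<beta> * (\<Prod>i<n. x i ^ \<beta> i)) =
    (\<Sum>j\<in>A \<times> B. (c (fst j) * d (snd j)) * (\<Prod>i<n. x i ^ (fst j i + snd j i)))"
  by (simp add: sum_product sum.cartesian_product case_prod_unfold power_add prod.distrib mult_ac)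

lemma poly_fun_mult:
  assumes "poly_fun n f" and "poly_fun n g"
  shows "poly_fun n (\<lambda>x. f x * g x)"
proof -
  obtain A c where A: "finite A" "f = (\<lambda>x. \<Sum>\<alpha>\<in>A. c \<alpha> * (\<Prod>i<n. x i ^ \<alpha> i))"
    using assms(1) unfolding poly_fun_def by blast
  obtain B d where B: "finite B" "g = (\<lambda>x. \<Sum>\<alpha>\<in>B. d \<alpha> * (\<Prod>i<n. x i ^ \<alpha> i))"
    using assms(2) unfolding poly_fun_def by blast
  show ?thesis
    unfolding A(2) B(2) sum_monomials_mult
    using A B by (intro poly_fun_sum_monomials) auto
qed

lemma hom_poly_fun_mult:
  assumes "hom_poly_fun n k f" and "hom_poly_fun n l g"
  shows "hom_poly_fun n (k + l) (\<lambda>x. f x * g x)"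
proof -
  obtain A c where A: "finite A" "\<forall>\<alpha>\<in>A. (\<Sum>i<n. \<alpha> i) = k"
      "f = (\<lambda>x. \<Sum>\<alpha>\<in>A. c \<alpha> * (\<Prod>i<n. x i ^ \<alpha> i))"
    using assms(1) unfolding hom_poly_fun_def by blast
  obtain B d where B: "finite B" "\<forall>\<alpha>\<in>B. (\<Sum>i<n. \<alpha> i) = l"
      "g = (\<lambda>x. \<Sum>\<alpha>\<in>B. d \<alpha> * (\<Prod>i<n. x i ^ \<alpha> i))"
    using assms(2) unfolding hom_poly_fun_def by blast
  show ?thesis
    unfolding A(3) B(3) sum_monomials_mult
    using A B by (intro hom_poly_fun_sum_monomials) (auto simp: sum.distrib)
qed

lemma poly_fun_power: "poly_fun n f \<Longrightarrow> poly_fun n (\<lambda>x. f x ^ k)"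
  by (induction k) (auto intro: poly_fun_const poly_fun_mult)

lemma poly_fun_sum: "(\<And>j. j \<in> J \<Longrightarrow> poly_fun n (f j)) \<Longrightarrow> poly_fun n (\<lambda>x. \<Sum>j\<in>J. f j x)"
  by (induction J rule: infinite_finite_induct) (auto intro: poly_fun_const poly_fun_add)

lemma poly_fun_prod: "(\<And>j. j \<in> J \<Longrightarrow> poly_fun n (f j)) \<Longrightarrow> poly_fun n (\<lambda>x. \<Prod>j\<in>J. f j x)"
  by (induction J rule: infinite_finite_induct) (auto intro: poly_fun_const poly_fun_mult)

lemmas poly_fun_intros = poly_fun_const poly_fun_coord poly_fun_add poly_fun_mult poly_fun_power
  poly_fun_sum poly_fun_prod

lemma poly_fun_induct [consumes 1, case_names const coord add mult]:
  assumes "poly_fun n f"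
    and const: "\<And>a. P (\<lambda>x. a)"
    and coord: "\<And>j. j < n \<Longrightarrow> P (\<lambda>x. x j)"
    and add: "\<And>f g. P f \<Longrightarrow> P g \<Longrightarrow> P (\<lambda>x. f x + g x)"
    and mult: "\<And>f g. P f \<Longrightarrow> P g \<Longrightarrow> P (\<lambda>x. f x * g x)"
  shows "P f"
proof -
  obtain A c where A: "finite A" "f = (\<lambda>x. \<Sum>\<alpha>\<in>A. c \<alpha> * (\<Prod>i<n. x i ^ \<alpha> i))"
    using assms(1) unfolding poly_fun_def by blast
  have pow: "P (\<lambda>x. x j ^ k)" if "j < n" for j k
    by (induction k) (use that in \<open>auto intro: const mult coord\<close>)
  have "P (\<lambda>x. \<Prod>i<l. x i ^ \<alpha> i)" if "l \<le> n" for \<alpha> l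
    using that
  proof (induction l)
    case (Suc l)
    then show ?case
      using mult[OF Suc.IH pow[of l "\<alpha> l"]] by simp
  qed (auto intro: const)
  then have mono: "P (\<lambda>x. c \<alpha> * (\<Prod>i<n. x i ^ \<alpha> i))" for \<alpha>
    using mult[OF const[of "c \<alpha>"]] by blast
  have "P (\<lambda>x. \<Sum>\<alpha>\<in>A. c \<alpha> * (\<Prod>i<n. x i ^ \<alpha> i))"
    using A(1) by (induct A rule: finite_induct) (auto intro: const add mono)
  then show ?thesis by (simp add: A(2))
qed

lemma hom_poly_fun_monomial: "hom_poly_fun n (\<Sum>i<n. e i) (\<lambda>x. a * (\<Prod>i<n. x i ^ e i))"
  using hom_poly_fun_sum_monomials[where J = "{()}" and e = "\<lambda>_. e" and c = "\<lambda>_. a"] by simp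

lemma hom_poly_fun_const: "hom_poly_fun n 0 (\<lambda>x. a)"
  using hom_poly_fun_monomial[of n "\<lambda>_. 0" a] by simp

lemma hom_poly_fun_diag:
  assumes "hom_poly_fun n d f"
  shows "hom_poly_fun n d (\<lambda>x. f (\<lambda>i. s i * x i))"
proof -
  obtain A c where A: "finite A" "\<forall>\<alpha>\<in>A. (\<Sum>i<n. \<alpha> i) = d"
      "f = (\<lambda>x. \<Sum>\<alpha>\<in>A. c \<alpha> * (\<Prod>i<n. x i ^ \<alpha> i))"
    using assms(1) unfolding hom_poly_fun_def by blast
  have "f (\<lambda>i. s i * x i) = (\<Sum>\<alpha>\<in>A. (c \<alpha> * (\<Prod>i<n. s i ^ \<alpha> i)) * (\<Prod>i<n. x i ^ \<alpha> i))" for x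
    unfolding A(3) by (simp add: power_mult_distrib prod.distrib mult_ac)
  with A show ?thesis
    by (auto intro: hom_poly_fun_sum_monomials)
qed

lemma hom_poly_fun_scale:
  assumes "hom_poly_fun n d f"
  shows "f (\<lambda>i. s * x i) = s ^ d * f x"
proof -
  obtain A c where A: "finite A" "\<forall>\<alpha>\<in>A. (\<Sum>i<n. \<alpha> i) = d"
      "f = (\<lambda>x. \<Sum>\<alpha>\<in>A. c \<alpha> * (\<Prod>i<n. x i ^ \<alpha> i))"
    using assms(1) unfolding hom_poly_fun_def by blast
  show ?thesis
    unfolding A(3) sum_distrib_left
    by (rule sum.cong) (use A(2) in \<open>auto simp: power_mult_distrib prod.distrib simp flip: power_sum\<close>)
qed

lemma hom_poly_fun_imp_poly_fun: "hom_poly_fun n d f \<Longrightarrow> poly_fun n f"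
  unfolding hom_poly_fun_def poly_fun_def by blast

lemma tendsto_poly_fun:
  assumes "poly_fun n f" and "\<And>i. i < n \<Longrightarrow> ((\<lambda>z. a z i) \<longlongrightarrow> l i) F"
  shows "((\<lambda>z. f (a z)) \<longlongrightarrow> f l) F"
  using assms(1)
proof (induction rule: poly_fun_induct)
  case (coord j)
  then show ?case by (rule assms(2))
qed (auto intro: tendsto_intros)

section \<open>Zariski topologies\<close>

lemma openin_generated_basis:
  assumes "\<And>b b'. b \<in> \<B> \<Longrightarrow> b' \<in> \<B> \<Longrightarrow> b \<inter> b' \<in> \<B>"
  shows "openin (topology_generated_by \<B>) W \<longleftrightarrow> (\<forall>x\<in>W. \<exists>b\<in>\<B>. x \<in> b \<and> b \<subseteq> W)"
proof
  assume "openin (topology_generated_by \<B>) W"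
  then have "generate_topology_on \<B> W"
    by (rule openin_topology_generated_by)
  then show "\<forall>x\<in>W. \<exists>b\<in>\<B>. x \<in> b \<and> b \<subseteq> W"
  proof induction
    case (Int a b)
    show ?case
    proof
      fix x assume x: "x \<in> a \<inter> b"
      with Int.IH obtain b1 b2 where "b1 \<in> \<B>" "x \<in> b1" "b1 \<subseteq> a" "b2 \<in> \<B>" "x \<in> b2" "b2 \<subseteq> b"
        by (meson IntD1 IntD2)
      with assms show "\<exists>b'\<in>\<B>. x \<in> b' \<and> b' \<subseteq> a \<inter> b"
        by (intro bexI[of _ "b1 \<inter> b2"]) auto
    qed
  next
    case (UN K)
    then show ?case by (meson UnionE Union_upper subset_trans)
  qed auto
next
  assume "\<forall>x\<in>W. \<exists>b\<in>\<B>. x \<in> b \<and> b \<subseteq> W"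
  then show "openin (topology_generated_by \<B>) W"
    by (subst openin_subopen) (meson topology_generated_by_Basis)
qed

lemma openin_subtopology_generated_basis:
  assumes "\<And>b b'. b \<in> \<B> \<Longrightarrow> b' \<in> \<B> \<Longrightarrow> b \<inter> b' \<in> \<B>"
  shows "openin (subtopology (topology_generated_by \<B>) X) W \<longleftrightarrow>
    W \<subseteq> X \<and> (\<forall>x\<in>W. \<exists>b\<in>\<B>. x \<in> b \<and> X \<inter> b \<subseteq> W)" (is "?L \<longleftrightarrow> ?R")
proof
  assume ?L
  then obtain T where T: "openin (topology_generated_by \<B>) T" "W = T \<inter> X"
    by (auto simp: openin_subtopology)
  show ?R
  proof (intro conjI ballI)
    fix x assume "x \<in> W"
    then obtain b where "b \<in> \<B>" "x \<in> b" "b \<subseteq> T"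
      using T openin_generated_basis[OF assms, where W = T] by blast
    with T(2) show "\<exists>b\<in>\<B>. x \<in> b \<and> X \<inter> b \<subseteq> W"
      by blast
  qed (use T in blast)
next
  assume R: ?R
  show ?L
  proof (subst openin_subopen, intro ballI)
    fix x assume "x \<in> W"
    with R obtain b where "b \<in> \<B>" "x \<in> b" "X \<inter> b \<subseteq> W" by blast
    moreover have "openin (subtopology (topology_generated_by \<B>) X) (X \<inter> b)"
      using topology_generated_by_Basis[OF \<open>b \<in> \<B>\<close>] by (simp add: openin_subtopology_Int2)
    ultimately show "\<exists>T. openin (subtopology (topology_generated_by \<B>) X) T \<and> x \<in> T \<and> T \<subseteq> W"
      using R \<open>x \<in> W\<close> by (intro exI[of _ "X \<inter> b"]) auto
  qed
qed

text \<open>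
  The generating sets are closed under intersection because \<open>f g\<close> is nonzero exactly where \<open>f\<close> and \<open>g\<close>
  are, so they form a basis.
\<close>

lemma openin_zariski_aff_iff:
  assumes "X \<subseteq> aff_space n"
  shows "openin (subtopology (zariski_aff n) X) W \<longleftrightarrow>
    W \<subseteq> X \<and> (\<forall>p\<in>W. \<exists>f. poly_fun n f \<and> f p \<noteq> 0 \<and> (\<forall>a\<in>X. f a \<noteq> 0 \<longrightarrow> a \<in> W))"
proof -
  have "openin (subtopology (zariski_aff n) X) W \<longleftrightarrow>
    W \<subseteq> X \<and> (\<forall>x\<in>W. \<exists>b\<in>{{a \<in> aff_space n. f a \<noteq> 0} | f. poly_fun n f}. x \<in> b \<and> X \<inter> b \<subseteq> W)"
    unfolding zariski_aff_def
  proof (rule openin_subtopology_generated_basis)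
    fix b b' assume "b \<in> {{a \<in> aff_space n. f a \<noteq> 0} | f. poly_fun n f}"
      "b' \<in> {{a \<in> aff_space n. f a \<noteq> 0} | f. poly_fun n f}"
    then obtain f g where "poly_fun n f" "poly_fun n g"
      "b = {a \<in> aff_space n. f a \<noteq> 0}" "b' = {a \<in> aff_space n. g a \<noteq> 0}" by blast
    then have "b \<inter> b' = {a \<in> aff_space n. f a * g a \<noteq> 0}" "poly_fun n (\<lambda>x. f x * g x)"
      by (auto intro: poly_fun_mult)
    then show "b \<inter> b' \<in> {{a \<in> aff_space n. f a \<noteq> 0} | f. poly_fun n f}"
      by (intro CollectI exI[of _ "\<lambda>x. f x * g x"] conjI)
  qed
  also have "\<dots> \<longleftrightarrow>
    W \<subseteq> X \<and> (\<forall>p\<in>W. \<exists>f. poly_fun n f \<and> f p \<noteq> 0 \<and> (\<forall>a\<in>X. f a \<noteq> 0 \<longrightarrow> a \<in> W))"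
  proof (intro conj_cong refl ball_cong iffI)
    fix p assume p: "W \<subseteq> X" "p \<in> W"
      and "\<exists>b\<in>{{a \<in> aff_space n. f a \<noteq> 0} | f. poly_fun n f}. p \<in> b \<and> X \<inter> b \<subseteq> W"
    then obtain f where "poly_fun n f" "f p \<noteq> 0" "X \<inter> {a \<in> aff_space n. f a \<noteq> 0} \<subseteq> W"
      by auto
    then show "\<exists>f. poly_fun n f \<and> f p \<noteq> 0 \<and> (\<forall>a\<in>X. f a \<noteq> 0 \<longrightarrow> a \<in> W)"
      using assms by (intro exI[of _ f]) auto
  next
    fix p assume p: "W \<subseteq> X" "p \<in> W"
      and "\<exists>f. poly_fun n f \<and> f p \<noteq> 0 \<and> (\<forall>a\<in>X. f a \<noteq> 0 \<longrightarrow> a \<in> W)"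
    then obtain f where "poly_fun n f" "f p \<noteq> 0" "\<forall>a\<in>X. f a \<noteq> 0 \<longrightarrow> a \<in> W"
      by auto
    then show "\<exists>b\<in>{{a \<in> aff_space n. f a \<noteq> 0} | f. poly_fun n f}. p \<in> b \<and> X \<inter> b \<subseteq> W"
      using assms p by (intro bexI[of _ "{a \<in> aff_space n. f a \<noteq> 0}"]) auto
  qed
  finally show ?thesis .
qed

lemma proj_point_eq:
  assumes "p \<in> proj_space n" and "a \<in> p"
  shows "p = {(\<lambda>i. c * a i) | c. c \<noteq> 0}"
proof -
  obtain b where b: "p = {(\<lambda>i. c * b i) | c. c \<noteq> 0}"
    using assms(1) by (auto simp: proj_space_def)
  with assms(2) obtain s where s: "s \<noteq> 0" "a = (\<lambda>i. s * b i)" by auto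
  have "(\<lambda>i. c * b i) \<in> {(\<lambda>i. c * a i) | c. c \<noteq> 0}" if "c \<noteq> 0" for c
    using s that by (auto intro!: exI[of _ "c / s"])
  moreover have "(\<lambda>i. c * a i) \<in> p" if "c \<noteq> 0" for c
    using s that b by (auto intro!: exI[of _ "c * s"])
  ultimately show ?thesis using b by auto
qed

lemma proj_pointD:
  assumes "p \<in> proj_space n" and "a \<in> p"
  shows "a \<in> aff_space (Suc n)" and "a \<noteq> (\<lambda>i. 0)"
  using assms by (auto simp: proj_space_def aff_space_def fun_eq_iff)

lemma proj_point_scale:
  assumes "p \<in> proj_space n" and "a \<in> p" and "b \<in> p"
  obtains c where "c \<noteq> 0" and "b = (\<lambda>i. c * a i)"
  using proj_point_eq[OF assms(1,2)] assms(3) by auto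

lemma proj_point_nonempty: "p \<in> proj_space n \<Longrightarrow> \<exists>a. a \<in> p"
  by (auto simp: proj_space_def)

lemma hom_poly_fun_nonzero_iff:
  assumes "hom_poly_fun k d f" and "p \<in> proj_space n" and "a \<in> p"
  shows "(\<forall>b\<in>p. f b \<noteq> 0) \<longleftrightarrow> f a \<noteq> 0"
proof -
  have "f b \<noteq> 0" if "b \<in> p" "f a \<noteq> 0" for b
  proof -
    obtain c where "c \<noteq> 0" "b = (\<lambda>i. c * a i)"
      using proj_point_scale[OF assms(2,3) \<open>b \<in> p\<close>] by blast
    with that(2) show ?thesis
      by (simp add: hom_poly_fun_scale[OF assms(1)])
  qed
  with assms(3) show ?thesis by blast
qed

lemma openin_zariski_proj_iff:
  assumes "X \<subseteq> proj_space n"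
  shows "openin (subtopology (zariski_proj n) X) W \<longleftrightarrow>
    W \<subseteq> X \<and> (\<forall>p\<in>W. \<exists>f d. hom_poly_fun (Suc n) d f \<and> (\<forall>a\<in>p. f a \<noteq> 0) \<and>
      (\<forall>q\<in>X. (\<forall>a\<in>q. f a \<noteq> 0) \<longrightarrow> q \<in> W))"
proof -
  let ?B = "{{p \<in> proj_space n. \<forall>a\<in>p. f a \<noteq> 0} | f d. hom_poly_fun (Suc n) d f}"
  have "openin (subtopology (zariski_proj n) X) W \<longleftrightarrow>
    W \<subseteq> X \<and> (\<forall>x\<in>W. \<exists>b\<in>?B. x \<in> b \<and> X \<inter> b \<subseteq> W)"
    unfolding zariski_proj_def
  proof (rule openin_subtopology_generated_basis)
    fix b b' assume "b \<in> ?B" "b' \<in> ?B"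
    then obtain f g d e where "hom_poly_fun (Suc n) d f" "hom_poly_fun (Suc n) e g"
      "b = {p \<in> proj_space n. \<forall>a\<in>p. f a \<noteq> 0}" "b' = {p \<in> proj_space n. \<forall>a\<in>p. g a \<noteq> 0}" by blast
    then have "b \<inter> b' = {p \<in> proj_space n. \<forall>a\<in>p. f a * g a \<noteq> 0}"
      "hom_poly_fun (Suc n) (d + e) (\<lambda>x. f x * g x)"
      by (auto intro: hom_poly_fun_mult)
    then show "b \<inter> b' \<in> ?B"
      by (intro CollectI exI[of _ "\<lambda>x. f x * g x"] exI[of _ "d + e"] conjI)
  qed
  also have "\<dots> \<longleftrightarrow> W \<subseteq> X \<and> (\<forall>p\<in>W. \<exists>f d. hom_poly_fun (Suc n) d f \<and> (\<forall>a\<in>p. f a \<noteq> 0) \<and>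
      (\<forall>q\<in>X. (\<forall>a\<in>q. f a \<noteq> 0) \<longrightarrow> q \<in> W))" (is "?L \<longleftrightarrow> ?R")
  proof
    assume L: ?L
    show ?R
    proof (intro conjI ballI)
      fix p assume "p \<in> W"
      then obtain b where "b \<in> ?B" "p \<in> b" "X \<inter> b \<subseteq> W"
        using L by blast
      then obtain f d where f: "hom_poly_fun (Suc n) d f" "\<forall>a\<in>p. f a \<noteq> 0"
        "X \<inter> {p \<in> proj_space n. \<forall>a\<in>p. f a \<noteq> 0} \<subseteq> W"
        by auto
      then have "\<forall>q\<in>X. (\<forall>a\<in>q. f a \<noteq> 0) \<longrightarrow> q \<in> W"
        using assms by auto
      with f show "\<exists>f d. hom_poly_fun (Suc n) d f \<and> (\<forall>a\<in>p. f a \<noteq> 0) \<and>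
          (\<forall>q\<in>X. (\<forall>a\<in>q. f a \<noteq> 0) \<longrightarrow> q \<in> W)"
        by (intro exI[of _ f] exI[of _ d]) simp
    qed (use L in blast)
  next
    assume R: ?R
    show ?L
    proof (intro conjI ballI)
      fix p assume p: "p \<in> W"
      then obtain f d where f: "hom_poly_fun (Suc n) d f" "\<forall>a\<in>p. f a \<noteq> 0"
        "\<forall>q\<in>X. (\<forall>a\<in>q. f a \<noteq> 0) \<longrightarrow> q \<in> W"
        using R by blast
      then show "\<exists>b\<in>?B. p \<in> b \<and> X \<inter> b \<subseteq> W"
        using R assms p by (intro bexI[of _ "{p \<in> proj_space n. \<forall>a\<in>p. f a \<noteq> 0}"]) auto
    qed (use R in blast)
  qed
  finally show ?thesis .
qed

lemma points_proj_fun_space: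
  assumes "X \<subseteq> proj_space n"
  shows "points (proj_fun_space n X) = X"
proof -
  have "openin (subtopology (zariski_proj n) X) X"
    unfolding openin_zariski_proj_iff[OF assms]
    using hom_poly_fun_const[of "Suc n" 1] by (auto intro!: exI[of _ "\<lambda>_. 1"] exI[of _ "0::nat"])
  from openin_subset[OF this] show ?thesis
    by (auto simp: proj_fun_space_def)
qed

lemma regular_proj_iff:
  "regular (proj_fun_space n X) U r \<longleftrightarrow> (\<forall>p\<in>U. \<exists>W g h d.
     openin (subtopology (zariski_proj n) X) W \<and> p \<in> W \<and> W \<subseteq> U \<and>
     hom_poly_fun (Suc n) d g \<and> hom_poly_fun (Suc n) d h \<and> (\<forall>q\<in>W. \<forall>a\<in>q. h a \<noteq> 0 \<and> r q = g a / h a))"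
  by (simp add: proj_fun_space_def)

lemma regular_projE:
  assumes "regular (proj_fun_space n X) U r" and "p \<in> U"
  obtains W g h d where "openin (subtopology (zariski_proj n) X) W" and "p \<in> W" and "W \<subseteq> U"
    and "hom_poly_fun (Suc n) d g" and "hom_poly_fun (Suc n) d h"
    and "\<And>q a. q \<in> W \<Longrightarrow> a \<in> q \<Longrightarrow> h a \<noteq> 0 \<and> r q = g a / h a"
proof -
  obtain W g h d where *: "openin (subtopology (zariski_proj n) X) W \<and> p \<in> W \<and> W \<subseteq> U \<and>
     hom_poly_fun (Suc n) d g \<and> hom_poly_fun (Suc n) d h \<and> (\<forall>q\<in>W. \<forall>a\<in>q. h a \<noteq> 0 \<and> r q = g a / h a)"
    using bspec[OF assms(1)[unfolded regular_proj_iff] assms(2)] by (elim exE)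
  show ?thesis
    by (rule that[of W d g h]) (use * in simp_all)
qed

lemma regular_proj_cong:
  assumes "\<And>p. p \<in> U \<Longrightarrow> f p = g p" and "regular (proj_fun_space n X) U f"
  shows "regular (proj_fun_space n X) U g"
  unfolding regular_proj_iff
proof
  fix p assume "p \<in> U"
  then obtain W k h d where *: "openin (subtopology (zariski_proj n) X) W" "p \<in> W" "W \<subseteq> U"
    "hom_poly_fun (Suc n) d k" "hom_poly_fun (Suc n) d h"
    "\<And>q a. q \<in> W \<Longrightarrow> a \<in> q \<Longrightarrow> h a \<noteq> 0 \<and> f q = k a / h a"
    using regular_projE[OF assms(2)] by metis
  then have "\<forall>q\<in>W. \<forall>a\<in>q. h a \<noteq> 0 \<and> g q = k a / h a"
    using assms(1) by (metis subsetD)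
  with * show "\<exists>W k h d. openin (subtopology (zariski_proj n) X) W \<and> p \<in> W \<and> W \<subseteq> U \<and>
     hom_poly_fun (Suc n) d k \<and> hom_poly_fun (Suc n) d h \<and> (\<forall>q\<in>W. \<forall>a\<in>q. h a \<noteq> 0 \<and> g q = k a / h a)"
    by (intro exI[of _ W] exI[of _ k] exI[of _ h] exI[of _ d]) simp
qed

lemma regular_aff_iff:
  "regular (aff_fun_space n X) U r \<longleftrightarrow> (\<forall>p\<in>U. \<exists>W g h.
     openin (subtopology (zariski_aff n) X) W \<and> p \<in> W \<and> W \<subseteq> U \<and>
     poly_fun n g \<and> poly_fun n h \<and> (\<forall>a\<in>W. h a \<noteq> 0 \<and> r a = g a / h a))"
  by (simp add: aff_fun_space_def)

lemma regular_affE: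
  assumes "regular (aff_fun_space n X) U r" and "p \<in> U"
  obtains W g h where "openin (subtopology (zariski_aff n) X) W" and "p \<in> W" and "W \<subseteq> U"
    and "poly_fun n g" and "poly_fun n h" and "\<And>a. a \<in> W \<Longrightarrow> h a \<noteq> 0 \<and> r a = g a / h a"
proof -
  obtain W g h where *: "openin (subtopology (zariski_aff n) X) W \<and> p \<in> W \<and> W \<subseteq> U \<and>
     poly_fun n g \<and> poly_fun n h \<and> (\<forall>a\<in>W. h a \<noteq> 0 \<and> r a = g a / h a)"
    using bspec[OF assms(1)[unfolded regular_aff_iff] assms(2)] by (elim exE)
  show ?thesis
    by (rule that[of W g h]) (use * in simp_all)
qed

section \<open>Monomial coverings of the torus\<close>

definition laurent :: "(nat \<Rightarrow> complex) \<Rightarrow> (nat \<Rightarrow> int) \<Rightarrow> complex" where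
  "laurent z e = (\<Prod>i<3. z i powi e i)"

definition torus_point :: "(nat \<Rightarrow> complex) \<Rightarrow> bool" where
  "torus_point z \<longleftrightarrow> (\<forall>i<3. z i \<noteq> 0)"

lemma laurent_nonzero: "torus_point z \<Longrightarrow> laurent z e \<noteq> 0"
  by (auto simp: laurent_def torus_point_def)

lemma laurent_mult: "laurent (\<lambda>i. a i * z i) e = laurent a e * laurent z e"
  by (simp add: laurent_def power_int_mult_distrib prod.distrib)

lemma laurent_divide: "laurent (\<lambda>i. a i / z i) e = laurent a e / laurent z e"
  by (simp add: laurent_def power_int_divide_distrib prod_dividef)

lemma laurent_add: "torus_point z \<Longrightarrow> laurent z (\<lambda>i. e i + e' i) = laurent z e * laurent z e'"
  unfolding laurent_def prod.distrib[symmetric]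
  by (rule prod.cong) (auto simp: power_int_add torus_point_def)

lemma laurent_of_nat: "laurent z (\<lambda>i. int (\<alpha> i)) = (\<Prod>i<3. z i ^ \<alpha> i)"
  by (simp add: laurent_def)

lemma laurent_exp: "laurent (\<lambda>i. exp (w i)) e = exp (\<Sum>i<3. of_int (e i) * w i)"
  by (simp add: laurent_def exp_power_int exp_sum)

lemma laurent_cong: "(\<And>i. i < 3 \<Longrightarrow> z i = z' i) \<Longrightarrow> laurent z e = laurent z' e"
  by (simp add: laurent_def)

lemma torus_point_logarithm:
  assumes "torus_point z"
  obtains w where "\<And>i. i < 3 \<Longrightarrow> z i = exp (w i)"
proof
  show "z i = exp (Ln (z i))" if "i < 3" for i
    using assms that by (simp add: torus_point_def)
qed

lemma laurent_laurent:
  assumes "torus_point z"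
  shows "laurent (\<lambda>j. laurent z (E j)) n = laurent z (\<lambda>i. \<Sum>j<3. n j * E j i)"
proof -
  obtain w where w: "\<And>i. i < 3 \<Longrightarrow> z i = exp (w i)"
    using torus_point_logarithm[OF assms] by blast
  have l: "laurent z e = exp (\<Sum>i<3. of_int (e i) * w i)" for e
    unfolding laurent_exp[symmetric] by (rule laurent_cong) (simp add: w)
  have "(\<Sum>j<3. of_int (n j) * (\<Sum>i<3. of_int (E j i) * w i)) =
      (\<Sum>i<3. of_int (\<Sum>j<3. n j * E j i) * w i)"
    by (simp add: sum_distrib_left sum_distrib_right mult_ac) (rule sum.swap)
  then show ?thesis
    unfolding l laurent_exp by simp
qed

lemma scalar_matrix_product_apply:
  fixes v :: "nat \<Rightarrow> 'a :: comm_ring_1" and M N :: "nat \<Rightarrow> nat \<Rightarrow> int"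
  assumes "\<And>k. k < n \<Longrightarrow> (\<Sum>j<n. M i j * N j k) = (if i = k then d else 0)" and "i < n"
  shows "(\<Sum>j<n. of_int (M i j) * (\<Sum>k<n. of_int (N j k) * v k)) = of_int d * v i"
proof -
  have "(\<Sum>j<n. of_int (M i j) * (\<Sum>k<n. of_int (N j k) * v k)) =
      (\<Sum>j<n. \<Sum>k<n. of_int (M i j * N j k) * v k)"
    by (simp add: sum_distrib_left mult_ac)
  also have "\<dots> = (\<Sum>k<n. of_int (\<Sum>j<n. M i j * N j k) * v k)"
    by (subst sum.swap) (simp add: sum_distrib_right)
  also have "\<dots> = (\<Sum>k<n. if k = i then of_int d * v i else 0)"
    using assms(1) by (intro sum.cong) auto
  finally show ?thesis using assms(2) by simp
qed

text \<open>
  The map \<open>z \<mapsto> (c\<^sub>j z^A\<^sub>j)\<^sub>j\<close> of the three-dimensional torus to itself, where \<open>A\<close> is \<open>m\<close> times the inverse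
  of an integer matrix \<open>B\<close>.
\<close>

locale monomial_covering =
  fixes m :: nat and A B :: "nat \<Rightarrow> nat \<Rightarrow> int" and c :: "nat \<Rightarrow> complex"
  assumes m_pos: "m > 0"
    and AB: "\<And>i k. i < 3 \<Longrightarrow> k < 3 \<Longrightarrow> (\<Sum>j<3. A i j * B j k) = (if i = k then int m else 0)"
    and BA: "\<And>i k. i < 3 \<Longrightarrow> k < 3 \<Longrightarrow> (\<Sum>j<3. B i j * A j k) = (if i = k then int m else 0)"
    and c_nonzero: "\<And>j. c j \<noteq> 0"
begin

text \<open>
  The value \<open>0\<close> beyond the third coordinate places the image in \<open>aff_space 3\<close>.
\<close>

definition cover :: "(nat \<Rightarrow> complex) \<Rightarrow> nat \<Rightarrow> complex" where
  "cover z j = (if j < 3 then c j * laurent z (A j) else 0)"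

text \<open>
  The kernel of \<open>z \<mapsto> z^A\<close>, parametrised by integer vectors: in logarithmic coordinates it is
  \<open>2\<pi>\<i> A\<inverse> \<int>\<^sup>3\<close>, and \<open>A\<inverse> = B / m\<close>.
\<close>

definition deck :: "(nat \<Rightarrow> int) \<Rightarrow> nat \<Rightarrow> complex" where
  "deck k i = exp (2 * of_real pi * \<i> / of_nat m * (\<Sum>j<3. of_int (B i j) * of_int (k j)))"

lemma deck_add: "deck (\<lambda>j. k j + l j) i = deck k i * deck l i"
  by (simp add: deck_def exp_add ring_distribs sum.distrib flip: exp_add)

lemma deck_zero: "deck (\<lambda>j. 0) i = 1"
  by (simp add: deck_def)

lemma deck_nonzero: "deck k i \<noteq> 0"
  by (simp add: deck_def)

lemma exp_2pi_int: "exp (2 * of_real pi * \<i> * of_int n) = 1"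
  using exp_integer_2pi[of "of_int n"] by (simp add: mult_ac)

text \<open>
  The value outside \<open>{0, 1, 2}\<close> makes the reduced vector a member of the finite set of extensional
  functions over which averages are taken.
\<close>

lemma deck_mod: "deck (\<lambda>j. if j < 3 then k j mod int m else undefined) i = deck k i"
proof -
  let ?n = "\<Sum>j<3. B i j * (k j div int m)"
  have "(\<Sum>j<3. of_int (B i j) * of_int (k j) :: complex) =
      (\<Sum>j<3. of_int (B i j) * of_int (k j mod int m)) + of_nat m * of_int ?n"
  proof -
    have "of_int (k j) = of_int (k j mod int m) + (of_nat m * of_int (k j div int m) :: complex)" for j
      by (metis mod_mult_div_eq of_int_add of_int_mult of_int_of_nat_eq)
    then show ?thesis
      by (simp add: ring_distribs sum.distrib sum_distrib_left mult_ac)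
  qed
  then have "deck k i = deck (\<lambda>j. k j mod int m) i * exp (2 * of_real pi * \<i> * of_int ?n)"
    using m_pos unfolding deck_def by (simp add: ring_distribs exp_add mult_ac)
  moreover have "deck (\<lambda>j. if j < 3 then k j mod int m else undefined) i = deck (\<lambda>j. k j mod int m) i"
    by (simp add: deck_def)
  ultimately show ?thesis
    by (simp only: exp_2pi_int mult_1_right)
qed

lemma laurent_deck:
  "laurent (deck k) e =
    (\<Prod>j<3. exp (2 * of_real pi * \<i> / of_nat m * of_int (\<Sum>i<3. e i * B i j) * of_int (k j)))"
proof -
  have "(\<Sum>i<3. of_int (e i) * (2 * of_real pi * \<i> / of_nat m * (\<Sum>j<3. of_int (B i j) * of_int (k j)))) =
      (\<Sum>j<3. 2 * of_real pi * \<i> / of_nat m * of_int (\<Sum>i<3. e i * B i j) * of_int (k j))"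
    by (simp add: sum_distrib_left sum_distrib_right mult_ac) (rule sum.swap)
  then show ?thesis
    unfolding deck_def laurent_exp by (simp only: exp_sum finite_lessThan)
qed

lemma cover_deck: "cover (\<lambda>i. deck k i * z i) = cover z"
proof -
  have "laurent (deck k) (A j) = 1" if "j < 3" for j
  proof -
    have "laurent (deck k) (A j) =
        (\<Prod>j'<3. if j' = j then exp (2 * of_real pi * \<i> * of_int (k j)) else 1)"
      unfolding laurent_deck using that m_pos by (intro prod.cong) (auto simp: AB mult_ac)
    then show ?thesis by (simp only: exp_2pi_int) simp
  qed
  then show ?thesis
    by (auto simp: cover_def laurent_mult)
qed

lemma torus_point_cover: "torus_point z \<Longrightarrow> torus_point (cover z)"
  by (simp add: torus_point_def[of "cover z"] cover_def c_nonzero laurent_nonzero)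

text \<open>
  In logarithmic coordinates the covering is the linear map \<open>A\<close>, whose inverse is \<open>B / m\<close>.
\<close>

lemma cover_surjective:
  assumes "torus_point x"
  obtains z where "torus_point z" and "\<And>j. j < 3 \<Longrightarrow> cover z j = x j"
proof -
  have "torus_point (\<lambda>j. x j / c j)"
    using assms c_nonzero by (simp add: torus_point_def)
  then obtain w where w: "\<And>j. j < 3 \<Longrightarrow> x j / c j = exp (w j)"
    by (rule torus_point_logarithm) blast
  define z where "z i = exp (\<Sum>j<3. of_int (B i j) * (w j / of_nat m))" for i
  show ?thesis
  proof
    show "torus_point z"
      by (simp add: torus_point_def z_def)
    fix j :: nat assume j: "j < 3"
    have "laurent z (A j) = exp (w j)"
      unfolding z_def laurent_exp
      using scalar_matrix_product_apply[of 3 A j B "int m" "\<lambda>j. w j / of_nat m"] AB j m_pos by simp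
    then show "cover z j = x j"
      using w[OF j] j c_nonzero[of j] by (simp add: cover_def field_simps)
  qed
qed

text \<open>
  The quotient of two points of a fibre has a logarithm \<open>w\<close> with \<open>A w \<in> 2\<pi>\<i> \<int>\<^sup>3\<close>; applying \<open>B\<close>
  recovers \<open>w\<close>.
\<close>

lemma cover_fibres:
  assumes "torus_point z" and "torus_point z'" and "cover z = cover z'"
  obtains k where "\<And>i. i < 3 \<Longrightarrow> z' i = deck k i * z i"
proof -
  have "torus_point (\<lambda>i. z' i / z i)"
    using assms by (simp add: torus_point_def)
  then obtain w where w: "\<And>i. i < 3 \<Longrightarrow> z' i / z i = exp (w i)"
    by (rule torus_point_logarithm) blast
  have "\<exists>n::int. (\<Sum>i<3. of_int (A j i) * w i) = 2 * of_real pi * \<i> * of_int n" if j: "j < 3" for j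
  proof -
    have "exp (\<Sum>i<3. of_int (A j i) * w i) = laurent (\<lambda>i. z' i / z i) (A j)"
      unfolding laurent_exp[symmetric] by (rule laurent_cong) (simp add: w)
    also have "\<dots> = 1"
      using fun_cong[OF assms(3), of j] j c_nonzero[of j] laurent_nonzero[OF assms(1), of "A j"]
      by (simp add: laurent_divide cover_def)
    finally obtain n :: int where "(\<Sum>i<3. of_int (A j i) * w i) = 0 + of_int (2 * n) * of_real pi * \<i>"
      using exp_eq[of _ 0] by auto
    then show ?thesis
      by (intro exI[of _ n]) (simp add: mult_ac)
  qed
  then obtain k where k: "\<And>j. j < 3 \<Longrightarrow> (\<Sum>i<3. of_int (A j i) * w i) = 2 * of_real pi * \<i> * of_int (k j)"
    by metis
  show ?thesis
  proof
    fix i :: nat assume i: "i < 3"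
    have "of_nat m * w i = (\<Sum>j<3. of_int (B i j) * (\<Sum>l<3. of_int (A j l) * w l))"
      using scalar_matrix_product_apply[of 3 B i A "int m" w] BA i by simp
    also have "\<dots> = (\<Sum>j<3. of_int (B i j) * (2 * of_real pi * \<i> * of_int (k j)))"
      using k by (intro sum.cong) auto
    also have "\<dots> = 2 * of_real pi * \<i> * (\<Sum>j<3. of_int (B i j) * of_int (k j))"
      by (simp add: sum_distrib_left mult_ac)
    finally have "w i = 2 * of_real pi * \<i> / of_nat m * (\<Sum>j<3. of_int (B i j) * of_int (k j))"
      using m_pos by (simp add: field_simps)
    then have "exp (w i) = deck k i"
      by (simp add: deck_def)
    then show "z' i = deck k i * z i"
      using w[OF i] assms(1) i by (auto simp: torus_point_def divide_simps)
  qed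
qed

text \<open>
  An exponent vector is an integral combination of the rows of \<open>A\<close> if and only if its product with
  \<open>A\<inverse> = B / m\<close> is integral.
\<close>

definition in_lattice :: "(nat \<Rightarrow> int) \<Rightarrow> bool" where
  "in_lattice e \<longleftrightarrow> (\<forall>j<3. int m dvd (\<Sum>i<3. e i * B i j))"

text \<open>
  Orthogonality of characters. The sum over the group splits into three geometric sums of \<open>m\<close>-th roots
  of unity, one for each coordinate of the parameter.
\<close>

lemma character_sum:
  "(\<Sum>k\<in>PiE {..<3} (\<lambda>_. {0..<int m}). laurent (deck k) e) = (if in_lattice e then of_nat m ^ 3 else 0)"
proof -
  define s where "s j = (\<Sum>i<3. e i * B i j)" for j
  define \<xi> where "\<xi> j = exp (2 * of_real pi * \<i> / of_nat m * of_int (s j))" for j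
  have pow: "exp (2 * of_real pi * \<i> / of_nat m * of_int (s j) * of_int (int k)) = \<xi> j ^ k" for j k
    by (simp add: \<xi>_def mult_ac flip: exp_of_nat_mult)
  have one: "\<xi> j = 1 \<longleftrightarrow> int m dvd s j" for j
  proof -
    have "\<xi> j = 1 \<longleftrightarrow> (\<exists>n::int. 2 * of_real pi * \<i> / of_nat m * of_int (s j) = of_int (2 * n) * of_real pi * \<i>)"
      using exp_eq[of "2 * of_real pi * \<i> / of_nat m * of_int (s j)" 0] by (simp add: \<xi>_def)
    also have "\<dots> \<longleftrightarrow> (\<exists>n. (of_int (s j) :: complex) = of_int (int m * n))"
      using m_pos by (intro ex_cong1) (auto simp: field_simps)
    also have "\<dots> \<longleftrightarrow> int m dvd s j"
      unfolding of_int_eq_iff dvd_def ..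
    finally show ?thesis .
  qed
  have "\<xi> j ^ m = 1" for j
    using pow[of j m] m_pos exp_2pi_int[of "s j"] by (simp add: mult_ac)
  then have geo: "(\<Sum>k\<in>{0..<int m}. exp (2 * of_real pi * \<i> / of_nat m * of_int (s j) * of_int k)) =
      (if int m dvd s j then of_nat m else 0)" for j
  proof -
    have "(\<Sum>k\<in>{0..<int m}. exp (2 * of_real pi * \<i> / of_nat m * of_int (s j) * of_int k)) =
        (\<Sum>k<m. \<xi> j ^ k)"
      unfolding pow[symmetric] by (rule sum.reindex_bij_witness[of _ int nat]) auto
    then show ?thesis
      using geometric_sum[of "\<xi> j" m] one[of j] \<open>\<xi> j ^ m = 1\<close> by auto
  qed
  have "(\<Sum>k\<in>PiE {..<3} (\<lambda>_. {0..<int m}). laurent (deck k) e) =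
      (\<Prod>j<3. \<Sum>k\<in>{0..<int m}. exp (2 * of_real pi * \<i> / of_nat m * of_int (s j) * of_int k))"
    unfolding laurent_deck s_def[symmetric] by (subst prod_sum_PiE) auto
  also have "\<dots> = (\<Prod>j<(3::nat). if int m dvd s j then of_nat m else 0)"
    by (simp only: geo)
  also have "\<dots> = (if in_lattice e then of_nat m ^ 3 else 0)"
    by (auto simp: in_lattice_def s_def)
  finally show ?thesis .
qed

text \<open>
  The invariant Laurent monomials are Laurent monomials in the coordinates of the target.
\<close>

lemma laurent_in_lattice:
  assumes "in_lattice e"
  obtains n where "\<And>z. torus_point z \<Longrightarrow> laurent z e = laurent (\<lambda>j. cover z j / c j) n"
proof -
  have "\<forall>j. \<exists>n. j < 3 \<longrightarrow> (\<Sum>i<3. e i * B i j) = int m * n"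
    using assms by (auto simp: in_lattice_def dvd_def)
  then obtain n where n: "\<And>j. j < 3 \<Longrightarrow> (\<Sum>i<3. e i * B i j) = int m * n j"
    by metis
  have e: "(\<Sum>j<3. n j * A j i) = e i" if "i < 3" for i
  proof -
    have "(\<Sum>j<3. B k j * A j i) = (if i = k then int m else 0)" if "k < 3" for k
      using BA[OF that \<open>i < 3\<close>] by auto
    then have "int m * (\<Sum>j<3. n j * A j i) = int m * e i"
      using scalar_matrix_product_apply[of 3 "\<lambda>i j. A j i" i "\<lambda>j k. B k j" "int m" e] that n
      by (simp add: sum_distrib_left mult_ac)
    then show ?thesis using m_pos by simp
  qed
  show ?thesis
  proof
    fix z assume z: "torus_point z"
    have "laurent (\<lambda>j. cover z j / c j) n = laurent (\<lambda>j. laurent z (A j)) n"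
      by (rule laurent_cong) (simp add: cover_def c_nonzero)
    also have "\<dots> = laurent z (\<lambda>i. \<Sum>j<3. n j * A j i)"
      by (rule laurent_laurent[OF z])
    also have "\<dots> = laurent z e"
      unfolding laurent_def by (simp add: e)
    finally show "laurent z e = laurent (\<lambda>j. cover z j / c j) n" ..
  qed
qed

text \<open>
  The pullbacks of Laurent polynomials along the covering, written over a power of the product of the
  coordinates.
\<close>

definition laurent_of_cover :: "((nat \<Rightarrow> complex) \<Rightarrow> complex) \<Rightarrow> bool" where
  "laurent_of_cover f \<longleftrightarrow> (\<exists>P N. poly_fun 3 P \<and>
     (\<forall>z. torus_point z \<longrightarrow> f z = P (cover z) / (\<Prod>j<3. cover z j) ^ N))"

lemma laurent_of_cover_add:
  assumes "laurent_of_cover f" and "laurent_of_cover g"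
  shows "laurent_of_cover (\<lambda>z. f z + g z)"
proof -
  obtain P M where P: "poly_fun 3 P"
      "\<And>z. torus_point z \<Longrightarrow> f z = P (cover z) / (\<Prod>j<3. cover z j) ^ M"
    using assms(1) unfolding laurent_of_cover_def by blast
  obtain Q N where Q: "poly_fun 3 Q"
      "\<And>z. torus_point z \<Longrightarrow> g z = Q (cover z) / (\<Prod>j<3. cover z j) ^ N"
    using assms(2) unfolding laurent_of_cover_def by blast
  have "poly_fun 3 (\<lambda>x. P x * (\<Prod>j<3. x j) ^ N + Q x * (\<Prod>j<3. x j) ^ M)"
    using P(1) Q(1) by (intro poly_fun_intros) auto
  moreover have "f z + g z = (P (cover z) * (\<Prod>j<3. cover z j) ^ N + Q (cover z) * (\<Prod>j<3. cover z j) ^ M)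
      / (\<Prod>j<3. cover z j) ^ (M + N)" if "torus_point z" for z
  proof -
    have "(\<Prod>j<3. cover z j) \<noteq> 0"
      using torus_point_cover[OF that] by (auto simp: torus_point_def)
    then show ?thesis
      using P(2)[OF that] Q(2)[OF that] by (simp add: power_add add_frac_eq)
  qed
  ultimately show ?thesis
    unfolding laurent_of_cover_def by blast
qed

lemma laurent_of_cover_monomial:
  assumes "in_lattice e"
  shows "laurent_of_cover (\<lambda>z. a * laurent z e)"
proof -
  obtain n where n: "\<And>z. torus_point z \<Longrightarrow> laurent z e = laurent (\<lambda>j. cover z j / c j) n"
    using laurent_in_lattice[OF assms] by blast
  \<comment> \<open>A common power of the coordinates that clears all negative exponents.\<close>
  define N where "N = (\<Sum>j<3. nat \<bar>n j\<bar>)"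
  have N: "n j + int N \<ge> 0" if "j < 3" for j
  proof -
    have "nat \<bar>n j\<bar> \<le> N"
      unfolding N_def by (rule member_le_sum) (use that in auto)
    then show ?thesis by linarith
  qed
  have "poly_fun 3 (\<lambda>x. a / laurent c n * (\<Prod>j<3. x j ^ nat (n j + int N)))"
    by (intro poly_fun_intros) auto
  moreover have "a * laurent z e = a / laurent c n * (\<Prod>j<3. cover z j ^ nat (n j + int N))
      / (\<Prod>j<3. cover z j) ^ N" if "torus_point z" for z
  proof -
    have nz: "(\<Prod>j<3. cover z j) \<noteq> 0"
      using torus_point_cover[OF that] by (auto simp: torus_point_def)
    have "cover z j ^ nat (n j + int N) = cover z j powi n j * cover z j ^ N" if "j < 3" for j
    proof -
      have "cover z j \<noteq> 0"
        using torus_point_cover[OF \<open>torus_point z\<close>] that by (simp add: torus_point_def)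
      then have "cover z j powi (n j + int N) = cover z j powi n j * cover z j ^ N"
        by (simp add: power_int_add)
      then show ?thesis
        using N[OF that] by (simp add: power_int_def split: if_splits)
    qed
    then have "(\<Prod>j<3. cover z j ^ nat (n j + int N)) = laurent (cover z) n * (\<Prod>j<3. cover z j) ^ N"
      by (simp add: laurent_def prod.distrib prod_power_distrib)
    then show ?thesis
      using nz by (simp add: n[OF that] laurent_divide)
  qed
  ultimately show ?thesis
    unfolding laurent_of_cover_def by blast
qed

text \<open>
  The projection of \<open>f\<close> to its component on which the deck group acts by the character of the
  monomial \<open>z^e\<close>.
\<close>

definition average :: "(nat \<Rightarrow> int) \<Rightarrow> ((nat \<Rightarrow> complex) \<Rightarrow> complex) \<Rightarrow> (nat \<Rightarrow> complex) \<Rightarrow> complex" where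
  "average e f z =
    (\<Sum>k\<in>PiE {..<3} (\<lambda>_. {0..<int m}). laurent (deck k) (\<lambda>i. - e i) * f (\<lambda>i. deck k i * z i)) / of_nat m ^ 3"

lemma average_polynomial:
  assumes "finite S"
  shows "average e (\<lambda>z. \<Sum>\<alpha>\<in>S. a \<alpha> * (\<Prod>i<3. z i ^ \<alpha> i)) z =
    (\<Sum>\<alpha> | \<alpha> \<in> S \<and> in_lattice (\<lambda>i. int (\<alpha> i) - e i). a \<alpha> * (\<Prod>i<3. z i ^ \<alpha> i))"
proof -
  let ?K = "PiE {..<3::nat} (\<lambda>_. {0..<int m})"
  have "laurent (deck k) (\<lambda>i. - e i) * (\<Sum>\<alpha>\<in>S. a \<alpha> * (\<Prod>i<3. (deck k i * z i) ^ \<alpha> i)) =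
      (\<Sum>\<alpha>\<in>S. laurent (deck k) (\<lambda>i. int (\<alpha> i) - e i) * (a \<alpha> * (\<Prod>i<3. z i ^ \<alpha> i)))" for k
  proof -
    have "torus_point (deck k)"
      by (simp add: torus_point_def deck_nonzero)
    then have "laurent (deck k) (\<lambda>i. int (\<alpha> i) - e i) = laurent (deck k) (\<lambda>i. - e i) * (\<Prod>i<3. deck k i ^ \<alpha> i)" for \<alpha>
      using laurent_add[of "deck k" "\<lambda>i. - e i" "\<lambda>i. int (\<alpha> i)"] by (simp add: laurent_of_nat)
    then show ?thesis
      by (simp add: sum_distrib_left power_mult_distrib prod.distrib mult_ac)
  qed
  then have "average e (\<lambda>z. \<Sum>\<alpha>\<in>S. a \<alpha> * (\<Prod>i<3. z i ^ \<alpha> i)) z =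
      (\<Sum>k\<in>?K. \<Sum>\<alpha>\<in>S. laurent (deck k) (\<lambda>i. int (\<alpha> i) - e i) * (a \<alpha> * (\<Prod>i<3. z i ^ \<alpha> i))) / of_nat m ^ 3"
    unfolding average_def by simp
  also have "\<dots> = (\<Sum>\<alpha>\<in>S. (\<Sum>k\<in>?K. laurent (deck k) (\<lambda>i. int (\<alpha> i) - e i)) * (a \<alpha> * (\<Prod>i<3. z i ^ \<alpha> i))) / of_nat m ^ 3"
    by (subst sum.swap) (simp add: sum_distrib_right)
  also have "\<dots> = (\<Sum>\<alpha>\<in>S. if in_lattice (\<lambda>i. int (\<alpha> i) - e i) then a \<alpha> * (\<Prod>i<3. z i ^ \<alpha> i) else 0)"
    unfolding character_sum sum_divide_distrib using m_pos by (intro sum.cong) auto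
  finally show ?thesis
    using assms by (simp add: sum.inter_filter)
qed

text \<open>
  By orthogonality only monomials \<open>z^\<alpha>\<close> with \<open>\<alpha> - e\<close> in the lattice survive, and dividing them by \<open>z^e\<close>
  leaves Laurent monomials in the coordinates of the target.
\<close>

lemma average_descends:
  assumes "poly_fun 3 f"
  obtains P N where "poly_fun 3 P" and "\<And>z. torus_point z \<Longrightarrow>
    average e f z = laurent z e * P (cover z) / (\<Prod>j<3. cover z j) ^ N"
proof -
  obtain S a where S: "finite S" "f = (\<lambda>z. \<Sum>\<alpha>\<in>S. a \<alpha> * (\<Prod>i<3. z i ^ \<alpha> i))"
    using assms unfolding poly_fun_def by blast
  define S' where "S' = {\<alpha>. \<alpha> \<in> S \<and> in_lattice (\<lambda>i. int (\<alpha> i) - e i)}"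
  have "finite S'" "\<forall>\<alpha>\<in>S'. in_lattice (\<lambda>i. int (\<alpha> i) - e i)"
    using S(1) by (auto simp: S'_def)
  then have "laurent_of_cover (\<lambda>z. \<Sum>\<alpha>\<in>S'. a \<alpha> * laurent z (\<lambda>i. int (\<alpha> i) - e i))"
  proof (induct S' rule: finite_induct)
    case empty
    show ?case
      unfolding laurent_of_cover_def using poly_fun_const[of 3 0] by auto
  next
    case (insert \<alpha> S')
    then show ?case
      by (simp add: laurent_of_cover_add laurent_of_cover_monomial)
  qed
  then obtain P N where P: "poly_fun 3 P" "\<And>z. torus_point z \<Longrightarrow>
      (\<Sum>\<alpha>\<in>S'. a \<alpha> * laurent z (\<lambda>i. int (\<alpha> i) - e i)) = P (cover z) / (\<Prod>j<3. cover z j) ^ N"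
    unfolding laurent_of_cover_def by blast
  show ?thesis
  proof
    show "poly_fun 3 P" by fact
    fix z assume z: "torus_point z"
    have "laurent z (\<lambda>i. int (\<alpha> i)) = laurent z e * laurent z (\<lambda>i. int (\<alpha> i) - e i)" for \<alpha>
      using laurent_add[OF z, of e "\<lambda>i. int (\<alpha> i) - e i"] by simp
    then have "average e f z = laurent z e * (\<Sum>\<alpha>\<in>S'. a \<alpha> * laurent z (\<lambda>i. int (\<alpha> i) - e i))"
      unfolding S(2) average_polynomial[OF S(1)] S'_def[symmetric]
      by (simp add: sum_distrib_left mult_ac flip: laurent_of_nat)
    then show "average e f z = laurent z e * P (cover z) / (\<Prod>j<3. cover z j) ^ N"
      by (simp add: P(2)[OF z])
  qed
qed

text \<open>
  A polynomial is the sum of its components: exponents that differ by a lattice vector belong to the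
  same component, and these classes partition the exponents that occur. So not all
  components vanish where \<open>f\<close> does not.
\<close>

lemma average_nonzero:
  assumes "poly_fun 3 f" and "f z \<noteq> 0"
  obtains e where "average e f z \<noteq> 0"
proof -
  obtain S a where S: "finite S" "f = (\<lambda>z. \<Sum>\<alpha>\<in>S. a \<alpha> * (\<Prod>i<3. z i ^ \<alpha> i))"
    using assms unfolding poly_fun_def by blast
  \<comment> \<open>Group the exponents of \<open>f\<close> by their class modulo the lattice.\<close>
  define cls where "cls \<alpha> = {\<beta>. \<beta> \<in> S \<and> in_lattice (\<lambda>i. int (\<beta> i) - int (\<alpha> i))}" for \<alpha>
  have refl: "in_lattice (\<lambda>i. int (\<alpha> i) - int (\<alpha> i))" for \<alpha>
    by (simp add: in_lattice_def)
  have sym: "in_lattice (\<lambda>i. int (\<alpha> i) - int (\<beta> i))" if "in_lattice (\<lambda>i. int (\<beta> i) - int (\<alpha> i))" for \<alpha> \<beta>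
  proof -
    have "(\<Sum>i<3. (int (\<alpha> i) - int (\<beta> i)) * B i j) = - (\<Sum>i<3. (int (\<beta> i) - int (\<alpha> i)) * B i j)" for j
      by (simp add: algebra_simps flip: sum_negf)
    with that show ?thesis
      unfolding in_lattice_def by (simp only: dvd_minus_iff)
  qed
  have trans: "in_lattice (\<lambda>i. int (\<alpha> i) - int (\<gamma> i))" if "in_lattice (\<lambda>i. int (\<alpha> i) - int (\<beta> i))"
    "in_lattice (\<lambda>i. int (\<beta> i) - int (\<gamma> i))" for \<alpha> \<beta> \<gamma>
  proof -
    have "(\<Sum>i<3. (int (\<alpha> i) - int (\<gamma> i)) * B i j) =
        (\<Sum>i<3. (int (\<alpha> i) - int (\<beta> i)) * B i j) + (\<Sum>i<3. (int (\<beta> i) - int (\<gamma> i)) * B i j)" for j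
      by (simp add: algebra_simps flip: sum.distrib)
    with that show ?thesis
      unfolding in_lattice_def by simp
  qed
  have cls_eq: "{\<beta>. \<beta> \<in> S \<and> cls \<beta> = cls \<alpha>} = cls \<alpha>" if "\<alpha> \<in> S" for \<alpha>
  proof (intro equalityI subsetI)
    fix \<beta> assume "\<beta> \<in> {\<beta>. \<beta> \<in> S \<and> cls \<beta> = cls \<alpha>}"
    then have "\<beta> \<in> S" "cls \<beta> = cls \<alpha>"
      by simp_all
    moreover have "\<beta> \<in> cls \<beta>"
      using refl[of \<beta>] \<open>\<beta> \<in> S\<close> unfolding cls_def by simp
    ultimately show "\<beta> \<in> cls \<alpha>"
      by simp
  next
    fix \<beta> assume "\<beta> \<in> cls \<alpha>"
    then have "\<beta> \<in> S" "in_lattice (\<lambda>i. int (\<beta> i) - int (\<alpha> i))"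
      unfolding cls_def by simp_all
    moreover from this have "in_lattice (\<lambda>i. int (\<gamma> i) - int (\<beta> i)) \<longleftrightarrow> in_lattice (\<lambda>i. int (\<gamma> i) - int (\<alpha> i))" for \<gamma>
      using trans[of \<gamma> \<beta> \<alpha>] trans[of \<gamma> \<alpha> \<beta>] sym[of \<beta> \<alpha>] by blast
    ultimately show "\<beta> \<in> {\<beta>. \<beta> \<in> S \<and> cls \<beta> = cls \<alpha>}"
      by (simp add: cls_def)
  qed
  have "f z = (\<Sum>C\<in>cls ` S. \<Sum>\<alpha> | \<alpha> \<in> S \<and> cls \<alpha> = C. a \<alpha> * (\<Prod>i<3. z i ^ \<alpha> i))"
    unfolding S(2) by (rule sum.image_gen[OF S(1)])
  with assms(2) have "(\<Sum>C\<in>cls ` S. \<Sum>\<alpha> | \<alpha> \<in> S \<and> cls \<alpha> = C. a \<alpha> * (\<Prod>i<3. z i ^ \<alpha> i)) \<noteq> 0"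
    by simp
  then obtain C where C: "C \<in> cls ` S" "(\<Sum>\<beta> | \<beta> \<in> S \<and> cls \<beta> = C. a \<beta> * (\<Prod>i<3. z i ^ \<beta> i)) \<noteq> 0"
    by (rule sum.not_neutral_contains_not_neutral)
  then obtain \<alpha> where "\<alpha> \<in> S" "C = cls \<alpha>"
    by blast
  with C(2) have "(\<Sum>\<beta> | \<beta> \<in> S \<and> cls \<beta> = cls \<alpha>. a \<beta> * (\<Prod>i<3. z i ^ \<beta> i)) \<noteq> 0"
    by simp
  then have "average (\<lambda>i. int (\<alpha> i)) f z \<noteq> 0"
    unfolding S(2) average_polynomial[OF S(1)] cls_eq[OF \<open>\<alpha> \<in> S\<close>] by (simp add: cls_def)
  with that show ?thesis by blast
qed

text \<open>
  Stated without division so that it serves two purposes. If \<open>f / g\<close> is invariant and \<open>r\<close> is its value,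
  then \<open>r\<close> is also the value of \<open>P / Q\<close>, which is how regular functions descend. If \<open>f = 0\<close> and \<open>g\<close>
  vanishes on an orbit, then every \<open>r\<close> satisfies the premise there, which forces \<open>Q\<close> to vanish at
  its image; this is how open sets descend. The character is chosen such that the corresponding
  component of \<open>g\<close> does not vanish at the given point.
\<close>

lemma invariant_fraction_descends:
  assumes "poly_fun 3 f" and "poly_fun 3 g" and "torus_point z0" and "g z0 \<noteq> 0"
  shows "\<exists>P Q. poly_fun 3 P \<and> poly_fun 3 Q \<and> Q (cover z0) \<noteq> 0 \<and>
    (\<forall>z r. torus_point z \<and> (\<forall>k. r * g (\<lambda>i. deck k i * z i) = f (\<lambda>i. deck k i * z i)) \<longrightarrow>
      r * Q (cover z) = P (cover z))"
proof -
  obtain e where e: "average e g z0 \<noteq> 0"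
    using average_nonzero[OF assms(2,4)] .
  obtain P M where P: "poly_fun 3 P" "\<And>z. torus_point z \<Longrightarrow>
      average e f z = laurent z e * P (cover z) / (\<Prod>j<3. cover z j) ^ M"
    using average_descends[OF assms(1)] by blast
  obtain Q N where Q: "poly_fun 3 Q" "\<And>z. torus_point z \<Longrightarrow>
      average e g z = laurent z e * Q (cover z) / (\<Prod>j<3. cover z j) ^ N"
    using average_descends[OF assms(2)] by blast
  have nz: "(\<Prod>j<3. cover z j) \<noteq> 0" if "torus_point z" for z
    using torus_point_cover[OF that] by (auto simp: torus_point_def)
  show ?thesis
  proof (intro exI conjI allI impI; (elim conjE)?)
    show "poly_fun 3 (\<lambda>x. P x * (\<Prod>j<3. x j) ^ N)" "poly_fun 3 (\<lambda>x. Q x * (\<Prod>j<3. x j) ^ M)"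
      using P(1) Q(1) by (intro poly_fun_intros; simp)+
    show "Q (cover z0) * (\<Prod>j<3. cover z0 j) ^ M \<noteq> 0"
      using e Q(2)[OF assms(3)] nz[OF assms(3)] by auto
    fix z r assume z: "torus_point z"
      and r: "\<forall>k. r * g (\<lambda>i. deck k i * z i) = f (\<lambda>i. deck k i * z i)"
    have "r * average e g z = average e f z"
      unfolding average_def by (simp add: sum_distrib_left mult.left_commute[of r] r)
    then show "r * (Q (cover z) * (\<Prod>j<3. cover z j) ^ M) = P (cover z) * (\<Prod>j<3. cover z j) ^ N"
      using nz[OF z] laurent_nonzero[OF z, of e] P(2)[OF z] Q(2)[OF z] by (simp add: divide_simps mult_ac)
  qed
qed

end

section \<open>The Fermat surface in projective space\<close>

definition scale_coords :: "(nat \<Rightarrow> complex) \<Rightarrow> proj_point \<Rightarrow> proj_point" where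
  "scale_coords s p = (\<lambda>a i. s i * a i) ` p"

lemma scale_coords_compose: "scale_coords s (scale_coords t p) = scale_coords (\<lambda>i. s i * t i) p"
  by (simp add: scale_coords_def image_image mult.assoc)

lemma scale_coords_one: "scale_coords (\<lambda>i. 1) p = p"
  by (simp add: scale_coords_def)

lemma scale_coords_proj_space:
  assumes "\<And>i. s i \<noteq> 0" and "p \<in> proj_space n"
  shows "scale_coords s p \<in> proj_space n"
proof -
  obtain a where a: "p = {(\<lambda>i. c * a i) | c. c \<noteq> 0}" "a \<in> aff_space (Suc n)" "a \<noteq> (\<lambda>i. 0)"
    using assms(2) by (auto simp: proj_space_def)
  have "scale_coords s p = {(\<lambda>i. c * (s i * a i)) | c. c \<noteq> 0}"
  proof (intro equalityI subsetI)
    fix b assume "b \<in> {(\<lambda>i. c * (s i * a i)) | c. c \<noteq> 0}"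
    then obtain c where "c \<noteq> 0" "b = (\<lambda>i. s i * (c * a i))"
      by (auto simp: mult.left_commute)
    then show "b \<in> scale_coords s p"
      unfolding scale_coords_def a(1) by (intro image_eqI[where x = "\<lambda>i. c * a i"]) auto
  qed (auto simp: scale_coords_def a(1) mult.left_commute)
  moreover have "(\<lambda>i. s i * a i) \<in> aff_space (Suc n)" "(\<lambda>i. s i * a i) \<noteq> (\<lambda>i. 0)"
    using a(2,3) assms(1) by (auto simp: aff_space_def fun_eq_iff)
  ultimately show ?thesis
    unfolding proj_space_def by (intro CollectI exI[of _ "\<lambda>i. s i * a i"]) simp
qed

lemma morphism_scale_coords:
  assumes X: "X \<subseteq> proj_space n" and s: "\<And>p. p \<in> X \<Longrightarrow> scale_coords s p \<in> X"
  shows "morphism (proj_fun_space n X) (proj_fun_space n X) (restrict (scale_coords s) X)"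
    (is "morphism ?P ?P ?g")
proof -
  have pts: "points ?P = X"
    by (rule points_proj_fun_space[OF X])
  have op: "space_top ?P = subtopology (zariski_proj n) X"
    by (simp add: proj_fun_space_def)
  have pre: "openin (space_top ?P) {p \<in> X. ?g p \<in> W}" if W: "openin (space_top ?P) W" for W
    unfolding op openin_zariski_proj_iff[OF X]
  proof (intro conjI ballI)
    fix p assume "p \<in> {p \<in> X. ?g p \<in> W}"
    then have p: "p \<in> X" "scale_coords s p \<in> W" by auto
    then obtain f d where f: "hom_poly_fun (Suc n) d f" "\<forall>a\<in>scale_coords s p. f a \<noteq> 0"
        "\<forall>q\<in>X. (\<forall>a\<in>q. f a \<noteq> 0) \<longrightarrow> q \<in> W"
      using W unfolding op openin_zariski_proj_iff[OF X] by blast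
    show "\<exists>f d. hom_poly_fun (Suc n) d f \<and> (\<forall>a\<in>p. f a \<noteq> 0) \<and>
      (\<forall>q\<in>X. (\<forall>a\<in>q. f a \<noteq> 0) \<longrightarrow> q \<in> {p \<in> X. ?g p \<in> W})"
    proof (intro exI conjI)
      show "hom_poly_fun (Suc n) d (\<lambda>x. f (\<lambda>i. s i * x i))"
        by (rule hom_poly_fun_diag[OF f(1)])
      show "\<forall>a\<in>p. f (\<lambda>i. s i * a i) \<noteq> 0"
        using f(2) by (simp add: scale_coords_def)
      show "\<forall>q\<in>X. (\<forall>a\<in>q. f (\<lambda>i. s i * a i) \<noteq> 0) \<longrightarrow> q \<in> {p \<in> X. ?g p \<in> W}"
        using f(3) s by (simp add: scale_coords_def)
    qed
  qed auto
  show ?thesis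
    unfolding morphism_def pts
  proof (intro conjI allI impI; (elim conjE)?)
    show "continuous_map (space_top ?P) (space_top ?P) ?g"
      unfolding continuous_map_def pts using pre s by auto
    fix V h assume V: "openin (space_top ?P) V" and h: "regular ?P V h"
    show "regular ?P {p \<in> X. ?g p \<in> V} (h \<circ> ?g)"
      unfolding regular_proj_iff
    proof
      fix p assume "p \<in> {p \<in> X. ?g p \<in> V}"
      then have p: "p \<in> X" "scale_coords s p \<in> V" by auto
      obtain W g h' d where W: "openin (subtopology (zariski_proj n) X) W"
          "scale_coords s p \<in> W" "W \<subseteq> V" "hom_poly_fun (Suc n) d g" "hom_poly_fun (Suc n) d h'"
          "\<And>q a. q \<in> W \<Longrightarrow> a \<in> q \<Longrightarrow> h' a \<noteq> 0 \<and> h q = g a / h' a"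
        using regular_projE[OF h p(2)] by metis
      show "\<exists>W g h' d. openin (subtopology (zariski_proj n) X) W \<and> p \<in> W \<and> W \<subseteq> {p \<in> X. ?g p \<in> V} \<and>
        hom_poly_fun (Suc n) d g \<and> hom_poly_fun (Suc n) d h' \<and>
        (\<forall>q\<in>W. \<forall>a\<in>q. h' a \<noteq> 0 \<and> (h \<circ> ?g) q = g a / h' a)"
      proof (intro exI conjI)
        show "openin (subtopology (zariski_proj n) X) {p \<in> X. ?g p \<in> W}"
          using pre W(1) unfolding op by simp
        show "p \<in> {p \<in> X. ?g p \<in> W}" "{p \<in> X. ?g p \<in> W} \<subseteq> {p \<in> X. ?g p \<in> V}"
          using p W by auto
        show "hom_poly_fun (Suc n) d (\<lambda>x. g (\<lambda>i. s i * x i))" "hom_poly_fun (Suc n) d (\<lambda>x. h' (\<lambda>i. s i * x i))"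
          using W(4,5) by (auto intro: hom_poly_fun_diag)
        show "\<forall>q\<in>{p \<in> X. ?g p \<in> W}. \<forall>a\<in>q. h' (\<lambda>i. s i * a i) \<noteq> 0 \<and>
            (h \<circ> ?g) q = g (\<lambda>i. s i * a i) / h' (\<lambda>i. s i * a i)"
          using W(6) by (simp add: scale_coords_def)
      qed
    qed
  qed
qed

definition ratios :: "(nat \<Rightarrow> complex) \<Rightarrow> nat \<Rightarrow> complex" where
  "ratios a i = a (Suc i) / a 0"

definition chart :: "proj_point \<Rightarrow> nat \<Rightarrow> complex" where
  "chart p = ratios (SOME a. a \<in> p)"

lemma chart_eq:
  assumes "p \<in> proj_space n" and "a \<in> p"
  shows "chart p = ratios a"
proof -
  have "(SOME a. a \<in> p) \<in> p"
    using someI[of "\<lambda>a. a \<in> p"] assms(2) by simp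
  then obtain c where "c \<noteq> 0" "(SOME a. a \<in> p) = (\<lambda>i. c * a i)"
    using proj_point_scale[OF assms] by blast
  then show ?thesis
    by (simp add: chart_def ratios_def fun_eq_iff)
qed

definition dehomogenize :: "((nat \<Rightarrow> complex) \<Rightarrow> complex) \<Rightarrow> (nat \<Rightarrow> complex) \<Rightarrow> complex" where
  "dehomogenize f z = f (case_nat 1 z)"

lemma poly_fun_dehomogenize:
  assumes "poly_fun (Suc n) f"
  shows "poly_fun n (dehomogenize f)"
  using assms unfolding dehomogenize_def
proof (induction rule: poly_fun_induct)
  case (coord j)
  then show ?case
    by (cases j) (auto intro: poly_fun_intros)
qed (auto intro: poly_fun_intros)

lemma hom_poly_fun_dehomogenize:
  assumes "hom_poly_fun n d f" and "a 0 \<noteq> 0"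
  shows "f a = a 0 ^ d * dehomogenize f (ratios a)"
proof -
  have "a = (\<lambda>i. a 0 * case_nat 1 (ratios a) i)"
    using assms(2) by (auto simp: ratios_def fun_eq_iff split: nat.split)
  then show ?thesis
    using hom_poly_fun_scale[OF assms(1), of "a 0" "case_nat 1 (ratios a)"] by (simp add: dehomogenize_def)
qed

text \<open>
  Fractions of homogeneous polynomials of equal degree whose denominator vanishes only where some
  coordinate does: the functions by which the covering is described on the projective side.
\<close>

definition hom_fraction :: "nat \<Rightarrow> ((nat \<Rightarrow> complex) \<Rightarrow> complex) \<Rightarrow> bool" where
  "hom_fraction n f \<longleftrightarrow> (\<exists>H M d. hom_poly_fun n d H \<and> hom_poly_fun n d M \<and>
     (\<forall>a. (\<forall>i<n. a i \<noteq> 0) \<longrightarrow> M a \<noteq> 0 \<and> f a = H a / M a))"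

lemma hom_fraction_const: "hom_fraction n (\<lambda>a. b)"
  unfolding hom_fraction_def
  by (intro exI[of _ "\<lambda>_. b"] exI[of _ "\<lambda>_. 1"] exI[of _ 0]) (simp add: hom_poly_fun_const)

lemma hom_fraction_add:
  assumes "hom_fraction n f" and "hom_fraction n g"
  shows "hom_fraction n (\<lambda>a. f a + g a)"
proof -
  obtain H M d where 1: "hom_poly_fun n d H" "hom_poly_fun n d M"
     "\<forall>a. (\<forall>i<n. a i \<noteq> 0) \<longrightarrow> M a \<noteq> 0 \<and> f a = H a / M a"
    using assms(1) unfolding hom_fraction_def by blast
  obtain H' M' d' where 2: "hom_poly_fun n d' H'" "hom_poly_fun n d' M'"
     "\<forall>a. (\<forall>i<n. a i \<noteq> 0) \<longrightarrow> M' a \<noteq> 0 \<and> g a = H' a / M' a"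
    using assms(2) unfolding hom_fraction_def by blast
  show ?thesis
    unfolding hom_fraction_def
  proof (intro exI conjI)
    have "hom_poly_fun n (d + d') (\<lambda>a. M a * H' a)"
      by (rule hom_poly_fun_mult[OF 1(2) 2(1)])
    then show "hom_poly_fun n (d + d') (\<lambda>a. H a * M' a + M a * H' a)"
      by (intro hom_poly_fun_add hom_poly_fun_mult[OF 1(1) 2(2)])
    show "hom_poly_fun n (d + d') (\<lambda>a. M a * M' a)"
      by (rule hom_poly_fun_mult[OF 1(2) 2(2)])
    show "\<forall>a. (\<forall>i<n. a i \<noteq> 0) \<longrightarrow> M a * M' a \<noteq> 0 \<and>
        f a + g a = (H a * M' a + M a * H' a) / (M a * M' a)"
      using 1(3) 2(3) by (simp add: add_frac_eq mult.commute)
  qed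
qed

lemma hom_fraction_mult:
  assumes "hom_fraction n f" and "hom_fraction n g"
  shows "hom_fraction n (\<lambda>a. f a * g a)"
proof -
  obtain H M d where 1: "hom_poly_fun n d H" "hom_poly_fun n d M"
     "\<forall>a. (\<forall>i<n. a i \<noteq> 0) \<longrightarrow> M a \<noteq> 0 \<and> f a = H a / M a"
    using assms(1) unfolding hom_fraction_def by blast
  obtain H' M' d' where 2: "hom_poly_fun n d' H'" "hom_poly_fun n d' M'"
     "\<forall>a. (\<forall>i<n. a i \<noteq> 0) \<longrightarrow> M' a \<noteq> 0 \<and> g a = H' a / M' a"
    using assms(2) unfolding hom_fraction_def by blast
  show ?thesis
    unfolding hom_fraction_def
  proof (intro exI conjI)
    show "hom_poly_fun n (d + d') (\<lambda>a. H a * H' a)" "hom_poly_fun n (d + d') (\<lambda>a. M a * M' a)"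
      by (rule hom_poly_fun_mult[OF 1(1) 2(1)], rule hom_poly_fun_mult[OF 1(2) 2(2)])
    show "\<forall>a. (\<forall>i<n. a i \<noteq> 0) \<longrightarrow> M a * M' a \<noteq> 0 \<and> f a * g a = (H a * H' a) / (M a * M' a)"
      using 1(3) 2(3) by simp
  qed
qed

lemma hom_fraction_power: "hom_fraction n f \<Longrightarrow> hom_fraction n (\<lambda>a. f a ^ k)"
  by (induction k) (simp_all add: hom_fraction_const hom_fraction_mult)

lemma hom_fraction_prod: "(\<And>j. j \<in> J \<Longrightarrow> hom_fraction n (f j)) \<Longrightarrow> hom_fraction n (\<lambda>a. \<Prod>j\<in>J. f j a)"
  by (induction J rule: infinite_finite_induct) (simp_all add: hom_fraction_const hom_fraction_mult)

lemma hom_poly_fun_coord: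
  assumes "j < n"
  shows "hom_poly_fun n 1 (\<lambda>x. x j)"
  using hom_poly_fun_monomial[of n "\<lambda>i. if i = j then 1 else 0" 1] assms
  by (simp add: prod_lessThan_single)

lemma hom_poly_fun_prod_coords: "hom_poly_fun n n (\<lambda>x. \<Prod>i<n. x i)"
  using hom_poly_fun_monomial[of n "\<lambda>_. 1" 1] by simp

lemma hom_fraction_quotient:
  assumes "i < n" and "j < n"
  shows "hom_fraction n (\<lambda>a. a i / a j)"
  unfolding hom_fraction_def
  using hom_poly_fun_coord[OF assms(1)] hom_poly_fun_coord[OF assms(2)] assms(2)
  by (intro exI[of _ "\<lambda>a. a i"] exI[of _ "\<lambda>a. a j"] exI[of _ 1]) simp

lemma hom_fraction_ratio_powi:
  assumes "i < n"
  shows "hom_fraction (Suc n) (\<lambda>a. ratios a i powi e)"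
  using assms unfolding ratios_def power_int_def
  by (cases "e \<ge> 0") (simp_all add: hom_fraction_power hom_fraction_quotient)

definition fermat_points :: "nat \<Rightarrow> proj_point set" where
  "fermat_points m = {p \<in> proj_space 3. \<forall>a\<in>p. a 0 ^ m + a 1 ^ m + a 2 ^ m + a 3 ^ m = 0}"

lemma fermat_surface_eq: "fermat_surface m = proj_fun_space 3 (fermat_points m)"
  by (simp add: fermat_surface_def fermat_points_def)

definition fermat_torus :: "nat \<Rightarrow> proj_point set" where
  "fermat_torus m = {p \<in> fermat_points m. \<forall>a\<in>p. \<forall>i<4. a i \<noteq> 0}"

lemma fermat_points_subset: "fermat_points m \<subseteq> proj_space 3"
  by (auto simp: fermat_points_def)

lemma points_fermat_surface: "points (fermat_surface m) = fermat_points m"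
  unfolding fermat_surface_eq by (rule points_proj_fun_space[OF fermat_points_subset])

lemma space_top_fermat_surface:
  "space_top (fermat_surface m) = subtopology (zariski_proj 3) (fermat_points m)"
  by (simp add: fermat_surface_eq proj_fun_space_def)

lemma fermat_ratios:
  fixes a :: "nat \<Rightarrow> complex"
  assumes "a 0 \<noteq> 0"
  shows "a 0 ^ m + a 1 ^ m + a 2 ^ m + a 3 ^ m = a 0 ^ m * (1 + (\<Sum>i<3. ratios a i ^ m))"
  using assms by (simp add: ratios_def eval_nat_numeral power_divide field_simps)

lemma fermat_torus_pointI:
  assumes "a \<in> aff_space 4" and nz: "\<And>i. i < 4 \<Longrightarrow> a i \<noteq> 0"
    and eq: "a 0 ^ m + a 1 ^ m + a 2 ^ m + a 3 ^ m = 0"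
  obtains p where "p \<in> fermat_torus m" and "p \<in> proj_space 3" and "a \<in> p"
proof -
  define p where "p = {(\<lambda>i. b * a i) | b. b \<noteq> 0}"
  have "a \<noteq> (\<lambda>i. 0)"
    using nz[of 0] by auto
  then have p: "p \<in> proj_space 3"
    unfolding p_def proj_space_def using assms(1) by (intro CollectI exI[of _ a] conjI refl) simp_all
  have ap: "a \<in> p"
    unfolding p_def by (intro CollectI exI[of _ 1]) simp
  have "(b * a 0) ^ m + (b * a 1) ^ m + (b * a 2) ^ m + (b * a 3) ^ m = 0" for b
    using arg_cong[OF eq, of "\<lambda>u. b ^ m * u"] by (simp add: power_mult_distrib algebra_simps)
  then have "p \<in> fermat_points m"
    using p unfolding fermat_points_def by (auto simp: p_def)
  then have "p \<in> fermat_torus m"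
    using nz by (auto simp: fermat_torus_def p_def)
  with p ap that show ?thesis by blast
qed

lemma fermat_torus_open: "openin (space_top (fermat_surface m)) (fermat_torus m)"
  unfolding space_top_fermat_surface openin_zariski_proj_iff[OF fermat_points_subset]
proof (intro conjI ballI)
  fix p assume p: "p \<in> fermat_torus m"
  show "\<exists>f d. hom_poly_fun (Suc 3) d f \<and> (\<forall>a\<in>p. f a \<noteq> 0) \<and>
      (\<forall>q\<in>fermat_points m. (\<forall>a\<in>q. f a \<noteq> 0) \<longrightarrow> q \<in> fermat_torus m)"
  proof (intro exI conjI)
    show "hom_poly_fun (Suc 3) (Suc 3) (\<lambda>x. \<Prod>i<Suc 3. x i)"
      by (rule hom_poly_fun_prod_coords)
  qed (use p in \<open>auto simp: fermat_torus_def\<close>)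
qed (auto simp: fermat_torus_def)

section \<open>The deck group as a group of automorphisms\<close>

text \<open>
  A surface in affine space whose torus part is the image of the torus part of the Fermat surface:
  since the \<open>i\<close>-th Laurent monomial pulls back to \<open>z\<^sub>i^m\<close>, its equation pulls back to
  \<open>1 + z\<^sub>0^m + z\<^sub>1^m + z\<^sub>2^m = 0\<close>.
\<close>

locale fermat_cover = monomial_covering +
  fixes S :: "(nat \<Rightarrow> complex) set"
  assumes S_aff: "S \<subseteq> aff_space 3"
    and S_torus: "\<And>x. x \<in> aff_space 3 \<Longrightarrow> torus_point x \<Longrightarrow>
      x \<in> S \<longleftrightarrow> 1 + (\<Sum>i<3. laurent (\<lambda>j. x j / c j) (B i)) = 0"
    and S_dense: "\<And>x f. x \<in> S \<Longrightarrow> poly_fun 3 f \<Longrightarrow> f x \<noteq> 0 \<Longrightarrow> \<exists>y\<in>S. torus_point y \<and> f y \<noteq> 0"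
begin

abbreviation S_space :: "(nat \<Rightarrow> complex) fun_space" where
  "S_space \<equiv> aff_fun_space 3 S"

definition S_torus_part :: "(nat \<Rightarrow> complex) set" where
  "S_torus_part = {x \<in> S. torus_point x}"

definition covering_map :: "proj_point \<Rightarrow> nat \<Rightarrow> complex" where
  "covering_map p = cover (chart p)"

definition deck_coords :: "(nat \<Rightarrow> int) \<Rightarrow> nat \<Rightarrow> complex" where
  "deck_coords k = case_nat 1 (deck k)"

definition deck_transformation :: "(nat \<Rightarrow> int) \<Rightarrow> proj_point \<Rightarrow> proj_point" where
  "deck_transformation k = restrict (scale_coords (deck_coords k)) (fermat_points m)"

definition deck_group :: "(proj_point \<Rightarrow> proj_point) set" where
  "deck_group = range deck_transformation"

lemma space_top_S: "space_top S_space = subtopology (zariski_aff 3) S"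
  by (simp add: aff_fun_space_def)

lemma cover_aff: "cover z \<in> aff_space 3"
  by (simp add: cover_def aff_space_def)

text \<open>
  This is \<open>B A = m\<close> written multiplicatively.
\<close>

lemma power_laurent:
  assumes "torus_point z" and "i < 3"
  shows "laurent (\<lambda>j. cover z j / c j) (B i) = z i ^ m"
proof -
  have "laurent (\<lambda>j. cover z j / c j) (B i) = laurent (\<lambda>j. laurent z (A j)) (B i)"
    by (rule laurent_cong) (simp add: cover_def c_nonzero)
  also have "\<dots> = laurent z (\<lambda>l. \<Sum>j<3. B i j * A j l)"
    by (rule laurent_laurent[OF assms(1)])
  also have "\<dots> = (\<Prod>l<3. if l = i then z i ^ m else 1)"
    unfolding laurent_def using assms(2) by (intro prod.cong) (auto simp: BA)
  finally show ?thesis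
    using assms(2) by simp
qed

lemma torus_point_chart:
  assumes "p \<in> fermat_torus m"
  shows "torus_point (chart p)"
proof -
  have p: "p \<in> proj_space 3" "\<forall>a\<in>p. \<forall>i<4. a i \<noteq> 0"
    using assms fermat_points_subset by (auto simp: fermat_torus_def)
  then obtain a where "a \<in> p"
    using proj_point_nonempty by blast
  then show ?thesis
    using p by (simp add: chart_eq torus_point_def ratios_def)
qed

lemma covering_map_in_torus_part:
  assumes "p \<in> fermat_torus m"
  shows "covering_map p \<in> S_torus_part"
proof -
  have p: "p \<in> proj_space 3" "\<forall>a\<in>p. \<forall>i<4. a i \<noteq> 0"
      "\<forall>a\<in>p. a 0 ^ m + a 1 ^ m + a 2 ^ m + a 3 ^ m = 0"
    using assms by (auto simp: fermat_torus_def fermat_points_def)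
  then obtain a where a: "a \<in> p"
    using proj_point_nonempty by blast
  have t: "torus_point (chart p)"
    by (rule torus_point_chart[OF assms])
  have "a 0 \<noteq> 0"
    using p(2) a by simp
  then have "1 + (\<Sum>i<3. chart p i ^ m) = 0"
    using p(3) a fermat_ratios[of a m] by (simp add: chart_eq[OF p(1) a])
  then have "1 + (\<Sum>i<3. laurent (\<lambda>j. covering_map p j / c j) (B i)) = 0"
    unfolding covering_map_def using power_laurent[OF t] by simp
  then show ?thesis
    using S_torus[OF cover_aff torus_point_cover[OF t]] torus_point_cover[OF t]
    by (simp add: S_torus_part_def covering_map_def)
qed

lemma covering_map_surjective: "covering_map ` fermat_torus m = S_torus_part"
proof (intro equalityI subsetI)
  fix x assume "x \<in> S_torus_part"
  then have x: "x \<in> S" "torus_point x" "x \<in> aff_space 3"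
    using S_aff by (auto simp: S_torus_part_def)
  obtain z where z: "torus_point z" "\<And>j. j < 3 \<Longrightarrow> cover z j = x j"
    using cover_surjective[OF x(2)] by blast
  have cz: "cover z = x"
  proof
    show "cover z j = x j" for j
      using z(2) x(3) by (cases "j < 3") (auto simp: cover_def aff_space_def)
  qed
  then have eq: "1 + (\<Sum>i<3. z i ^ m) = 0"
    using S_torus[OF x(3,2)] x(1) power_laurent[OF z(1)] by simp
  define a where "a i = (if i < 4 then case_nat 1 z i else 0)" for i
  have ar: "ratios a i = z i" if "i < 3" for i
    using that by (auto simp: a_def ratios_def)
  have a_nz: "a i \<noteq> 0" if "i < 4" for i
    using z(1) that by (cases i) (auto simp: a_def torus_point_def)
  have "a \<in> aff_space 4"
    by (simp add: aff_space_def a_def)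
  moreover have "a 0 ^ m + a 1 ^ m + a 2 ^ m + a 3 ^ m = 0"
    using fermat_ratios[of a m] a_nz[of 0] eq ar by simp
  ultimately obtain p where "p \<in> fermat_torus m" and p: "p \<in> proj_space 3" and ap: "a \<in> p"
    using a_nz fermat_torus_pointI by blast
  moreover have "covering_map p = x"
  proof -
    have "cover (ratios a) = cover z"
      using ar by (auto simp: cover_def fun_eq_iff intro!: laurent_cong)
    then show ?thesis
      by (simp add: covering_map_def chart_eq[OF p ap] cz)
  qed
  ultimately show "x \<in> covering_map ` fermat_torus m"
    by blast
qed (use covering_map_in_torus_part in blast)

lemma deck_coords_nonzero: "deck_coords k i \<noteq> 0"
  by (simp add: deck_coords_def deck_nonzero split: nat.split)

lemma deck_coords_add: "deck_coords (\<lambda>j. k j + l j) = (\<lambda>i. deck_coords k i * deck_coords l i)"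
  by (rule ext) (simp add: deck_coords_def deck_add split: nat.split)

lemma deck_coords_zero: "deck_coords (\<lambda>j. 0) = (\<lambda>i. 1)"
  by (rule ext) (simp add: deck_coords_def deck_zero split: nat.split)

lemma deck_coords_power: "deck_coords k i ^ m = 1"
proof (cases i)
  case (Suc j)
  have "deck k j ^ m = exp (2 * of_real pi * \<i> * of_int (\<Sum>l<3. B j l * k l))"
    using m_pos by (simp add: deck_def flip: exp_of_nat_mult)
  then show ?thesis
    by (simp only: exp_2pi_int deck_coords_def Suc nat.case)
qed (simp add: deck_coords_def)

lemma scale_deck_fermat:
  assumes "p \<in> fermat_points m"
  shows "scale_coords (deck_coords k) p \<in> fermat_points m"
  using assms unfolding fermat_points_def
  by (auto simp: scale_coords_proj_space deck_coords_nonzero)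
    (auto simp: scale_coords_def power_mult_distrib deck_coords_power)

lemma deck_transformation_apply:
  "p \<in> fermat_points m \<Longrightarrow> deck_transformation k p = scale_coords (deck_coords k) p"
  by (simp add: deck_transformation_def)

lemma deck_transformation_compose:
  assumes "p \<in> fermat_points m"
  shows "deck_transformation k (deck_transformation l p) = deck_transformation (\<lambda>j. k j + l j) p"
  using assms
  by (simp add: deck_transformation_apply scale_deck_fermat scale_coords_compose deck_coords_add)

lemma deck_transformation_zero: "p \<in> fermat_points m \<Longrightarrow> deck_transformation (\<lambda>j. 0) p = p"
  by (simp add: deck_transformation_apply deck_coords_zero scale_coords_one)

lemma deck_transformation_closed: "p \<in> fermat_points m \<Longrightarrow> deck_transformation k p \<in> fermat_points m"
  by (simp add: deck_transformation_apply scale_deck_fermat)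

lemma deck_transformation_inverse:
  assumes "p \<in> fermat_points m"
  shows "deck_transformation (\<lambda>j. - k j) (deck_transformation k p) = p"
    and "deck_transformation k (deck_transformation (\<lambda>j. - k j) p) = p"
  using assms by (simp_all add: deck_transformation_compose deck_transformation_zero)

lemma deck_transformation_Bij: "deck_transformation k \<in> Bij (fermat_points m)"
proof -
  have "bij_betw (deck_transformation k) (fermat_points m) (fermat_points m)"
    by (rule bij_betw_byWitness[where f' = "deck_transformation (\<lambda>j. - k j)"])
      (auto simp: deck_transformation_inverse deck_transformation_closed)
  then show ?thesis
    by (simp add: Bij_def deck_transformation_def)
qed

lemma deck_transformation_morphism:
  "morphism (fermat_surface m) (fermat_surface m) (deck_transformation k)"
  unfolding deck_transformation_def fermat_surface_eq
  by (rule morphism_scale_coords[OF fermat_points_subset scale_deck_fermat])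

lemma deck_transformation_isomorphism:
  "isomorphism (fermat_surface m) (fermat_surface m) (deck_transformation k)"
  unfolding isomorphism_def points_fermat_surface
  using deck_transformation_morphism deck_transformation_inverse by blast

text \<open>
  The parameter vectors matter only modulo \<open>m\<close>.
\<close>

lemma finite_deck_group: "finite deck_group"
proof -
  have "deck_transformation k \<in> deck_transformation ` (PiE {..<3} (\<lambda>_. {0..<int m}))" for k
  proof -
    let ?k = "\<lambda>j. if j < 3 then k j mod int m else undefined"
    have "deck_coords ?k = deck_coords k"
      unfolding deck_coords_def deck_mod[abs_def] by simp
    then have "deck_transformation k = deck_transformation ?k"
      by (simp add: deck_transformation_def)
    moreover have "?k \<in> PiE {..<3} (\<lambda>_. {0..<int m})"
      using m_pos by (auto simp: PiE_def extensional_def)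
    ultimately show ?thesis
      by blast
  qed
  then have "deck_group \<subseteq> deck_transformation ` (PiE {..<3} (\<lambda>_. {0..<int m}))"
    by (auto simp: deck_group_def)
  then show ?thesis
    by (rule finite_subset) (intro finite_imageI finite_PiE; simp)
qed

lemma deck_transformation_mult:
  "deck_transformation k \<otimes>\<^bsub>BijGroup (fermat_points m)\<^esub> deck_transformation l =
    deck_transformation (\<lambda>j. k j + l j)"
proof -
  have "deck_transformation k \<otimes>\<^bsub>BijGroup (fermat_points m)\<^esub> deck_transformation l =
      compose (fermat_points m) (deck_transformation k) (deck_transformation l)"
    using deck_transformation_Bij by (simp add: BijGroup_def)
  also have "\<dots> = deck_transformation (\<lambda>j. k j + l j)"
  proof
    show "compose (fermat_points m) (deck_transformation k) (deck_transformation l) p =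
        deck_transformation (\<lambda>j. k j + l j) p" for p
      by (cases "p \<in> fermat_points m")
        (auto simp: compose_def deck_transformation_compose, auto simp: deck_transformation_def)
  qed
  finally show ?thesis .
qed

lemma deck_transformation_one: "deck_transformation (\<lambda>j. 0) = \<one>\<^bsub>BijGroup (fermat_points m)\<^esub>"
proof -
  have "\<one>\<^bsub>BijGroup (fermat_points m)\<^esub> = restrict (\<lambda>x. x) (fermat_points m)"
    by (simp add: BijGroup_def)
  then show ?thesis
    by (simp add: deck_transformation_def deck_coords_zero scale_coords_one cong: restrict_cong)
qed

text \<open>
  Inverses are computed in the ambient group of bijections, where they are unique.
\<close>

lemma deck_transformation_m_inv:
  "inv\<^bsub>aut_group (fermat_surface m)\<^esub> (deck_transformation k) = deck_transformation (\<lambda>j. - k j)"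
proof -
  let ?G = "BijGroup (fermat_points m)"
  interpret group ?G by (rule group_BijGroup)
  have car: "carrier ?G = Bij (fermat_points m)"
    by (simp add: BijGroup_def)
  have 1: "deck_transformation k \<otimes>\<^bsub>?G\<^esub> deck_transformation (\<lambda>j. - k j) = \<one>\<^bsub>?G\<^esub>"
      "deck_transformation (\<lambda>j. - k j) \<otimes>\<^bsub>?G\<^esub> deck_transformation k = \<one>\<^bsub>?G\<^esub>"
    by (simp_all add: deck_transformation_mult flip: deck_transformation_one)
  have "y = deck_transformation (\<lambda>j. - k j)"
    if "y \<in> Bij (fermat_points m)" "deck_transformation k \<otimes>\<^bsub>?G\<^esub> y = \<one>\<^bsub>?G\<^esub>" for y
  proof -
    have "y = (deck_transformation (\<lambda>j. - k j) \<otimes>\<^bsub>?G\<^esub> deck_transformation k) \<otimes>\<^bsub>?G\<^esub> y"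
      using that(1) 1(2) car by simp
    also have "\<dots> = deck_transformation (\<lambda>j. - k j)"
      using that deck_transformation_Bij car by (simp add: m_assoc)
    finally show ?thesis .
  qed
  then show ?thesis
    unfolding m_inv_def aut_group_def points_fermat_surface
    using 1 deck_transformation_Bij deck_transformation_isomorphism
    by (intro the_equality) auto
qed

lemma subgroup_deck_group: "subgroup deck_group (aut_group (fermat_surface m))"
proof
  show "deck_group \<subseteq> carrier (aut_group (fermat_surface m))"
    using deck_transformation_Bij deck_transformation_isomorphism
    by (auto simp: deck_group_def aut_group_def points_fermat_surface)
  fix g assume "g \<in> deck_group"
  then obtain k where k: "g = deck_transformation k"
    by (auto simp: deck_group_def)
  show "inv\<^bsub>aut_group (fermat_surface m)\<^esub> g \<in> deck_group"
    unfolding k deck_transformation_m_inv by (simp add: deck_group_def)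
  fix h assume "h \<in> deck_group"
  then obtain l where "h = deck_transformation l"
    by (auto simp: deck_group_def)
  then have "g \<otimes>\<^bsub>aut_group (fermat_surface m)\<^esub> h = deck_transformation (\<lambda>j. k j + l j)"
    by (simp add: k aut_group_def points_fermat_surface deck_transformation_mult)
  then show "g \<otimes>\<^bsub>aut_group (fermat_surface m)\<^esub> h \<in> deck_group"
    by (simp add: deck_group_def)
next
  have "\<one>\<^bsub>aut_group (fermat_surface m)\<^esub> = deck_transformation (\<lambda>j. 0)"
    by (simp add: aut_group_def points_fermat_surface deck_transformation_one)
  then show "\<one>\<^bsub>aut_group (fermat_surface m)\<^esub> \<in> deck_group"
    by (simp add: deck_group_def)
qed

lemma orbit_deck_group: "orbit_of deck_group p = range (\<lambda>k. deck_transformation k p)"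
  by (auto simp: orbit_of_def deck_group_def)

lemma orbit_refl: "p \<in> fermat_points m \<Longrightarrow> p \<in> orbit_of deck_group p"
  unfolding orbit_deck_group using deck_transformation_zero by (metis rangeI)

lemma deck_transformation_torus:
  assumes "p \<in> fermat_torus m"
  shows "deck_transformation k p \<in> fermat_torus m"
proof -
  have p: "p \<in> fermat_points m" "\<forall>a\<in>p. \<forall>i<4. a i \<noteq> 0"
    using assms by (auto simp: fermat_torus_def)
  then show ?thesis
    using deck_transformation_closed[OF p(1)]
    by (auto simp: fermat_torus_def deck_transformation_apply scale_coords_def deck_coords_nonzero)
qed

lemma chart_deck_transformation:
  assumes "p \<in> fermat_points m"
  shows "chart (deck_transformation k p) = (\<lambda>i. deck k i * chart p i)"
proof -
  have p: "p \<in> proj_space 3"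
    using assms fermat_points_subset by blast
  then obtain a where a: "a \<in> p"
    using proj_point_nonempty by blast
  have "(\<lambda>i. deck_coords k i * a i) \<in> deck_transformation k p"
    using a by (simp add: deck_transformation_apply[OF assms] scale_coords_def)
  moreover have "deck_transformation k p \<in> proj_space 3"
    using deck_transformation_closed[OF assms] fermat_points_subset by blast
  ultimately have "chart (deck_transformation k p) = ratios (\<lambda>i. deck_coords k i * a i)"
    by (rule chart_eq[rotated])
  then show ?thesis
    by (simp add: chart_eq[OF p a] ratios_def deck_coords_def fun_eq_iff)
qed

lemma covering_map_deck:
  "p \<in> fermat_points m \<Longrightarrow> covering_map (deck_transformation k p) = covering_map p"
  by (simp add: covering_map_def chart_deck_transformation cover_deck)

lemma proj_point_eqI:
  assumes "p \<in> proj_space 3" and "q \<in> proj_space 3" and "a \<in> p" and "b \<in> q"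
    and "a 0 \<noteq> 0" and "b 0 \<noteq> 0" and "\<And>i. i < 3 \<Longrightarrow> ratios a i = ratios b i"
  shows "p = q"
proof -
  have "b i = b 0 / a 0 * a i" for i
  proof (cases "i < 4")
    case True
    then show ?thesis
      using assms(5,6) assms(7)[of "i - 1"] by (cases i) (auto simp: ratios_def field_simps)
  next
    case False
    then show ?thesis
      using proj_pointD(1)[OF assms(1,3)] proj_pointD(1)[OF assms(2,4)] by (simp add: aff_space_def)
  qed
  then have "b = (\<lambda>i. b 0 / a 0 * a i)" ..
  moreover have "b 0 / a 0 \<noteq> 0"
    using assms(5,6) by simp
  ultimately have "b \<in> p"
    unfolding proj_point_eq[OF assms(1,3)] by blast
  then show ?thesis
    using proj_point_eq[OF assms(1), of b] proj_point_eq[OF assms(2,4)] by simp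
qed

lemma covering_map_fibres:
  assumes "p \<in> fermat_torus m" and "q \<in> fermat_torus m"
  shows "covering_map p = covering_map q \<longleftrightarrow> orbit_of deck_group p = orbit_of deck_group q"
proof
  have F: "p \<in> fermat_points m" "q \<in> fermat_points m"
    using assms by (auto simp: fermat_torus_def)
  {
    assume "covering_map p = covering_map q"
    then obtain k where k: "\<And>i. i < 3 \<Longrightarrow> chart q i = deck k i * chart p i"
      unfolding covering_map_def
      using cover_fibres[OF torus_point_chart[OF assms(1)] torus_point_chart[OF assms(2)]] by blast
    have q: "q = deck_transformation k p"
    proof -
      let ?p = "deck_transformation k p"
      have t: "?p \<in> fermat_torus m"
        by (rule deck_transformation_torus[OF assms(1)])
      then have P: "?p \<in> proj_space 3" "q \<in> proj_space 3"
        using assms(2) by (auto simp: fermat_torus_def fermat_points_def)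
      then obtain a b where ab: "a \<in> ?p" "b \<in> q"
        using proj_point_nonempty by metis
      then have "a 0 \<noteq> 0" "b 0 \<noteq> 0"
        using t assms(2) by (auto simp: fermat_torus_def)
      moreover have "ratios b i = ratios a i" if "i < 3" for i
        using k[OF that] chart_deck_transformation[OF F(1), of k] by (simp add: chart_eq[OF P(1) ab(1)] chart_eq[OF P(2) ab(2)])
      ultimately show ?thesis
        using proj_point_eqI[OF P(2,1) ab(2,1)] by blast
    qed
    have "deck_transformation l q \<in> orbit_of deck_group p" for l
      unfolding q deck_transformation_compose[OF F(1)] orbit_deck_group by blast
    moreover have "deck_transformation l p \<in> orbit_of deck_group q" for l
    proof -
      have "deck_transformation l p = deck_transformation (\<lambda>j. l j - k j) q"
        unfolding q deck_transformation_compose[OF F(1)] by simp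
      then show ?thesis
        unfolding orbit_deck_group by blast
    qed
    ultimately show "orbit_of deck_group p = orbit_of deck_group q"
      unfolding orbit_deck_group by blast
  }
  assume "orbit_of deck_group p = orbit_of deck_group q"
  then have "p \<in> orbit_of deck_group q"
    using orbit_refl[OF F(1)] by simp
  then obtain k where "p = deck_transformation k q"
    by (auto simp: orbit_deck_group)
  then show "covering_map p = covering_map q"
    using covering_map_deck[OF F(2)] by simp
qed

end

section \<open>Density of the torus part of the Fermat surface\<close>

text \<open>
  Replace the vanishing coordinates of \<open>a\<close> by a small \<open>d\<close> and compensate the change of the sum of
  \<open>m\<close>-th powers in one coordinate \<open>a\<^sub>j \<noteq> 0\<close>, using a branch of the \<open>m\<close>-th root near \<open>1\<close>. The new point
  tends to \<open>a\<close> as \<open>d\<close> tends to \<open>0\<close>, so \<open>f\<close> does not vanish at it for small \<open>d\<close>.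
\<close>

lemma fermat_equation_perturb:
  assumes m: "m > 0" and a: "a \<in> aff_space 4" "a \<noteq> (\<lambda>i. 0)"
    and eq: "a 0 ^ m + a 1 ^ m + a 2 ^ m + a 3 ^ m = 0"
    and f: "poly_fun 4 f" "f a \<noteq> 0"
  obtains b where "b \<in> aff_space 4" and "\<And>i. i < 4 \<Longrightarrow> b i \<noteq> 0"
    and "b 0 ^ m + b 1 ^ m + b 2 ^ m + b 3 ^ m = 0" and "f b \<noteq> 0"
proof -
  have sum4: "(\<Sum>i<4. u i) = u 0 + u 1 + u 2 + u 3" for u :: "nat \<Rightarrow> complex"
    by (simp add: eval_nat_numeral)
  obtain j where j: "j < 4" "a j \<noteq> 0"
    using a by (auto simp: aff_space_def fun_eq_iff) (meson not_le)
  define Z where "Z = {i. i < 4 \<and> a i = 0}"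
  define w where "w d = 1 - of_nat (card Z) * d ^ m / a j ^ m" for d :: complex
  define b where "b d i = (if i = j then a j * exp (Ln (w d) / of_nat m) else if i \<in> Z then d else a i)" for d i
  have Zj: "j \<notin> Z" "Z \<subseteq> {..<4}" "finite Z"
    using j by (auto simp: Z_def)
  have w0: "w 0 = 1"
    using m by (simp add: w_def)
  have b0: "b 0 = a"
    using m by (auto simp: b_def w0 Z_def fun_eq_iff)
  have cw: "isCont w 0"
    unfolding w_def using j by (intro continuous_intros) auto
  have b_cont: "isCont (\<lambda>d. b d i) 0" for i
  proof (cases "i = j")
    case True
    have "isCont (\<lambda>d. a j * exp (Ln (w d) / of_nat m)) 0"
      using m by (intro continuous_intros cw) (auto simp: w0)
    then show ?thesis using True by (simp add: b_def)
  next
    case False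
    then show ?thesis by (cases "i \<in> Z") (simp_all add: b_def)
  qed
  have "((\<lambda>d. f (b d)) \<longlongrightarrow> f a) (at 0)"
    by (rule tendsto_poly_fun[OF f(1)]) (use b_cont b0 in \<open>simp add: isCont_def\<close>)
  then have "eventually (\<lambda>d. f (b d) \<noteq> 0) (at 0)"
    using f(2) by (rule tendsto_imp_eventually_ne)
  moreover have "(w \<longlongrightarrow> 1) (at 0)"
    using cw by (simp add: isCont_def w0)
  then have "eventually (\<lambda>d. w d \<noteq> 0) (at 0)"
    by (rule tendsto_imp_eventually_ne) simp
  moreover have "eventually (\<lambda>d::complex. d \<noteq> 0) (at 0)"
    by (rule eventually_neq_at_within)
  ultimately have "eventually (\<lambda>d. f (b d) \<noteq> 0 \<and> w d \<noteq> 0 \<and> d \<noteq> 0) (at 0)"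
    by eventually_elim simp
  then obtain d where d: "f (b d) \<noteq> 0" "w d \<noteq> 0" "d \<noteq> 0"
    using eventually_happens[of _ "at (0::complex)"] by auto
  have bj: "b d j ^ m = a j ^ m - of_nat (card Z) * d ^ m"
    using d m j by (simp add: b_def power_mult_distrib w_def divide_simps flip: exp_of_nat_mult)
  have "(\<Sum>i<4. b d i ^ m) = (\<Sum>i<4. a i ^ m + (if i \<in> Z then d ^ m else 0) +
      (if i = j then - (of_nat (card Z) * d ^ m) else 0))"
    using bj Zj m by (intro sum.cong) (auto simp: b_def[of d i for i] Z_def)
  also have "\<dots> = (\<Sum>i<4. a i ^ m) + (\<Sum>i\<in>Z. d ^ m) - of_nat (card Z) * d ^ m"
    using j(1) Zj by (simp add: sum.distrib sum.If_cases Int_absorb1 Int_absorb2 Int_commute)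
  finally have "(\<Sum>i<4. b d i ^ m) = 0"
    using eq by (simp add: sum4)
  moreover have "b d i \<noteq> 0" if "i < 4" for i
    using that d(3) j by (auto simp: b_def Z_def)
  moreover have "b d \<in> aff_space 4"
    using a(1) j by (auto simp: aff_space_def b_def Z_def)
  ultimately show ?thesis
    using that[of "b d"] d(1) by (simp add: sum4)
qed

lemma dense_open_fermat_torus:
  assumes "m > 0"
  shows "dense_open (fermat_surface m) (fermat_torus m)"
  unfolding dense_open_iff
proof (intro conjI allI impI fermat_torus_open; elim conjE)
  fix N assume N: "openin (space_top (fermat_surface m)) N" "N \<noteq> {}"
  then obtain p where p: "p \<in> N" by blast
  have o: "openin (subtopology (zariski_proj 3) (fermat_points m)) N"
    using N(1) by (simp add: space_top_fermat_surface)
  then have "N \<subseteq> fermat_points m"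
    using openin_zariski_proj_iff[OF fermat_points_subset] by blast
  with p have pF: "p \<in> proj_space 3" "\<forall>a\<in>p. a 0 ^ m + a 1 ^ m + a 2 ^ m + a 3 ^ m = 0"
    by (auto simp: fermat_points_def)
  obtain f d where f: "hom_poly_fun (Suc 3) d f" "\<forall>a\<in>p. f a \<noteq> 0"
      "\<forall>q\<in>fermat_points m. (\<forall>a\<in>q. f a \<noteq> 0) \<longrightarrow> q \<in> N"
    using o p unfolding openin_zariski_proj_iff[OF fermat_points_subset] by blast
  obtain a where a: "a \<in> p"
    using pF(1) proj_point_nonempty by blast
  have "poly_fun 4 f"
    using hom_poly_fun_imp_poly_fun[OF f(1)] by simp
  moreover have "a \<in> aff_space 4" "a \<noteq> (\<lambda>i. 0)"
    using proj_pointD[OF pF(1) a] by simp_all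
  ultimately obtain b where b: "b \<in> aff_space 4" "\<And>i. i < 4 \<Longrightarrow> b i \<noteq> 0"
      "b 0 ^ m + b 1 ^ m + b 2 ^ m + b 3 ^ m = 0" "f b \<noteq> 0"
    using fermat_equation_perturb[OF assms, of a f] pF(2) f(2) a by blast
  obtain q where q: "q \<in> fermat_torus m" "q \<in> proj_space 3" "b \<in> q"
    using fermat_torus_pointI[OF b(1,2,3)] by blast
  have "\<forall>a\<in>q. f a \<noteq> 0"
    using hom_poly_fun_nonzero_iff[OF f(1) q(2,3)] b(4) by simp
  then have "q \<in> N"
    using f(3) q(1) by (auto simp: fermat_torus_def)
  with q(1) show "fermat_torus m \<inter> N \<noteq> {}"
    by blast
qed

section \<open>Descent of open sets and regular functions\<close>

context fermat_cover
begin

lemma covering_map_preimage: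
  assumes "x \<in> S_torus_part"
  obtains p where "p \<in> fermat_torus m" and "covering_map p = x"
proof -
  have "x \<in> covering_map ` fermat_torus m"
    using assms by (simp add: covering_map_surjective)
  then show ?thesis
    by (elim imageE) (rule that, simp_all)
qed

lemma dense_open_S_torus_part: "dense_open S_space S_torus_part"
  unfolding dense_open_iff space_top_S
proof (intro conjI allI impI; (elim conjE)?)
  show "openin (subtopology (zariski_aff 3) S) S_torus_part"
    unfolding openin_zariski_aff_iff[OF S_aff]
  proof (intro conjI ballI)
    fix x assume x: "x \<in> S_torus_part"
    have "poly_fun 3 (\<lambda>x. \<Prod>i<3. x i)"
      by (intro poly_fun_intros) simp
    then show "\<exists>f. poly_fun 3 f \<and> f x \<noteq> 0 \<and> (\<forall>a\<in>S. f a \<noteq> 0 \<longrightarrow> a \<in> S_torus_part)"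
      using x by (intro exI[of _ "\<lambda>x. \<Prod>i<3. x i"]) (auto simp: S_torus_part_def torus_point_def)
  qed (auto simp: S_torus_part_def)
  fix N assume N: "openin (subtopology (zariski_aff 3) S) N" "N \<noteq> {}"
  then obtain x where x: "x \<in> N" by blast
  then obtain f where f: "poly_fun 3 f" "f x \<noteq> 0" "\<forall>a\<in>S. f a \<noteq> 0 \<longrightarrow> a \<in> N" and "N \<subseteq> S"
    using N(1) unfolding openin_zariski_aff_iff[OF S_aff] by blast
  then obtain y where "y \<in> S" "torus_point y" "f y \<noteq> 0"
    using S_dense[of x f] x by blast
  then show "S_torus_part \<inter> N \<noteq> {}"
    using f(3) by (auto simp: S_torus_part_def)
qed

lemma poly_fun_pullback:
  assumes "poly_fun 3 P"
  obtains H M d where "hom_poly_fun 4 d H" and "hom_poly_fun 4 d M"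
    and "\<And>p a. p \<in> fermat_torus m \<Longrightarrow> a \<in> p \<Longrightarrow> M a \<noteq> 0 \<and> P (covering_map p) = H a / M a"
proof -
  have "hom_fraction 4 (\<lambda>a. P (cover (ratios a)))"
    using assms
  proof (induction rule: poly_fun_induct)
    case (coord j)
    have "hom_fraction 4 (\<lambda>a. c j * (\<Prod>i<3. ratios a i powi A j i))"
      by (intro hom_fraction_mult hom_fraction_const hom_fraction_prod)
        (use hom_fraction_ratio_powi[of _ 3] in simp)
    with coord show ?case
      by (simp add: cover_def laurent_def)
  qed (simp_all add: hom_fraction_const hom_fraction_add hom_fraction_mult)
  then obtain H M d where H: "hom_poly_fun 4 d H" "hom_poly_fun 4 d M"
      "\<forall>a. (\<forall>i<4. a i \<noteq> 0) \<longrightarrow> M a \<noteq> 0 \<and> P (cover (ratios a)) = H a / M a"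
    unfolding hom_fraction_def by blast
  show ?thesis
  proof
    fix p a assume p: "p \<in> fermat_torus m" "a \<in> p"
    then have "p \<in> proj_space 3" "\<forall>i<4. a i \<noteq> 0"
      by (auto simp: fermat_torus_def fermat_points_def)
    then show "M a \<noteq> 0 \<and> P (covering_map p) = H a / M a"
      using H(3) p(2) by (simp add: covering_map_def chart_eq)
  qed (use H in simp_all)
qed

lemma openin_preimage:
  assumes "openin (space_top S_space) V" and "V \<subseteq> S_torus_part"
  shows "openin (space_top (fermat_surface m)) {p \<in> fermat_torus m. covering_map p \<in> V}"
  unfolding space_top_fermat_surface openin_zariski_proj_iff[OF fermat_points_subset]
proof (intro conjI ballI)
  fix p assume "p \<in> {p \<in> fermat_torus m. covering_map p \<in> V}"
  then have p: "p \<in> fermat_torus m" "covering_map p \<in> V" by auto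
  then obtain P where P: "poly_fun 3 P" "P (covering_map p) \<noteq> 0" "\<forall>x\<in>S. P x \<noteq> 0 \<longrightarrow> x \<in> V"
    using assms(1) unfolding space_top_S openin_zariski_aff_iff[OF S_aff] by blast
  obtain H M d where H: "hom_poly_fun 4 d H"
      "\<And>p a. p \<in> fermat_torus m \<Longrightarrow> a \<in> p \<Longrightarrow> M a \<noteq> 0 \<and> P (covering_map p) = H a / M a"
    using poly_fun_pullback[OF P(1)] by metis
  show "\<exists>f d. hom_poly_fun (Suc 3) d f \<and> (\<forall>a\<in>p. f a \<noteq> 0) \<and>
      (\<forall>q\<in>fermat_points m. (\<forall>a\<in>q. f a \<noteq> 0) \<longrightarrow> q \<in> {p \<in> fermat_torus m. covering_map p \<in> V})"
  proof (intro exI conjI ballI impI)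
    \<comment> \<open>The product of the coordinates confines the basic open set to the torus part.\<close>
    show "hom_poly_fun (Suc 3) (d + 4) (\<lambda>a. H a * (\<Prod>i<4. a i))"
      using hom_poly_fun_mult[OF H(1) hom_poly_fun_prod_coords] by simp
    fix a assume a: "a \<in> p"
    have "\<forall>i<4. a i \<noteq> 0"
      using p(1) a by (auto simp: fermat_torus_def)
    then show "H a * (\<Prod>i<4. a i) \<noteq> 0"
      using H(2)[OF p(1) a] P(2) by auto
  next
    fix q assume q: "q \<in> fermat_points m" "\<forall>a\<in>q. H a * (\<Prod>i<4. a i) \<noteq> 0"
    then have t: "q \<in> fermat_torus m"
      by (auto simp: fermat_torus_def)
    obtain a where a: "a \<in> q"
      using q(1) fermat_points_subset proj_point_nonempty by blast
    have "P (covering_map q) \<noteq> 0"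
      using H(2)[OF t a] q(2) a by auto
    moreover have "covering_map q \<in> S"
      using covering_map_in_torus_part[OF t] by (simp add: S_torus_part_def)
    ultimately show "q \<in> {p \<in> fermat_torus m. covering_map p \<in> V}"
      using P(3) t by simp
  qed
qed (auto simp: fermat_torus_def)

text \<open>
  The descent of fractions, carried over to homogeneous polynomials: \<open>f\<close> and \<open>g\<close> have the same degree,
  so dehomogenizing divides both by the same power of \<open>a\<^sub>0\<close>.
\<close>

lemma hom_fraction_descends:
  assumes f: "hom_poly_fun 4 d f" and g: "hom_poly_fun 4 d g"
    and p: "p \<in> fermat_torus m" "\<forall>a\<in>p. g a \<noteq> 0"
  shows "\<exists>P Q. poly_fun 3 P \<and> poly_fun 3 Q \<and> Q (covering_map p) \<noteq> 0 \<and>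
    (\<forall>q r. q \<in> fermat_torus m \<and> (\<forall>k. \<forall>a\<in>deck_transformation k q. r * g a = f a) \<longrightarrow>
      r * Q (covering_map q) = P (covering_map q))"
proof -
  have torusD: "q \<in> proj_space 3 \<and> (\<exists>a. a \<in> q) \<and> (\<forall>a\<in>q. a 0 \<noteq> 0)" if "q \<in> fermat_torus m" for q
    using that proj_point_nonempty by (auto simp: fermat_torus_def fermat_points_def)
  have deh: "poly_fun 3 (dehomogenize f)" "poly_fun 3 (dehomogenize g)"
    using hom_poly_fun_imp_poly_fun[OF f] hom_poly_fun_imp_poly_fun[OF g]
    by (auto intro!: poly_fun_dehomogenize)
  obtain a where a: "a \<in> p" "a 0 \<noteq> 0" "chart p = ratios a"
    using torusD[OF p(1)] chart_eq[of p] by blast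
  then have nz: "dehomogenize g (chart p) \<noteq> 0"
    using p(2) hom_poly_fun_dehomogenize[OF g, of a] by auto
  obtain P Q where PQ: "poly_fun 3 P \<and> poly_fun 3 Q \<and> Q (cover (chart p)) \<noteq> 0 \<and>
      (\<forall>z r. torus_point z \<and> (\<forall>k. r * dehomogenize g (\<lambda>i. deck k i * z i) =
        dehomogenize f (\<lambda>i. deck k i * z i)) \<longrightarrow> r * Q (cover z) = P (cover z))"
    using invariant_fraction_descends[OF deh torus_point_chart[OF p(1)] nz] by (elim exE)
  show ?thesis
  proof (intro exI conjI allI impI; (elim conjE)?)
    show "poly_fun 3 P" "poly_fun 3 Q" "Q (covering_map p) \<noteq> 0"
      using PQ by (simp_all add: covering_map_def)
    fix q r assume q: "q \<in> fermat_torus m"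
      and r: "\<forall>k. \<forall>a\<in>deck_transformation k q. r * g a = f a"
    have "r * dehomogenize g (\<lambda>i. deck k i * chart q i) = dehomogenize f (\<lambda>i. deck k i * chart q i)" for k
    proof -
      have t: "deck_transformation k q \<in> fermat_torus m"
        by (rule deck_transformation_torus[OF q])
      then obtain b where b: "b \<in> deck_transformation k q" "b 0 \<noteq> 0"
        using torusD by blast
      have "ratios b = (\<lambda>i. deck k i * chart q i)"
        using chart_deck_transformation[of q k] chart_eq[of _ 3 b] torusD[OF t] b(1) q
        by (auto simp: fermat_torus_def)
      moreover have "b 0 ^ d * (r * dehomogenize g (ratios b)) = b 0 ^ d * dehomogenize f (ratios b)"
      proof -
        have "r * g b = f b"
          using r b(1) by blast
        then show ?thesis
          using b(2) by (simp add: hom_poly_fun_dehomogenize[OF f, of b] hom_poly_fun_dehomogenize[OF g, of b]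
              mult.left_commute)
      qed
      ultimately show ?thesis
        using b(2) by simp
    qed
    then show "r * Q (covering_map q) = P (covering_map q)"
      unfolding covering_map_def using PQ torus_point_chart[OF q] by simp
  qed
qed

text \<open>
  Let \<open>f\<close> be nonzero at a point over \<open>x\<close> and vanish on the Fermat surface outside the preimage of
  \<open>V\<close>. The orbits over points outside \<open>V\<close> avoid the preimage, so \<open>f\<close> vanishes on them, and the
  polynomial \<open>Q\<close> obtained by descent vanishes on the torus part outside \<open>V\<close> but not at \<open>x\<close>.
\<close>

lemma openin_image:
  assumes V: "V \<subseteq> S_torus_part"
    and o: "openin (space_top (fermat_surface m)) {p \<in> fermat_torus m. covering_map p \<in> V}"
  shows "openin (space_top S_space) V"
  unfolding space_top_S openin_zariski_aff_iff[OF S_aff]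
proof (intro conjI ballI)
  show "V \<subseteq> S"
    using V by (auto simp: S_torus_part_def)
  fix x assume "x \<in> V"
  then obtain p where p: "p \<in> fermat_torus m" "covering_map p = x"
    using V covering_map_preimage[of x] by (metis subsetD)
  then have "p \<in> {p \<in> fermat_torus m. covering_map p \<in> V}"
    using \<open>x \<in> V\<close> by simp
  then obtain f d where f: "hom_poly_fun (Suc 3) d f" "\<forall>a\<in>p. f a \<noteq> 0"
      "\<forall>q\<in>fermat_points m. (\<forall>a\<in>q. f a \<noteq> 0) \<longrightarrow> q \<in> {p \<in> fermat_torus m. covering_map p \<in> V}"
    using o unfolding space_top_fermat_surface openin_zariski_proj_iff[OF fermat_points_subset] by blast
  have f4: "hom_poly_fun 4 d f"
    using f(1) by simp
  have "hom_poly_fun 4 d (\<lambda>a. f a * 0)"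
    using hom_poly_fun_mult[OF f4 hom_poly_fun_const[of 4 0]] by simp
  from hom_fraction_descends[OF this f4 p(1) f(2)]
  obtain P Q where "poly_fun 3 P \<and> poly_fun 3 Q \<and> Q (covering_map p) \<noteq> 0 \<and>
    (\<forall>q r. q \<in> fermat_torus m \<and> (\<forall>k. \<forall>a\<in>deck_transformation k q. r * f a = f a * 0) \<longrightarrow>
      r * Q (covering_map q) = P (covering_map q))"
    by (elim exE)
  then have Q: "poly_fun 3 Q" "Q (covering_map p) \<noteq> 0"
    and PQ: "\<And>q r. q \<in> fermat_torus m \<Longrightarrow> \<forall>k. \<forall>a\<in>deck_transformation k q. r * f a = f a * 0 \<Longrightarrow>
      r * Q (covering_map q) = P (covering_map q)"
    by simp_all
  \<comment> \<open>The factor \<open>y\<^sub>0 y\<^sub>1 y\<^sub>2\<close> confines the basic open set to the torus part.\<close>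
  have "y \<in> V" if y: "y \<in> S" "Q y * (\<Prod>i<3. y i) \<noteq> 0" for y
  proof (rule ccontr)
    assume yV: "y \<notin> V"
    have "y \<in> S_torus_part"
      using y by (auto simp: S_torus_part_def torus_point_def)
    then obtain q where q: "q \<in> fermat_torus m" "covering_map q = y"
      using covering_map_preimage[of y] by metis
    have qF: "q \<in> fermat_points m"
      using q(1) by (simp add: fermat_torus_def)
    have vanish: "f a = 0" if "a \<in> deck_transformation k q" for k a
    proof -
      have "deck_transformation k q \<in> fermat_points m"
        by (rule deck_transformation_closed[OF qF])
      moreover have "covering_map (deck_transformation k q) \<notin> V"
        using yV q(2) covering_map_deck[OF qF] by simp
      ultimately have "\<not> (\<forall>a\<in>deck_transformation k q. f a \<noteq> 0)" "deck_transformation k q \<in> proj_space 3"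
        using f(3) fermat_points_subset by blast+
      then show ?thesis
        using hom_poly_fun_nonzero_iff[OF f4 _ that, of 3] by blast
    qed
    \<comment> \<open>Both values \<open>r = 0\<close> and \<open>r = 1\<close> fit an orbit on which \<open>f\<close> vanishes.\<close>
    have "0 * Q (covering_map q) = P (covering_map q)" "1 * Q (covering_map q) = P (covering_map q)"
      by (rule PQ[OF q(1)]; simp add: vanish)+
    then show False
      using y(2) q(2) by simp
  qed
  moreover have "poly_fun 3 (\<lambda>y. Q y * (\<Prod>i<3. y i))"
    using Q(1) by (intro poly_fun_intros) simp_all
  moreover have "Q x * (\<Prod>i<3. x i) \<noteq> 0"
    using Q(2) p V \<open>x \<in> V\<close> by (auto simp: S_torus_part_def torus_point_def)
  ultimately show "\<exists>f. poly_fun 3 f \<and> f x \<noteq> 0 \<and> (\<forall>a\<in>S. f a \<noteq> 0 \<longrightarrow> a \<in> V)"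
    by (intro exI[of _ "\<lambda>y. Q y * (\<Prod>i<3. y i)"]) simp
qed

lemma regular_preimage:
  assumes V: "V \<subseteq> S_torus_part" and r: "regular S_space V h"
  shows "regular (fermat_surface m) {p \<in> fermat_torus m. covering_map p \<in> V} (h \<circ> covering_map)"
  unfolding fermat_surface_eq regular_proj_iff
proof
  fix p assume "p \<in> {p \<in> fermat_torus m. covering_map p \<in> V}"
  then have p: "p \<in> fermat_torus m" "covering_map p \<in> V" by auto
  obtain W f g where W: "openin (subtopology (zariski_aff 3) S) W" "covering_map p \<in> W" "W \<subseteq> V"
      "poly_fun 3 f" "poly_fun 3 g" "\<And>x. x \<in> W \<Longrightarrow> g x \<noteq> 0 \<and> h x = f x / g x"
    using regular_affE[OF r p(2)] by metis
  obtain H M d where H: "hom_poly_fun 4 d H" "hom_poly_fun 4 d M"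
      "\<And>p a. p \<in> fermat_torus m \<Longrightarrow> a \<in> p \<Longrightarrow> M a \<noteq> 0 \<and> f (covering_map p) = H a / M a"
    using poly_fun_pullback[OF W(4)] by metis
  obtain H' M' d' where H': "hom_poly_fun 4 d' H'" "hom_poly_fun 4 d' M'"
      "\<And>p a. p \<in> fermat_torus m \<Longrightarrow> a \<in> p \<Longrightarrow> M' a \<noteq> 0 \<and> g (covering_map p) = H' a / M' a"
    using poly_fun_pullback[OF W(5)] by metis
  let ?W = "{p \<in> fermat_torus m. covering_map p \<in> W}"
  show "\<exists>W g h' d. openin (subtopology (zariski_proj 3) (fermat_points m)) W \<and> p \<in> W \<and>
      W \<subseteq> {p \<in> fermat_torus m. covering_map p \<in> V} \<and>
      hom_poly_fun (Suc 3) d g \<and> hom_poly_fun (Suc 3) d h' \<and>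
      (\<forall>q\<in>W. \<forall>a\<in>q. h' a \<noteq> 0 \<and> (h \<circ> covering_map) q = g a / h' a)"
  proof (intro exI conjI ballI)
    show "openin (subtopology (zariski_proj 3) (fermat_points m)) ?W"
      using openin_preimage[of W] W(1,3) V by (simp add: space_top_S space_top_fermat_surface)
    show "p \<in> ?W" "?W \<subseteq> {p \<in> fermat_torus m. covering_map p \<in> V}"
      using p W(2,3) by auto
    show "hom_poly_fun (Suc 3) (d + d') (\<lambda>a. H a * M' a)" "hom_poly_fun (Suc 3) (d + d') (\<lambda>a. M a * H' a)"
      using hom_poly_fun_mult[OF H(1) H'(2)] hom_poly_fun_mult[OF H(2) H'(1)] by simp_all
    fix q a assume q: "q \<in> ?W" and a: "a \<in> q"
    then have q': "q \<in> fermat_torus m" "covering_map q \<in> W"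
      by simp_all
    note H(3)[OF q'(1) a] H'(3)[OF q'(1) a] W(6)[OF q'(2)]
    then show "M a * H' a \<noteq> 0" "(h \<circ> covering_map) q = H a * M' a / (M a * H' a)"
      by auto
  qed
qed

text \<open>
  Near a point over \<open>x\<close> the pullback of \<open>h\<close> is a fraction \<open>g / g'\<close>, but only on an open set \<open>W\<close> that
  need not be a union of orbits. Multiplying both polynomials by an \<open>f\<close> that vanishes outside \<open>W\<close>
  makes \<open>h g' f = g f\<close> true on the whole preimage of \<open>V\<close>, hence on entire orbits, as descent requires.
\<close>

lemma regular_image:
  assumes V: "V \<subseteq> S_torus_part" "openin (space_top S_space) V"
    and r: "regular (fermat_surface m) {p \<in> fermat_torus m. covering_map p \<in> V} (h \<circ> covering_map)"
  shows "regular S_space V h"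
  unfolding regular_aff_iff
proof
  fix x assume x: "x \<in> V"
  then obtain p where p: "p \<in> fermat_torus m" "covering_map p = x"
    using V covering_map_preimage[of x] by (metis subsetD)
  then have pV: "p \<in> {p \<in> fermat_torus m. covering_map p \<in> V}"
    using x by simp
  obtain W g g' d where "openin (subtopology (zariski_proj 3) (fermat_points m)) W \<and> p \<in> W \<and>
      W \<subseteq> {p \<in> fermat_torus m. covering_map p \<in> V} \<and>
      hom_poly_fun (Suc 3) d g \<and> hom_poly_fun (Suc 3) d g' \<and>
      (\<forall>q\<in>W. \<forall>a\<in>q. g' a \<noteq> 0 \<and> (h \<circ> covering_map) q = g a / g' a)"
    using bspec[OF r[unfolded fermat_surface_eq regular_proj_iff] pV] by (elim exE)
  then have W: "openin (subtopology (zariski_proj 3) (fermat_points m)) W" "p \<in> W"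
      "W \<subseteq> {p \<in> fermat_torus m. covering_map p \<in> V}"
      "hom_poly_fun (Suc 3) d g" "hom_poly_fun (Suc 3) d g'"
      "\<And>q a. q \<in> W \<Longrightarrow> a \<in> q \<Longrightarrow> g' a \<noteq> 0 \<and> h (covering_map q) = g a / g' a"
    by simp_all
  from W(1,2) obtain f e where f: "hom_poly_fun (Suc 3) e f" "\<forall>a\<in>p. f a \<noteq> 0"
      "\<forall>q\<in>fermat_points m. (\<forall>a\<in>q. f a \<noteq> 0) \<longrightarrow> q \<in> W"
    unfolding openin_zariski_proj_iff[OF fermat_points_subset] by blast
  have hom: "hom_poly_fun 4 (d + e) (\<lambda>a. g a * f a)" "hom_poly_fun 4 (d + e) (\<lambda>a. g' a * f a)"
    using hom_poly_fun_mult[OF W(4) f(1)] hom_poly_fun_mult[OF W(5) f(1)] by simp_all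
  have nz: "\<forall>a\<in>p. g' a * f a \<noteq> 0"
    using W(6)[OF W(2)] f(2) by simp
  obtain P Q where "poly_fun 3 P \<and> poly_fun 3 Q \<and> Q (covering_map p) \<noteq> 0 \<and>
    (\<forall>q r. q \<in> fermat_torus m \<and> (\<forall>k. \<forall>a\<in>deck_transformation k q. r * (g' a * f a) = g a * f a) \<longrightarrow>
      r * Q (covering_map q) = P (covering_map q))"
    using hom_fraction_descends[OF hom p(1) nz] by (elim exE)
  then have PQ: "poly_fun 3 P" "poly_fun 3 Q" "Q (covering_map p) \<noteq> 0"
    "\<And>q r. q \<in> fermat_torus m \<Longrightarrow> \<forall>k. \<forall>a\<in>deck_transformation k q. r * (g' a * f a) = g a * f a \<Longrightarrow>
      r * Q (covering_map q) = P (covering_map q)"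
    by simp_all
  have eq: "h y * Q y = P y" if y: "y \<in> V" for y
  proof -
    obtain q where q: "q \<in> fermat_torus m" "covering_map q = y"
      using y V covering_map_preimage[of y] by (metis subsetD)
    have qF: "q \<in> fermat_points m"
      using q(1) by (simp add: fermat_torus_def)
    have "h y * (g' a * f a) = g a * f a" if a: "a \<in> deck_transformation k q" for k a
    proof (cases "f a = 0")
      case False
      have D: "deck_transformation k q \<in> fermat_points m"
        by (rule deck_transformation_closed[OF qF])
      then have "deck_transformation k q \<in> proj_space 3"
        using fermat_points_subset by blast
      then have "\<forall>b\<in>deck_transformation k q. f b \<noteq> 0"
        using hom_poly_fun_nonzero_iff[OF f(1) _ a] False by blast
      then have "deck_transformation k q \<in> W"
        using f(3) D by blast
      from W(6)[OF this a] show ?thesis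
        using covering_map_deck[OF qF] q(2) by auto
    qed simp
    then show ?thesis
      using PQ(4)[OF q(1), of "h y"] q(2) by simp
  qed
  obtain F where F: "poly_fun 3 F" "F x \<noteq> 0" "\<forall>a\<in>S. F a \<noteq> 0 \<longrightarrow> a \<in> V"
    using V(2) x unfolding space_top_S openin_zariski_aff_iff[OF S_aff] by blast
  have VS: "V \<subseteq> S"
    using V(1) by (auto simp: S_torus_part_def)
  show "\<exists>W g k. openin (subtopology (zariski_aff 3) S) W \<and> x \<in> W \<and> W \<subseteq> V \<and>
     poly_fun 3 g \<and> poly_fun 3 k \<and> (\<forall>a\<in>W. k a \<noteq> 0 \<and> h a = g a / k a)"
  proof (intro exI conjI ballI)
    show "openin (subtopology (zariski_aff 3) S) {y \<in> V. Q y \<noteq> 0}"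
      unfolding openin_zariski_aff_iff[OF S_aff]
    proof (intro conjI ballI)
      fix y assume y: "y \<in> {y \<in> V. Q y \<noteq> 0}"
      then obtain F where F: "poly_fun 3 F" "F y \<noteq> 0" "\<forall>a\<in>S. F a \<noteq> 0 \<longrightarrow> a \<in> V"
        using V(2) unfolding space_top_S openin_zariski_aff_iff[OF S_aff] by blast
      then show "\<exists>f. poly_fun 3 f \<and> f y \<noteq> 0 \<and> (\<forall>a\<in>S. f a \<noteq> 0 \<longrightarrow> a \<in> {y \<in> V. Q y \<noteq> 0})"
        using y poly_fun_mult[OF F(1) PQ(2)] by (intro exI[of _ "\<lambda>y. F y * Q y"]) simp
    qed (use VS in blast)
    show "x \<in> {y \<in> V. Q y \<noteq> 0}" "{y \<in> V. Q y \<noteq> 0} \<subseteq> V"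
      using x p(2) PQ(3) by auto
    show "poly_fun 3 P" "poly_fun 3 Q" by fact+
    fix y assume "y \<in> {y \<in> V. Q y \<noteq> 0}"
    then show "Q y \<noteq> 0" "h y = P y / Q y"
      using eq[of y] by (auto simp: eq_divide_eq)
  qed
qed

theorem birational_fermat_quotient:
  "birational S_space (quotient_space (fermat_surface m) deck_group)"
proof (rule birational_quotient[where \<Phi> = covering_map])
  show "dense_open (fermat_surface m) (fermat_torus m)"
    by (rule dense_open_fermat_torus[OF m_pos])
  show "dense_open S_space S_torus_part"
    by (rule dense_open_S_torus_part)
  show "covering_map ` fermat_torus m = S_torus_part"
    by (rule covering_map_surjective)
  show "p \<in> orbit_of deck_group p" if "p \<in> points (fermat_surface m)" for p
    using that orbit_refl by (simp add: points_fermat_surface)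
  show "orbit_of deck_group p \<subseteq> fermat_torus m" if "p \<in> fermat_torus m" for p
    using deck_transformation_torus[OF that] by (auto simp: orbit_deck_group)
  show "covering_map p = covering_map q \<longleftrightarrow> orbit_of deck_group p = orbit_of deck_group q"
    if "p \<in> fermat_torus m" "q \<in> fermat_torus m" for p q
    by (rule covering_map_fibres[OF that])
  show "openin (space_top S_space) V \<longleftrightarrow>
      openin (space_top (fermat_surface m)) {p \<in> fermat_torus m. covering_map p \<in> V}"
    if "V \<subseteq> S_torus_part" for V
    using openin_preimage openin_image that by blast
  show "regular S_space V h \<longleftrightarrow>
      regular (fermat_surface m) {p \<in> fermat_torus m. covering_map p \<in> V} (h \<circ> covering_map)"
    if "V \<subseteq> S_torus_part" "openin (space_top S_space) V" for V h
    using regular_preimage[OF that(1)] regular_image[OF that] by blast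
  show "regular (fermat_surface m) U g"
    if "\<And>p. p \<in> U \<Longrightarrow> f p = g p" "regular (fermat_surface m) U f" for U f g
    unfolding fermat_surface_eq
    by (rule regular_proj_cong[where f = f]) (use that in \<open>simp_all add: fermat_surface_eq\<close>)
qed

end

section \<open>Double planes branched along a trinomial\<close>

definition matrix_of :: "int list list \<Rightarrow> nat \<Rightarrow> nat \<Rightarrow> int" where
  "matrix_of M i j = M ! i ! j"

text \<open>
  A term \<open>(s, p, q)\<close> stands for \<open>s x^p t^q\<close>.
\<close>

definition trinomial :: "(int \<times> nat \<times> nat) list \<Rightarrow> complex \<Rightarrow> complex \<Rightarrow> complex" where
  "trinomial T x t = (\<Sum>(s, p, q)\<leftarrow>T. of_int s * x ^ p * t ^ q)"

definition double_cover :: "(complex \<Rightarrow> complex \<Rightarrow> complex) \<Rightarrow> (nat \<Rightarrow> complex) set" where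
  "double_cover R = {a \<in> aff_space 3. a 1 ^ 2 = R (a 0) (a 2)}"

text \<open>
  The two square roots \<open>\<plusminus>v\<close> of \<open>w\<close> satisfy \<open>\<bar>v - y\<bar> \<bar>-v - y\<bar> = \<bar>w - y\<^sup>2\<bar>\<close>, so one of the factors is
  at most the square root of the product.
\<close>

lemma square_root_near:
  fixes y w :: complex
  obtains y' where "y' ^ 2 = w" and "cmod (y' - y) \<le> sqrt (cmod (w - y ^ 2))"
proof -
  define v where "v = csqrt w"
  have v: "v ^ 2 = w" by (simp add: v_def)
  have "cmod (v - y) * cmod (- v - y) = cmod (w - y ^ 2)"
  proof -
    have "(v - y) * (- v - y) = - (w - y ^ 2)"
      by (simp add: algebra_simps power2_eq_square flip: v)
    then show ?thesis
      by (metis norm_minus_cancel norm_mult)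
  qed
  moreover have "cmod (v - y) * cmod (- v - y) > sqrt (cmod (w - y ^ 2)) * sqrt (cmod (w - y ^ 2))"
    if "cmod (v - y) > sqrt (cmod (w - y ^ 2))" "cmod (- v - y) > sqrt (cmod (w - y ^ 2))"
    using that by (intro mult_strict_mono) (auto intro: le_less_trans[of 0])
  ultimately have "cmod (v - y) \<le> sqrt (cmod (w - y ^ 2)) \<or> cmod (- v - y) \<le> sqrt (cmod (w - y ^ 2))"
    by (force simp: not_le)
  with v that show ?thesis
    by (metis power2_minus)
qed

lemma trinomial_zeros_finite:
  assumes "p2 < p1" and "p3 < p1"
  shows "finite {x. trinomial [(1, p1, 0), (s2, p2, q2), (s3, p3, q3)] x t = 0}"
proof -
  define P where "P = monom 1 p1 + monom (of_int s2 * t ^ q2) p2 + monom (of_int s3 * t ^ q3) p3"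
  have "poly P x = trinomial [(1, p1, 0), (s2, p2, q2), (s3, p3, q3)] x t" for x
    by (simp add: P_def trinomial_def poly_monom mult_ac)
  moreover have "coeff P p1 = 1"
    using assms by (simp add: P_def)
  then have "P \<noteq> 0" by auto
  ultimately show ?thesis
    using poly_roots_finite[of P] by simp
qed

lemma isCont_trinomial:
  shows "isCont (\<lambda>x. trinomial T x t) x" and "isCont (\<lambda>t. trinomial T x t) t"
  unfolding trinomial_def by (induction T) (auto simp: case_prod_unfold intro!: continuous_intros)

text \<open>
  Move \<open>t\<close> first and then \<open>x\<close>: for fixed \<open>t\<close> the right-hand side is monic in \<open>x\<close> and has finitely many
  zeros, which can be avoided. A nearby square root then gives a nonzero \<open>y\<close>.
\<close>

lemma double_cover_torus_approximation:
  assumes T: "T = [(1, p1, 0), (s2, p2, q2), (s3, p3, q3)]" "p2 < p1" "p3 < p1"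
    and x: "x \<in> double_cover (trinomial T)" and e: "e > 0"
  obtains y where "y \<in> double_cover (trinomial T)" and "torus_point y"
    and "\<And>i. i < 3 \<Longrightarrow> cmod (y i - x i) < e"
proof -
  let ?R = "trinomial T"
  have e2: "e ^ 2 / 2 > 0"
    using e by simp
  have "((\<lambda>t. ?R (x 0) t) \<longlongrightarrow> ?R (x 0) (x 2)) (at (x 2))"
    using isCont_trinomial(2) by (simp add: isCont_def)
  from tendstoD[OF this e2] tendstoD[OF tendsto_ident_at e] eventually_neq_at_within[of 0]
  have "eventually (\<lambda>t. dist (?R (x 0) t) (?R (x 0) (x 2)) < e ^ 2 / 2 \<and> dist t (x 2) < e \<and> t \<noteq> 0) (at (x 2))"
    by eventually_elim simp
  then obtain t where t: "dist (?R (x 0) t) (?R (x 0) (x 2)) < e ^ 2 / 2" "dist t (x 2) < e" "t \<noteq> 0"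
    using eventually_happens[of _ "at (x 2)"] by auto
  have fin: "finite {u. ?R u t = 0}"
    unfolding T(1) by (rule trinomial_zeros_finite[OF T(2,3)])
  have "eventually (\<lambda>u. \<forall>z\<in>{u. ?R u t = 0}. u \<noteq> z) (at (x 0))"
    using fin by (intro eventually_ball_finite ballI eventually_neq_at_within)
  then have nz: "eventually (\<lambda>u. ?R u t \<noteq> 0) (at (x 0))"
    by eventually_elim auto
  have "((\<lambda>u. ?R u t) \<longlongrightarrow> ?R (x 0) t) (at (x 0))"
    using isCont_trinomial(1) by (simp add: isCont_def)
  from tendstoD[OF this e2] tendstoD[OF tendsto_ident_at e] eventually_neq_at_within[of 0] nz
  have "eventually (\<lambda>u. dist (?R u t) (?R (x 0) t) < e ^ 2 / 2 \<and> dist u (x 0) < e \<and> u \<noteq> 0 \<and> ?R u t \<noteq> 0)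
      (at (x 0))"
    by eventually_elim simp
  then obtain u where u: "dist (?R u t) (?R (x 0) t) < e ^ 2 / 2" "dist u (x 0) < e" "u \<noteq> 0" "?R u t \<noteq> 0"
    using eventually_happens[of _ "at (x 0)"] by auto
  have "dist (?R u t) (?R (x 0) (x 2)) < e ^ 2"
    using u(1) t(1) dist_triangle[of "?R u t" "?R (x 0) (x 2)" "?R (x 0) t"] by simp
  then have close: "cmod (?R u t - x 1 ^ 2) < e ^ 2"
    using x by (simp add: double_cover_def dist_norm)
  obtain v where v: "v ^ 2 = ?R u t" "cmod (v - x 1) \<le> sqrt (cmod (?R u t - x 1 ^ 2))"
    using square_root_near by blast
  have "sqrt (cmod (?R u t - x 1 ^ 2)) < e"
    using real_sqrt_less_mono[OF close] e by simp
  then have v_near: "cmod (v - x 1) < e"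
    using v(2) by simp
  define y where "y i = (if i = 0 then u else if i = 1 then v else if i = 2 then t else 0)" for i :: nat
  have i3: "i = 0 \<or> i = 1 \<or> i = 2" if "i < 3" for i :: nat
    using that by linarith
  show ?thesis
  proof
    show "y \<in> double_cover ?R"
      using v(1) by (simp add: double_cover_def y_def aff_space_def)
    show "torus_point y"
      using u(3,4) t(3) v(1) by (auto simp: torus_point_def y_def dest!: i3)
    show "cmod (y i - x i) < e" if "i < 3" for i
      using i3[OF that] u(2) t(2) v_near by (auto simp: y_def dist_norm)
  qed
qed

lemma double_cover_torus_dense:
  assumes T: "T = [(1, p1, 0), (s2, p2, q2), (s3, p3, q3)]" "p2 < p1" "p3 < p1"
    and x: "x \<in> double_cover (trinomial T)" and f: "poly_fun 3 f" "f x \<noteq> 0"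
  shows "\<exists>y\<in>double_cover (trinomial T). torus_point y \<and> f y \<noteq> 0"
proof -
  have "\<exists>y. y \<in> double_cover (trinomial T) \<and> torus_point y \<and>
      (\<forall>i<3. cmod (y i - x i) < inverse (real (Suc n)))" for n
    by (rule double_cover_torus_approximation[OF T x, of "inverse (real (Suc n))"]) auto
  then obtain Y where Y: "\<And>n. Y n \<in> double_cover (trinomial T)" "\<And>n. torus_point (Y n)"
      "\<And>n i. i < 3 \<Longrightarrow> cmod (Y n i - x i) < inverse (real (Suc n))"
    by metis
  have "(\<lambda>n. Y n i) \<longlonglongrightarrow> x i" if "i < 3" for i
  proof -
    have "(\<lambda>n. Y n i - x i) \<longlonglongrightarrow> 0"
      by (rule Lim_null_comparison[OF _ LIMSEQ_inverse_real_of_nat])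
        (use Y(3)[OF that] in \<open>auto intro!: always_eventually less_imp_le\<close>)
    then show ?thesis
      by (rule LIM_zero_cancel)
  qed
  then have "(\<lambda>n. f (Y n)) \<longlonglongrightarrow> f x"
    by (rule tendsto_poly_fun[OF f(1)])
  then have "eventually (\<lambda>n. f (Y n) \<noteq> 0) sequentially"
    using f(2) by (rule tendsto_imp_eventually_ne)
  then obtain n where "f (Y n) \<noteq> 0"
    using eventually_happens[of _ sequentially] by auto
  with Y(1,2) show ?thesis by blast
qed

text \<open>
  The rows are the exponents of \<open>(x, y, t)\<close> in the terms divided by \<open>y\<^sup>2\<close>.
\<close>

definition exponent_matrix :: "(int \<times> nat \<times> nat) list \<Rightarrow> nat \<Rightarrow> nat \<Rightarrow> int" where
  "exponent_matrix T i j = (case T ! i of (s, p, q) \<Rightarrow> [int p, - 2, int q] ! j)"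

text \<open>
  The constants \<open>c\<close> must satisfy \<open>c^B\<^sub>i = -s\<^sub>i\<close> to absorb the signs; they exist because
  \<open>m B\<inverse> = A\<close> solves this system for logarithms.
\<close>

lemma double_cover_fermat_quotient:
  assumes T: "T = [(1, p1, 0), (s2, p2, q2), (s3, p3, q3)]" "p2 < p1" "p3 < p1"
    and s: "\<bar>s2\<bar> = 1" "\<bar>s3\<bar> = 1" and m: "m > 0"
    and AB: "\<forall>i<3. \<forall>k<3. (\<Sum>j<3. A i j * exponent_matrix T j k) = (if i = k then int m else 0)"
    and BA: "\<forall>i<3. \<forall>k<3. (\<Sum>j<3. exponent_matrix T i j * A j k) = (if i = k then int m else 0)"
  shows "\<exists>G. subgroup G (aut_group (fermat_surface m)) \<and> finite G \<and>
    birational (aff_fun_space 3 (double_cover (trinomial T))) (quotient_space (fermat_surface m) G)"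
proof -
  define s where "s i = fst (T ! i)" for i
  \<comment> \<open>\<open>\<pi>\<i> \<epsilon>\<close> is a logarithm of the sign \<open>- s\<close> that the constants have to produce.\<close>
  define \<epsilon> where "\<epsilon> i = (if s i = 1 then 1 else 0 :: complex)" for i
  define B where "B = exponent_matrix T"
  have sgn: "s i = 1 \<or> s i = - 1" if "i < 3" for i
  proof -
    have "i = 0 \<or> i = 1 \<or> i = 2" using that by linarith
    then show ?thesis
      using assms(4,5) by (auto simp: s_def T(1))
  qed
  define c where "c j = exp (\<Sum>k<3. of_int (A j k) * (\<epsilon> k * of_real pi * \<i> / of_nat m))" for j
  interpret monomial_covering m A B c
    by standard (use m AB BA in \<open>auto simp: B_def c_def\<close>)
  have c_power: "laurent c (B i) = - of_int (s i)" if i: "i < 3" for i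
  proof -
    have "laurent c (B i) = exp (of_int (int m) * (\<epsilon> i * of_real pi * \<i> / of_nat m))"
      unfolding c_def laurent_exp
      by (subst scalar_matrix_product_apply[where d = "int m"]) (use BA i in \<open>auto simp: B_def\<close>)
    also have "\<dots> = exp (\<epsilon> i * of_real pi * \<i>)"
      using m by simp
    also have "\<dots> = - of_int (s i)"
      using sgn[OF i] by (auto simp: \<epsilon>_def)
    finally show ?thesis .
  qed
  have sum3: "(\<Sum>i<3. u i) = u 0 + u 1 + u 2" for u :: "nat \<Rightarrow> complex"
    by (simp add: eval_nat_numeral)
  have prod3: "(\<Prod>i<3. u i) = u 0 * u 1 * u 2" for u :: "nat \<Rightarrow> complex"
    by (simp add: eval_nat_numeral)
  interpret fermat_cover m A B c "double_cover (trinomial T)"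
  proof
    show "double_cover (trinomial T) \<subseteq> aff_space 3"
      by (auto simp: double_cover_def)
    show "\<exists>y\<in>double_cover (trinomial T). torus_point y \<and> f y \<noteq> 0"
      if "x \<in> double_cover (trinomial T)" "poly_fun 3 f" "f x \<noteq> 0" for x f
      by (rule double_cover_torus_dense[OF T that])
    fix x assume x: "x \<in> aff_space 3" "torus_point x"
    then have nz: "x 1 \<noteq> 0"
      by (simp add: torus_point_def)
    have mono: "laurent (\<lambda>j. x j / c j) (B i) = - (of_int (s i) * x 0 ^ fst (snd (T ! i)) * x 2 ^ snd (snd (T ! i)) / x 1 ^ 2)"
      if i: "i < 3" for i
    proof -
      have "laurent x (B i) = x 0 ^ fst (snd (T ! i)) * x 2 ^ snd (snd (T ! i)) / x 1 ^ 2"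
        by (simp add: laurent_def prod3 B_def exponent_matrix_def case_prod_unfold power_int_minus divide_inverse
            eval_nat_numeral)
      then show ?thesis
        using sgn[OF i] by (auto simp: laurent_divide c_power[OF i])
    qed
    have "1 + (\<Sum>i<3. laurent (\<lambda>j. x j / c j) (B i)) = 1 - trinomial T (x 0) (x 2) / x 1 ^ 2"
      by (simp add: sum3 mono) (simp add: T(1) s_def trinomial_def add_divide_distrib)
    then show "x \<in> double_cover (trinomial T) \<longleftrightarrow> 1 + (\<Sum>i<3. laurent (\<lambda>j. x j / c j) (B i)) = 0"
      using x(1) nz by (auto simp: double_cover_def divide_simps)
  qed
  show ?thesis
    using subgroup_deck_group finite_deck_group birational_fermat_quotient by blast
qed

section \<open>The fifteen K3 surfaces\<close>

lemma k3_fermat_quotient: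
  assumes eq: "k3_rhs k = trinomial [(1, p1, 0), (s2, p2, q2), (s3, p3, q3)]"
    and "p2 < p1" "p3 < p1" "\<bar>s2\<bar> = 1" "\<bar>s3\<bar> = 1" "m > 0"
    and AB: "\<forall>i<3. \<forall>k<3. (\<Sum>j<3. matrix_of M i j * exponent_matrix [(1, p1, 0), (s2, p2, q2), (s3, p3, q3)] j k) =
      (if i = k then int m else 0)"
    and BA: "\<forall>i<3. \<forall>k<3. (\<Sum>j<3. exponent_matrix [(1, p1, 0), (s2, p2, q2), (s3, p3, q3)] i j * matrix_of M j k) =
      (if i = k then int m else 0)"
  shows "\<exists>G. subgroup G (aut_group (fermat_surface m)) \<and> finite G \<and>
    birational (k3_affine k) (quotient_space (fermat_surface m) G)"
proof -
  have "k3_affine k = aff_fun_space 3 (double_cover (k3_rhs k))"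
    by (simp add: k3_affine_def double_cover_def)
  then show ?thesis
    unfolding eq using double_cover_fermat_quotient[OF refl assms(2-8)] by simp
qed

lemmas k3_data_simps = k3_rhs_def trinomial_def fun_eq_iff matrix_of_def exponent_matrix_def
  All_less_Suc numeral_3_eq_3 algebra_simps

text \<open>
  In each of the following, the matrix is \<open>m B\<inverse>\<close>, where \<open>B\<close> is the exponent matrix of the equation.
\<close>

lemma k3_quotient_66:
  "\<exists>G. subgroup G (aut_group (fermat_surface 66)) \<and> finite G \<and>
    birational (k3_affine 66) (quotient_space (fermat_surface 66) G)"
  by (rule k3_fermat_quotient[where ?p1.0 = 3 and ?s2.0 = "- 1" and ?p2.0 = 0 and ?q2.0 = 12 and ?s3.0 = "- 1" and ?p3.0 = 0 and ?q3.0 = 1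
      and M = "[[22, 2, - 24], [0, 3, - 36], [0, 6, - 6]]"],
      simp_all add: k3_data_simps) (simp add: eval_nat_numeral)

lemma k3_quotient_44:
  "\<exists>G. subgroup G (aut_group (fermat_surface 44)) \<and> finite G \<and>
    birational (k3_affine 44) (quotient_space (fermat_surface 44) G)"
  by (rule k3_fermat_quotient[where ?p1.0 = 3 and ?s2.0 = "1" and ?p2.0 = 1 and ?q2.0 = 0 and ?s3.0 = "1" and ?p3.0 = 0 and ?q3.0 = 11
      and M = "[[22, - 22, 0], [11, - 33, 0], [2, - 6, 4]]"]) (simp_all add: k3_data_simps)

lemma k3_quotient_42:
  "\<exists>G. subgroup G (aut_group (fermat_surface 42)) \<and> finite G \<and>
    birational (k3_affine 42) (quotient_space (fermat_surface 42) G)"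
  by (rule k3_fermat_quotient[where ?p1.0 = 3 and ?s2.0 = "- 1" and ?p2.0 = 0 and ?q2.0 = 12 and ?s3.0 = "- 1" and ?p3.0 = 0 and ?q3.0 = 5
      and M = "[[14, 10, - 24], [0, 15, - 36], [0, 6, - 6]]"]) (simp_all add: k3_data_simps)

lemma k3_quotient_36:
  "\<exists>G. subgroup G (aut_group (fermat_surface 36)) \<and> finite G \<and>
    birational (k3_affine 36) (quotient_space (fermat_surface 36) G)"
  by (rule k3_fermat_quotient[where ?p1.0 = 3 and ?s2.0 = "- 1" and ?p2.0 = 0 and ?q2.0 = 11 and ?s3.0 = "- 1" and ?p3.0 = 0 and ?q3.0 = 5
      and M = "[[12, 10, - 22], [0, 15, - 33], [0, 6, - 6]]"]) (simp_all add: k3_data_simps)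

lemma k3_quotient_28:
  "\<exists>G. subgroup G (aut_group (fermat_surface 28)) \<and> finite G \<and>
    birational (k3_affine 28) (quotient_space (fermat_surface 28) G)"
  by (rule k3_fermat_quotient[where ?p1.0 = 3 and ?s2.0 = "1" and ?p2.0 = 1 and ?q2.0 = 0 and ?s3.0 = "1" and ?p3.0 = 0 and ?q3.0 = 7
      and M = "[[14, - 14, 0], [7, - 21, 0], [2, - 6, 4]]"]) (simp_all add: k3_data_simps)

lemma k3_quotient_12:
  "\<exists>G. subgroup G (aut_group (fermat_surface 12)) \<and> finite G \<and>
    birational (k3_affine 12) (quotient_space (fermat_surface 12) G)"
  by (rule k3_fermat_quotient[where ?p1.0 = 3 and ?s2.0 = "1" and ?p2.0 = 0 and ?q2.0 = 7 and ?s3.0 = "1" and ?p3.0 = 0 and ?q3.0 = 5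
      and M = "[[4, 10, - 14], [0, 15, - 21], [0, 6, - 6]]"]) (simp_all add: k3_data_simps)

lemma k3_quotient_9:
  "\<exists>G. subgroup G (aut_group (fermat_surface 18)) \<and> finite G \<and>
    birational (k3_affine 9) (quotient_space (fermat_surface 18) G)"
  by (rule k3_fermat_quotient[where ?p1.0 = 3 and ?s2.0 = "- 1" and ?p2.0 = 0 and ?q2.0 = 8 and ?s3.0 = "- 1" and ?p3.0 = 0 and ?q3.0 = 5
      and M = "[[6, 10, - 16], [0, 15, - 24], [0, 6, - 6]]"],
      simp_all add: k3_data_simps) (simp add: eval_nat_numeral)

lemma k3_quotient_27:
  "\<exists>G. subgroup G (aut_group (fermat_surface 54)) \<and> finite G \<and>
    birational (k3_affine 27) (quotient_space (fermat_surface 54) G)"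
  by (rule k3_fermat_quotient[where ?p1.0 = 3 and ?s2.0 = "- 1" and ?p2.0 = 0 and ?q2.0 = 10 and ?s3.0 = "- 1" and ?p3.0 = 0 and ?q3.0 = 1
      and M = "[[18, 2, - 20], [0, 3, - 30], [0, 6, - 6]]"],
      simp_all add: k3_data_simps) (simp add: eval_nat_numeral)

lemma k3_quotient_5:
  "\<exists>G. subgroup G (aut_group (fermat_surface 10)) \<and> finite G \<and>
    birational (k3_affine 5) (quotient_space (fermat_surface 10) G)"
  by (rule k3_fermat_quotient[where ?p1.0 = 3 and ?s2.0 = "1" and ?p2.0 = 1 and ?q2.0 = 3 and ?s3.0 = "- 1" and ?p3.0 = 0 and ?q3.0 = 7
      and M = "[[8, - 14, 6], [7, - 21, 9], [2, - 6, 4]]"]) (simp_all add: k3_data_simps)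

lemma k3_quotient_25:
  "\<exists>G. subgroup G (aut_group (fermat_surface 50)) \<and> finite G \<and>
    birational (k3_affine 25) (quotient_space (fermat_surface 50) G)"
  by (rule k3_fermat_quotient[where ?p1.0 = 5 and ?s2.0 = "1" and ?p2.0 = 1 and ?q2.0 = 5 and ?s3.0 = "- 1" and ?p3.0 = 0 and ?q3.0 = 0
      and M = "[[10, 0, - 10], [0, 0, - 25], [- 2, 10, - 8]]"]) (simp_all add: k3_data_simps)

lemma k3_quotient_7:
  "\<exists>G. subgroup G (aut_group (fermat_surface 14)) \<and> finite G \<and>
    birational (k3_affine 7) (quotient_space (fermat_surface 14) G)"
  by (rule k3_fermat_quotient[where ?p1.0 = 3 and ?s2.0 = "1" and ?p2.0 = 1 and ?q2.0 = 3 and ?s3.0 = "- 1" and ?p3.0 = 0 and ?q3.0 = 8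
      and M = "[[10, - 16, 6], [8, - 24, 9], [2, - 6, 4]]"]) (simp_all add: k3_data_simps)

lemma k3_quotient_11:
  "\<exists>G. subgroup G (aut_group (fermat_surface 22)) \<and> finite G \<and>
    birational (k3_affine 11) (quotient_space (fermat_surface 22) G)"
  by (rule k3_fermat_quotient[where ?p1.0 = 3 and ?s2.0 = "1" and ?p2.0 = 1 and ?q2.0 = 5 and ?s3.0 = "- 1" and ?p3.0 = 0 and ?q3.0 = 2
      and M = "[[6, 4, - 10], [- 2, 6, - 15], [- 2, 6, - 4]]"]) (simp_all add: k3_data_simps)

lemma k3_quotient_13:
  "\<exists>G. subgroup G (aut_group (fermat_surface 26)) \<and> finite G \<and>
    birational (k3_affine 13) (quotient_space (fermat_surface 26) G)"
  by (rule k3_fermat_quotient[where ?p1.0 = 3 and ?s2.0 = "1" and ?p2.0 = 1 and ?q2.0 = 5 and ?s3.0 = "- 1" and ?p3.0 = 0 and ?q3.0 = 1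
      and M = "[[8, 2, - 10], [- 1, 3, - 15], [- 2, 6, - 4]]"]) (simp_all add: k3_data_simps)

lemma k3_quotient_17:
  "\<exists>G. subgroup G (aut_group (fermat_surface 34)) \<and> finite G \<and>
    birational (k3_affine 17) (quotient_space (fermat_surface 34) G)"
  by (rule k3_fermat_quotient[where ?p1.0 = 3 and ?s2.0 = "1" and ?p2.0 = 1 and ?q2.0 = 7 and ?s3.0 = "- 1" and ?p3.0 = 0 and ?q3.0 = 2
      and M = "[[10, 4, - 14], [- 2, 6, - 21], [- 2, 6, - 4]]"]) (simp_all add: k3_data_simps)

lemma k3_quotient_19:
  "\<exists>G. subgroup G (aut_group (fermat_surface 38)) \<and> finite G \<and>
    birational (k3_affine 19) (quotient_space (fermat_surface 38) G)"
  by (rule k3_fermat_quotient[where ?p1.0 = 3 and ?s2.0 = "1" and ?p2.0 = 1 and ?q2.0 = 7 and ?s3.0 = "- 1" and ?p3.0 = 0 and ?q3.0 = 1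
      and M = "[[12, 2, - 14], [- 1, 3, - 21], [- 2, 6, - 4]]"]) (simp_all add: k3_data_simps)

theorem lemma1:
  fixes k m n :: nat and X :: "proj_point set"
  assumes "k \<in> {66, 44, 42, 36, 28, 12} \<and> m = k \<or>
           k \<in> {9, 27, 5, 25, 7, 11, 13, 17, 19} \<and> m = 2 * k"
    and "smooth_minimal_proj_model n X (k3_affine k)"
  shows "\<exists>G. subgroup G (aut_group (fermat_surface m)) \<and> finite G \<and>
           birational (proj_fun_space n X) (quotient_space (fermat_surface m) G)"
proof -
  have "\<exists>G. subgroup G (aut_group (fermat_surface m)) \<and> finite G \<and>
      birational (k3_affine k) (quotient_space (fermat_surface m) G)"
    using assms(1) k3_quotient_66 k3_quotient_44 k3_quotient_42 k3_quotient_36 k3_quotient_28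
      k3_quotient_12 k3_quotient_9 k3_quotient_27 k3_quotient_5 k3_quotient_25 k3_quotient_7
      k3_quotient_11 k3_quotient_13 k3_quotient_17 k3_quotient_19
    by (elim disjE conjE insertE) simp_all
  moreover have "birational (proj_fun_space n X) (k3_affine k)"
    using assms(2) by (simp add: smooth_minimal_proj_model_def)
  ultimately show ?thesis
    using birational_trans by blast
qed

end
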